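(* Let $X$ be a spectrally negative Lévy process (whose paths are not decreasing) with Lévy measure $\nu$ on $(0,\infty)$, such that if the paths of $X$ are of bounded variation then $\nu$ is absolutely continuous with respect to Lebesgue measure. Let $\omega$ be a discounting intensity and let $\mathcal{H}^{\omega}$ be the corresponding $\omega$-scale function. If the tail of the Lévy measure is log-convex, i.e. if the function $x\mapsto\nu(x,\infty)$ is log-convex on $(0,\infty)$, then $\mathcal{H}^{\omega\prime}$ is log-convex on $(0,\infty)$. In particular, $\mathcal{H}^{\omega\prime}$ is also convex on $(0,\infty)$.
   Context: Spectrally negative Lévy process: $X$ has Laplace exponent $$\psi(\theta)=\gamma\theta+\tfrac12\sigma^2\theta^2+\int_0^\infty\left(e^{-\theta z}-1+\theta z\mathbf 1_{(0,1]}(z)\right)\nu(dz),\quad \theta\ge0,$$ with $\gamma\in\mathbb{R}$, $\sigma\ge0$ and $\nu$ a $\sigma$-finite measure on $(0,\infty)$ satisfying $\int_0^\infty(1\wedge x^2)\nu(dx)<\infty$. The case where $X$ has decreasing paths is excluded. Scale functions: for $p\ge0$, $\Phi(p)=\sup\{\lambda\ge0:\psi(\lambda)=p\}$, and $W_p$ is the scale function vanishing on $(-\infty,0)$, continuous on $(0,\infty)$, with $\int_0^\infty e^{-\theta x}W_p(x)\,dx=(\psi(\theta)-p)^{-1}$ for all $\theta>\Phi(p)$. Discounting intensity: a function $\omega:\mathbb{R}\to[0,\infty)$ such that (i) $\omega$ is non-increasing; (ii) there exist $a\in(-\infty,0]$ and $\phi>0$ with $\omega(x)=\phi$ for all $x\in(-\infty,a)$,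 and there exists $\rho\in[0,\omega(0-)]$ with $\omega(x)=\rho$ for all $x\in[0,\infty)$; (iii) there is a finite partition $\{a_1,\dots,a_{n+1}\}$ of $[a,0]$, with $a=a_1<\dots<a_n\le a_{n+1}=0$, such that $\omega$ is absolutely continuous on each sub-interval $(a_k,a_{k+1})$, $k\in\{1,\dots,n\}$. $\omega$-scale function: $\mathcal{H}^{\omega}:\mathbb{R}\to\mathbb{R}$ is the (nonnegative, locally bounded) solution of $$\mathcal{H}^{\omega}(x)=e^{\Phi(\phi)(x-a)}+\int_a^xW_\phi(x-y)(\omega(y)-\phi)\mathcal{H}^{\omega}(y)\,dy,\quad x\in\mathbb{R},$$ where $\int_a^x=0$ if $a\ge x$. *)

theory Defs
  imports "HOL-Probability.Probability"
begin

section \<open>Notions from real analysis\<close>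

(* "log f is convex" for f >= 0 with log 0 = -infinity, written without logarithms so that f may
   vanish.  The weights 0 and 1 are left out only because 0 powr 0 = 0 in Isabelle/HOL. *)
definition log_convex_on :: "real set \<Rightarrow> (real \<Rightarrow> real) \<Rightarrow> bool" where
  "log_convex_on S f \<longleftrightarrow> convex S \<and> (\<forall>x\<in>S. 0 \<le> f x) \<and>
     (\<forall>x\<in>S. \<forall>y\<in>S. \<forall>u\<in>{0<..<1}.
        f ((1 - u) * x + u * y) \<le> f x powr (1 - u) * f y powr u)"

definition abs_continuous_on :: "real set \<Rightarrow> (real \<Rightarrow> real) \<Rightarrow> bool" where
  "abs_continuous_on S f \<longleftrightarrow>
     (\<forall>\<epsilon>>0. \<exists>\<delta>>0. \<forall>(n::nat) u v.
        (\<forall>i<n. u i \<le> v i \<and> {u i..v i} \<subseteq> S) \<and>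
        disjoint_family_on (\<lambda>i. {u i<..<v i}) {..<n} \<and>
        (\<Sum>i<n. v i - u i) < \<delta> \<longrightarrow>
        (\<Sum>i<n. \<bar>f (v i) - f (u i)\<bar>) < \<epsilon>)"

definition bounded_variation_on :: "real set \<Rightarrow> (real \<Rightarrow> real) \<Rightarrow> bool" where
  "bounded_variation_on S f \<longleftrightarrow>
     (\<exists>C. \<forall>(n::nat) t. mono_on {..n} t \<and> t ` {..n} \<subseteq> S \<longrightarrow>
        (\<Sum>i<n. \<bar>f (t (Suc i)) - f (t i)\<bar>) \<le> C)"

section \<open>Spectrally negative Levy processes\<close>

(* Processes are indexed by all reals; only times t >= 0 are meaningful. *)
definition levy_process :: "'a measure \<Rightarrow> (real \<Rightarrow> 'a \<Rightarrow> real) \<Rightarrow> bool" where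
  "levy_process M X \<longleftrightarrow>
     prob_space M \<and>
     (\<forall>t\<ge>0. X t \<in> borel_measurable M) \<and>
     (AE w in M. X 0 w = 0) \<and>
     (\<forall>(n::nat) t. mono_on {..n} t \<and> 0 \<le> t 0 \<longrightarrow>
        prob_space.indep_vars M (\<lambda>_. borel) (\<lambda>i w. X (t (Suc i)) w - X (t i) w) {..<n}) \<and>
     (\<forall>s\<ge>0. \<forall>h\<ge>0. distr M borel (\<lambda>w. X (s + h) w - X s w) = distr M borel (X h)) \<and>
     (AE w in M. (\<forall>t\<ge>0. continuous (at_right t) (\<lambda>s. X s w)) \<and>
                 (\<forall>t>0. \<exists>l. ((\<lambda>s. X s w) \<longlongrightarrow> l) (at_left t)))"

definition no_positive_jumps :: "'a measure \<Rightarrow> (real \<Rightarrow> 'a \<Rightarrow> real) \<Rightarrow> bool" where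
  "no_positive_jumps M X \<longleftrightarrow> (AE w in M. \<forall>t>0. X t w \<le> Lim (at_left t) (\<lambda>s. X s w))"

definition decreasing_paths :: "'a measure \<Rightarrow> (real \<Rightarrow> 'a \<Rightarrow> real) \<Rightarrow> bool" where
  "decreasing_paths M X \<longleftrightarrow> (AE w in M. \<forall>s\<ge>0. \<forall>t\<ge>s. X t w \<le> X s w)"

definition bounded_variation_paths :: "'a measure \<Rightarrow> (real \<Rightarrow> 'a \<Rightarrow> real) \<Rightarrow> bool" where
  "bounded_variation_paths M X \<longleftrightarrow>
     (AE w in M. \<forall>T\<ge>0. bounded_variation_on {0..T} (\<lambda>t. X t w))"

(* A Levy measure of a spectrally negative process is carried by (0,infinity): it describes the
   sizes of the downward jumps. *)
definition levy_measure :: "real measure \<Rightarrow> bool" where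
  "levy_measure \<nu> \<longleftrightarrow>
     sets \<nu> = sets (restrict_space borel {0<..}) \<and> sigma_finite_measure \<nu> \<and>
     integrable \<nu> (\<lambda>x. min 1 (x\<^sup>2))"

definition laplace_exponent :: "real \<Rightarrow> real \<Rightarrow> real measure \<Rightarrow> real \<Rightarrow> real" where
  "laplace_exponent \<gamma> \<sigma> \<nu> \<theta> = \<gamma> * \<theta> + \<sigma>\<^sup>2 * \<theta>\<^sup>2 / 2 +
     (LINT z|\<nu>. exp (- \<theta> * z) - 1 + \<theta> * z * indicator {0<..1} z)"

definition spectrally_negative_levy ::
    "'a measure \<Rightarrow> (real \<Rightarrow> 'a \<Rightarrow> real) \<Rightarrow> real \<Rightarrow> real \<Rightarrow> real measure \<Rightarrow> bool" where
  "spectrally_negative_levy M X \<gamma> \<sigma> \<nu> \<longleftrightarrow>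
     levy_process M X \<and> no_positive_jumps M X \<and> 0 \<le> \<sigma> \<and> levy_measure \<nu> \<and>
     (\<forall>t\<ge>0. \<forall>\<theta>\<ge>0. integrable M (\<lambda>w. exp (\<theta> * X t w)) \<and>
        (LINT w|M. exp (\<theta> * X t w)) = exp (t * laplace_exponent \<gamma> \<sigma> \<nu> \<theta>))"

section \<open>Scale functions\<close>

definition Phi :: "(real \<Rightarrow> real) \<Rightarrow> real \<Rightarrow> real" where
  "Phi \<psi> p = Sup {\<theta>. 0 \<le> \<theta> \<and> \<psi> \<theta> = p}"

(* The value at the single point 0 is left open; it affects none of the integrals below. *)
definition is_scale_function :: "(real \<Rightarrow> real) \<Rightarrow> real \<Rightarrow> (real \<Rightarrow> real) \<Rightarrow> bool" where
  "is_scale_function \<psi> p W \<longleftrightarrow>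
     (\<forall>x<0. W x = 0) \<and> continuous_on {0<..} W \<and>
     (\<forall>\<theta>>Phi \<psi> p. set_integrable lborel {0..} (\<lambda>x. exp (- \<theta> * x) * W x) \<and>
        (LINT x:{0..}|lborel. exp (- \<theta> * x) * W x) = inverse (\<psi> \<theta> - p))"

(* The point a and the level phi of the discounting intensity are explicit parameters because
   the omega-scale function refers to them. *)
definition discounting_intensity :: "(real \<Rightarrow> real) \<Rightarrow> real \<Rightarrow> real \<Rightarrow> bool" where
  "discounting_intensity \<omega> a \<phi> \<longleftrightarrow>
     (\<forall>x. 0 \<le> \<omega> x) \<and> antimono \<omega> \<and>
     a \<le> 0 \<and> 0 < \<phi> \<and> (\<forall>x<a. \<omega> x = \<phi>) \<and>
     (\<exists>\<rho>. 0 \<le> \<rho> \<and> \<rho> \<le> Lim (at_left 0) \<omega> \<and> (\<forall>x\<ge>0. \<omega> x = \<rho>)) \<and>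
     (\<exists>(n::nat) t. 1 \<le> n \<and> t 1 = a \<and> t (n + 1) = 0 \<and>
        strict_mono_on {1..n} t \<and> t n \<le> t (n + 1) \<and>
        (\<forall>k\<in>{1..n}. abs_continuous_on {t k<..<t (k + 1)} \<omega>))"

(* W stands for the phi-scale function.  Measurability of H is implicit in the integral equation;
   the integral over {a..x} vanishes for x <= a, as the convention requires. *)
definition is_omega_scale_function ::
    "(real \<Rightarrow> real) \<Rightarrow> (real \<Rightarrow> real) \<Rightarrow> real \<Rightarrow> real \<Rightarrow> (real \<Rightarrow> real) \<Rightarrow> (real \<Rightarrow> real) \<Rightarrow> bool" where
  "is_omega_scale_function \<psi> \<omega> a \<phi> W H \<longleftrightarrow>
     H \<in> borel_measurable borel \<and> (\<forall>x. 0 \<le> H x) \<and> (\<forall>K. compact K \<longrightarrow> bounded (H ` K)) \<and>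
     (\<forall>x. H x = exp (Phi \<psi> \<phi> * (x - a)) +
        (LINT y:{a..x}|lborel. W (x - y) * (\<omega> y - \<phi>) * H y))"

end

theory Submission
  imports Defs
begin

text \<open>A nonnegative f is log-convex iff every x \<mapsto> exp (\<beta> x) f x is convex. This condition is linear in f,
  hence inherited by mixtures and pointwise limits, and it suffices to check it for the increments
  H (x + \<eta>) - H x, which makes differentiability of H part of the conclusion.

  Write k x = \<nu> (x, \<infinity>). Up to constants, (\<psi> \<theta> - \<rho>) / \<theta> is \<sigma>^2 \<theta> / 2 minus the Laplace transform
  of the log-convex function k + \<rho>. Replacing the integral by Riemann sums on a lattice turns
  \<theta> / (\<psi> \<theta> - \<rho>) into the generating function of a renewal sequence with log-convex weights, which is
  log-convex by the theorem of de Bruijn and Erdos. Refining the lattice gives the scale function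
  W_\<rho>, with log-convex increments.

  On (0, \<infinity>) the intensity equals \<rho>, and \<omega> - \<rho> is nonnegative everywhere. Solving the equation for H
  with W_\<rho> in place of W_\<phi> therefore exhibits H as a mixture, with nonnegative weights, of the
  translates x \<mapsto> W_\<rho> (x + s), s \<ge> 0. The exponential term is such a mixture because it equals
  (\<phi> - \<rho>) times the Laplace transform of W_\<rho> at \<Phi>(\<phi>), split at x - a.\<close>

section \<open>Log-convexity through increments\<close>

text \<open>The obstacle is that \<open>k\<close> may fail to be integrable at 0, so that its
  Laplace transform is infinite. Every quantity is therefore anchored at a point \<open>t0\<close>
  with \<psi> t0 > \<rho>: only differences of (\<psi> t - \<rho>) / t are written as integrals of
  \<open>k\<close>, against exp (- t0 x) - exp (- t x), which vanishes at 0, and the value at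
  \<open>t0\<close> enters as a positive constant. The Gaussian term has no weight function of its
  own; it becomes extra mass on the first lattice site, where enlarging a log-convex sequence keeps
  it log-convex. The factor \<theta> disappears when the renewal weights are summed, since passing
  to the distribution function divides the transform by \<theta>. Replacing W_\<phi> by W_\<rho> is
  forced by signs: \<omega> - \<phi> is nonpositive, whereas \<omega> - \<rho> is nonnegative. The
  anchor is put below \<Phi>(\<phi>), so that W_\<rho> has a finite transform there.\<close>

definition log_convex_increments :: "(real \<Rightarrow> real) \<Rightarrow> bool" where
  "log_convex_increments V \<longleftrightarrow>
     (\<forall>\<eta>>0. \<forall>x>0. V x \<le> V (x + \<eta>)) \<and>
     (\<forall>\<eta>>0. \<forall>\<beta>. convex_on {0<..} (\<lambda>x. exp (\<beta> * x) * (V (x + \<eta>) - V x)))"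

lemma log_convex_increments_mono:
  "log_convex_increments V \<Longrightarrow> 0 < x \<Longrightarrow> 0 < \<eta> \<Longrightarrow> V x \<le> V (x + \<eta>)"
  by (simp add: log_convex_increments_def)

lemma convex_on_transform:
  fixes f g :: "'a::real_vector \<Rightarrow> real"
  assumes "convex_on S f" "\<And>x. x \<in> S \<Longrightarrow> f x = g x"
  shows "convex_on S g"
proof (rule convex_onI)
  show "convex S" using assms(1) by (rule convex_on_imp_convex)
  fix t :: real and x y assume t: "0 < t" "t < 1" and xy: "x \<in> S" "y \<in> S"
  moreover have "(1 - t) *\<^sub>R x + t *\<^sub>R y \<in> S"
    using \<open>convex S\<close> t xy by (simp add: convex_alt)
  ultimately show "g ((1 - t) *\<^sub>R x + t *\<^sub>R y) \<le> (1 - t) * g x + t * g y"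
    using convex_onD [OF assms(1), of t x y] by (simp add: assms(2))
qed

text \<open>For fixed endpoints each tilt \<beta> yields a weighted arithmetic bound on the
  intermediate value; the geometric bound is their infimum over \<beta>.\<close>

lemma log_convex_on_if_exp_convex:
  fixes f :: "real \<Rightarrow> real"
  assumes nonneg: "\<And>x. x > 0 \<Longrightarrow> 0 \<le> f x"
    and conv: "\<And>\<beta>. convex_on {0<..} (\<lambda>x. exp (\<beta> * x) * f x)"
  shows "log_convex_on {0<..} f"
  unfolding log_convex_on_def
proof (intro conjI ballI)
  fix x y u :: real
  assume x: "x \<in> {0<..}" and y: "y \<in> {0<..}" and u: "u \<in> {0<..<1}"
  define z where "z = (1 - u) * x + u * y"
  define c where "c = f x"
  define d where "d = f y"
  have c: "c \<ge> 0" and d: "d \<ge> 0" and z0: "f z \<ge> 0"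
    using x y u nonneg by (auto simp: c_def d_def z_def add_pos_pos intro!: nonneg)
  show "f ((1 - u) * x + u * y) \<le> f x powr (1 - u) * f y powr u"
  proof (cases "x = y")
    case True
    have "f x powr (1 - u) * f x powr u = f x"
      using c by (cases "c = 0") (auto simp: c_def powr_add [symmetric])
    then show ?thesis using True by (simp add: algebra_simps)
  next
    case False
    have key: "f z \<le> (1 - u) * (c * exp (- (u * t))) + u * (d * exp ((1 - u) * t))" for t
    proof -
      \<comment> \<open>The tilt then changes by \<open>t\<close> between x and y, so the bound
        depends on the endpoints only through \<open>c\<close>, \<open>d\<close> and
        \<open>u\<close>.\<close>
      define \<beta> where "\<beta> = t / (y - x)"
      have "exp (\<beta> * z) * f z \<le> (1 - u) * (exp (\<beta> * x) * c) + u * (exp (\<beta> * y) * d)"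
        using convex_onD [OF conv [of \<beta>], of u x y] x y u
        by (simp add: z_def c_def d_def)
      then have "exp (- (\<beta> * z)) * (exp (\<beta> * z) * f z)
          \<le> exp (- (\<beta> * z)) * ((1 - u) * (exp (\<beta> * x) * c) + u * (exp (\<beta> * y) * d))"
        by (rule mult_left_mono) simp
      also have "exp (- (\<beta> * z)) * (exp (\<beta> * z) * f z) = f z"
        by (simp add: exp_minus)
      also have "exp (- (\<beta> * z)) * ((1 - u) * (exp (\<beta> * x) * c) + u * (exp (\<beta> * y) * d))
          = (1 - u) * (c * exp (\<beta> * (x - z))) + u * (d * exp (\<beta> * (y - z)))"
        by (simp add: algebra_simps mult_exp_exp [symmetric] exp_diff exp_minus divide_inverse)
      also have "\<beta> * (x - z) = - (u * t)"
        using False by (simp add: \<beta>_def z_def field_simps)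
      also have "\<beta> * (y - z) = (1 - u) * t"
        using False by (simp add: \<beta>_def z_def field_simps)
      finally show ?thesis .
    qed
    have "f z \<le> c powr (1 - u) * d powr u"
    proof (cases "c = 0 \<or> d = 0")
      case False
      then have cd: "c > 0" "d > 0" using c d by auto
      \<comment> \<open>Minimizes the right-hand side of \<open>key\<close>: the two exponential
        terms become equal.\<close>
      define t where "t = ln c - ln d"
      have e1: "c * exp (- (u * t)) = c powr (1 - u) * d powr u"
      proof -
        have "c * exp (- (u * t)) = exp (ln c) * exp (- (u * t))" using cd by simp
        also have "\<dots> = exp ((1 - u) * ln c) * exp (u * ln d)"
          by (simp only: mult_exp_exp) (simp add: t_def algebra_simps)
        finally show ?thesis using cd by (simp add: powr_def)
      qed
      have e2: "d * exp ((1 - u) * t) = c powr (1 - u) * d powr u"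
      proof -
        have "d * exp ((1 - u) * t) = exp (ln d) * exp ((1 - u) * t)" using cd by simp
        also have "\<dots> = exp ((1 - u) * ln c) * exp (u * ln d)"
          by (simp only: mult_exp_exp) (simp add: t_def algebra_simps)
        finally show ?thesis using cd by (simp add: powr_def)
      qed
      show ?thesis using key [of t] unfolding e1 e2 by (simp add: algebra_simps)
    next
      case True
      \<comment> \<open>With exactly one endpoint value zero, the bound in \<open>key\<close> tends
        to 0 as t tends to infinity or minus infinity; the \<open>t\<close> chosen below makes it
        equal to half of \<open>f z\<close>.\<close>
      have "\<not> f z > 0"
      proof
        assume p: "f z > 0"
        show False
        proof (cases "c = 0")
          case True
          have ud: "u * d \<noteq> 0" using key [of 0] True p by auto
          then have "u * d > 0" using u d by (auto simp: less_le)
          define t where "t = ln (f z / (2 * (u * d))) / (1 - u)"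
          have "exp ((1 - u) * t) = f z / (2 * (u * d))"
            using u p \<open>u * d > 0\<close> by (simp add: t_def)
          then have "u * (d * exp ((1 - u) * t)) = f z / 2"
            using ud by simp
          with key [of t] True p show False by simp
        next
          case False
          then have d0: "d = 0" using \<open>c = 0 \<or> d = 0\<close> by simp
          have "(1 - u) * c > 0" using u c False by auto
          define t where "t = - ln (f z / (2 * ((1 - u) * c))) / u"
          have "exp (- (u * t)) = f z / (2 * ((1 - u) * c))"
            using u p \<open>(1 - u) * c > 0\<close> by (simp add: t_def)
          moreover have "u \<noteq> 1 \<and> c \<noteq> 0" using \<open>(1 - u) * c > 0\<close> by auto
          ultimately have "(1 - u) * (c * exp (- (u * t))) = f z / 2"
            by (simp only: mult.assoc [symmetric]) (simp add: field_simps)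
          with key [of t] d0 p show False by simp
        qed
      qed
      then show ?thesis using True by auto
    qed
    then show ?thesis by (simp add: z_def c_def d_def)
  qed
qed (use nonneg in auto)

lemma log_convex_on_imp_convex_on:
  assumes "log_convex_on S f"
  shows "convex_on S f"
proof (rule convex_onI)
  show "convex S" using assms by (simp add: log_convex_on_def)
  fix u x y :: real
  assume u: "0 < u" "u < 1" and xy: "x \<in> S" "y \<in> S"
  have nn: "f x \<ge> 0" "f y \<ge> 0" using assms xy by (auto simp: log_convex_on_def)
  have "f ((1 - u) * x + u * y) \<le> f x powr (1 - u) * f y powr u"
    using assms xy u by (auto simp: log_convex_on_def)
  also have "\<dots> \<le> (1 - u) * f x + u * f y"
    using Youngs_inequality_0 [of "1 - u" u "f x" "f y"] u nn
    by (cases "f x = 0 \<or> f y = 0") auto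
  finally show "f ((1 - u) *\<^sub>R x + u *\<^sub>R y) \<le> (1 - u) * f x + u * f y" by simp
qed

text \<open>If H jumped at x, continuity of its increments would make it jump at every point to the
  right of x, but a monotone function has only countably many jumps.\<close>
lemma log_convex_increments_continuous:
  assumes "log_convex_increments H"
  shows "continuous_on {0<..} H"
proof -
  have mono: "mono_on {0<..} H"
  proof (rule mono_onI)
    fix r s :: real assume "r \<in> {0<..}" "s \<in> {0<..}" "r \<le> s"
    then show "H r \<le> H s"
      using log_convex_increments_mono [OF assms, of r "s - r"] by (cases "r = s") auto
  qed
  have cnt: "countable {x \<in> {0<..}. \<not> isCont H x}"
    by (rule mono_on_ctble_discont_open [OF _ mono]) simp
  have "isCont H x" if x: "x > 0" for x
  proof (rule ccontr)
    assume n: "\<not> isCont H x"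
    have "y \<in> {x \<in> {0<..}. \<not> isCont H x}" if y: "y \<in> {x<..<x + 1}" for y
    proof -
      define \<eta> where "\<eta> = y - x"
      have \<eta>: "\<eta> > 0" using y by (simp add: \<eta>_def)
      have "convex_on {0<..} (\<lambda>x. exp (0 * x) * (H (x + \<eta>) - H x))"
        using assms \<eta> unfolding log_convex_increments_def by blast
      then have "continuous_on {0<..} (\<lambda>x. exp (0 * x) * (H (x + \<eta>) - H x))"
        by (rule convex_on_continuous [rotated]) simp
      then have c1: "isCont (\<lambda>x. H (x + \<eta>) - H x) x"
        using x by (simp add: continuous_on_eq_continuous_at)
      have "\<not> isCont H y"
      proof
        assume "isCont H y"
        then have "isCont (\<lambda>x. H (x + \<eta>)) x"
          by (intro isCont_o2 [where f = "\<lambda>x. x + \<eta>" and g = H]) (auto simp: \<eta>_def)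
        then have "isCont (\<lambda>x. H (x + \<eta>) - (H (x + \<eta>) - H x)) x"
          using c1 by (rule continuous_diff)
        then show False using n by simp
      qed
      then show ?thesis using y x by auto
    qed
    then have "countable {x<..<x + 1}" using cnt by (meson countable_subset subsetI)
    then show False using uncountable_open_interval [of x "x + 1"] by simp
  qed
  then show ?thesis by (simp add: continuous_at_imp_continuous_on)
qed

text \<open>Midpoint convexity of the increments makes symmetric difference quotients decrease when
  the step is halved, so they converge at every point. A symmetric derivative alone does not give
  differentiability; it is upgraded by showing that H is an integral of the limit \<open>g\<close>,
  which is continuous because it is convex.\<close>

lemma log_convex_increments_deriv:
  assumes lc: "log_convex_increments H"
  obtains g where "\<And>x. x > 0 \<Longrightarrow> (H has_real_derivative g x) (at x)"
    "\<And>x. x > 0 \<Longrightarrow> g x \<ge> 0" "\<And>\<beta>. convex_on {0<..} (\<lambda>x. exp (\<beta> * x) * g x)"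
proof -
  define A where "A = (\<lambda>\<eta> x. H (x + \<eta>) - H x)"
  have A0: "A \<eta> x \<ge> 0" if "\<eta> > 0" "x > 0" for \<eta> x
    using lc that by (auto simp: log_convex_increments_def A_def)
  have Ac: "convex_on {0<..} (\<lambda>x. exp (\<beta> * x) * A \<eta> x)" if "\<eta> > 0" for \<eta> \<beta>
    using lc that by (auto simp: log_convex_increments_def A_def)
  define \<delta> where "\<delta> = (\<lambda>n::nat. (1/2::real) ^ n)"
  have \<delta>: "\<delta> n > 0" "\<delta> (Suc n) = \<delta> n / 2" for n by (auto simp: \<delta>_def)
  have \<delta>0: "\<delta> \<longlonglongrightarrow> 0" unfolding \<delta>_def by (rule LIMSEQ_realpow_zero) auto
  have \<delta>dec: "\<delta> m \<le> \<delta> n" if "n \<le> m" for n m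
    unfolding \<delta>_def using that by (simp add: power_decreasing)
  have \<delta>ev: "\<exists>N. \<forall>n\<ge>N. \<delta> n < x" if "x > 0" for x
    using order_tendstoD(2) [OF \<delta>0 that] by (simp add: eventually_sequentially)
  define G where "G = (\<lambda>n x. (H (x + \<delta> n) - H (x - \<delta> n)) / (2 * \<delta> n))"
  have GA: "G n x = A (2 * \<delta> n) (x - \<delta> n) / (2 * \<delta> n)" for n x
    by (simp add: G_def A_def algebra_simps)
  have G0: "G n x \<ge> 0" if "\<delta> n < x" for n x
    unfolding GA using A0 [of "2 * \<delta> n" "x - \<delta> n"] that \<delta> [of n] by simp
  have Gdec1: "G (Suc n) x \<le> G n x" if x: "\<delta> n < x" for n x
  proof -
    let ?d = "\<delta> n"
    have "convex_on {0<..} (\<lambda>x. exp (0 * x) * A ?d x)" using Ac \<delta> by blast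
    then have c: "convex_on {0<..} (A ?d)" by simp
    have "A ?d (x - ?d / 2) \<le> (1 / 2) * A ?d (x - ?d) + (1 / 2) * A ?d x"
      using convex_onD [OF c, of "1/2" "x - ?d" x] x \<delta>(1) [of n] by (simp add: field_simps)
    also have "(1 / 2) * A ?d (x - ?d) + (1 / 2) * A ?d x = ?d * G n x"
      using \<delta>(1) [of n] by (simp add: A_def G_def field_simps)
    also have "A ?d (x - ?d / 2) = ?d * G (Suc n) x"
      using \<delta>(1) [of n] by (simp add: A_def G_def \<delta>(2) field_simps)
    finally show ?thesis using \<delta>(1) [of n] by simp
  qed
  have Gdec: "G m x \<le> G n x" if "\<delta> n < x" "n \<le> m" for n m x
    using that(2)
  proof (induction m rule: dec_induct)
    case (step k)
    then show ?case using Gdec1 [of k x] \<delta>dec [of n k] that by linarith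
  qed simp
  define g where "g = (\<lambda>x. lim (\<lambda>n. G n x))"
  have Glim: "(\<lambda>n. G n x) \<longlonglongrightarrow> g x" if x: "x > 0" for x
  proof -
    obtain N where N: "\<And>n. n \<ge> N \<Longrightarrow> \<delta> n < x" using \<delta>ev [OF x] by blast
    have "decseq (\<lambda>n. G (n + N) x)"
      unfolding decseq_def using Gdec N by (metis add_le_mono1 le_add2)
    moreover have "\<forall>i. 0 \<le> G (i + N) x" using G0 N by simp
    ultimately obtain L where "(\<lambda>n. G (n + N) x) \<longlonglongrightarrow> L"
      by (rule decseq_convergent)
    then have "(\<lambda>n. G n x) \<longlonglongrightarrow> L" by (rule LIMSEQ_offset)
    then show ?thesis unfolding g_def by (simp add: limI)
  qed
  have g0: "g x \<ge> 0" if x: "x > 0" for x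
  proof (rule LIMSEQ_le_const [OF Glim [OF x]])
    show "\<exists>N. \<forall>n\<ge>N. 0 \<le> G n x" using \<delta>ev [OF x] G0 by blast
  qed
  have gc: "convex_on {0<..} (\<lambda>x. exp (\<beta> * x) * g x)" for \<beta>
  proof (rule convex_onI)
    fix u x y :: real
    assume u: "0 < u" "u < 1" and xy: "x \<in> {0<..}" "y \<in> {0<..}"
    let ?z = "(1 - u) * x + u * y"
    have z: "?z > 0" using u xy by (simp add: add_pos_pos)
    have ev: "\<exists>N. \<forall>n\<ge>N. exp (\<beta> * ?z) * G n ?z
        \<le> (1 - u) * (exp (\<beta> * x) * G n x) + u * (exp (\<beta> * y) * G n y)"
    proof -
      obtain N where N: "\<And>n. n \<ge> N \<Longrightarrow> \<delta> n < min x y" using \<delta>ev [of "min x y"] xy by auto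
      have "exp (\<beta> * ?z) * G n ?z
        \<le> (1 - u) * (exp (\<beta> * x) * G n x) + u * (exp (\<beta> * y) * G n y)" if n: "n \<ge> N" for n
      proof -
        let ?d = "\<delta> n"
        have d: "?d < x" "?d < y" using N [OF n] by auto
        have "exp (\<beta> * (?z - ?d)) * A (2 * ?d) (?z - ?d) \<le>
            (1 - u) * (exp (\<beta> * (x - ?d)) * A (2 * ?d) (x - ?d))
            + u * (exp (\<beta> * (y - ?d)) * A (2 * ?d) (y - ?d))"
        proof -
          have e: "(1 - u) * (x - ?d) + u * (y - ?d) = ?z - ?d" by (simp add: algebra_simps)
          have "convex_on {0<..} (\<lambda>x. exp (\<beta> * x) * A (2 * ?d) x)" using Ac \<delta>(1) [of n] by simp
          from convex_onD [OF this, of u "x - ?d" "y - ?d"] show ?thesis using d u e by simp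
        qed
        \<comment> \<open>The factor exp (\<beta> \<delta>) recentres the tilt from the left end of
          the increment to its midpoint.\<close>
        then have "(exp (\<beta> * ?d) / (2 * ?d)) * (exp (\<beta> * (?z - ?d)) * A (2 * ?d) (?z - ?d)) \<le>
            (exp (\<beta> * ?d) / (2 * ?d)) * ((1 - u) * (exp (\<beta> * (x - ?d)) * A (2 * ?d) (x - ?d))
            + u * (exp (\<beta> * (y - ?d)) * A (2 * ?d) (y - ?d)))"
          using \<delta>(1) [of n] by (intro mult_left_mono) auto
        moreover have "(exp (\<beta> * ?d) / (2 * ?d)) * (exp (\<beta> * (w - ?d)) * B) = exp (\<beta> * w) * (B / (2 * ?d))"
          for w B by (simp add: algebra_simps exp_diff)
        ultimately show ?thesis unfolding GA by (simp only: distrib_left mult.left_commute [of _ "1-u"] mult.left_commute [of _ u])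
      qed
      then show ?thesis by blast
    qed
    have "exp (\<beta> * ?z) * g ?z \<le> (1 - u) * (exp (\<beta> * x) * g x) + u * (exp (\<beta> * y) * g y)"
      by (rule LIMSEQ_le [OF _ _ ev]) (use xy z in \<open>auto intro!: tendsto_intros Glim\<close>)
    then show "exp (\<beta> * ((1 - u) *\<^sub>R x + u *\<^sub>R y)) * g ((1 - u) *\<^sub>R x + u *\<^sub>R y)
        \<le> (1 - u) * (exp (\<beta> * x) * g x) + u * (exp (\<beta> * y) * g y)" by simp
  qed (simp add: convex_real_interval)
  have Hc: "continuous_on {0<..} H" by (rule log_convex_increments_continuous [OF lc])
  have gcont: "continuous_on {0<..} g"
  proof -
    have "convex_on {0<..} (\<lambda>x. exp (0 * x) * g x)" by (rule gc)
    then show ?thesis using convex_on_continuous [of "{0<..}" g] by simp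
  qed
  \<comment> \<open>\<open>G n\<close> is the derivative of \<open>K n\<close>, the symmetric
    quotient of an antiderivative \<open>B\<close> of H. Since \<open>K n\<close> tends to H
    pointwise, it remains to pass to the limit under the integral of \<open>G n\<close>, which is
    dominated by \<open>G N\<close>.\<close>
  have diff: "H q - H p = integral {p..q} g" if p: "0 < p" "p \<le> q" for p q
  proof -
    define c where "c = p / 2"
    define B where "B = (\<lambda>x. integral {c..x} H)"
    have c: "0 < c" "c < p" using p by (auto simp: c_def)
    have B': "(B has_real_derivative H x) (at x)" if "x > c" for x
    proof -
      have "continuous_on {c..x + 1} H" using c by (intro continuous_on_subset [OF Hc]) auto
      then have "(B has_real_derivative H x) (at x within {c..x + 1})"
        unfolding B_def using that by (intro integral_has_real_derivative) auto
      then show ?thesis using that by (simp add: at_within_Icc_at)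
    qed
    obtain N where N: "\<And>n. n \<ge> N \<Longrightarrow> \<delta> n < p - c" using \<delta>ev [of "p - c"] c by auto
    define K where "K = (\<lambda>n x. (B (x + \<delta> n) - B (x - \<delta> n)) / (2 * \<delta> n))"
    have int: "(G n has_integral K n q - K n p) {p..q}" if n: "n \<ge> N" for n
    proof (rule fundamental_theorem_of_calculus [OF p(2)])
      fix x assume x: "x \<in> {p..q}"
      have "x - \<delta> n > c" "x + \<delta> n > c" using x N [OF n] \<delta>(1) [of n] by auto
      then have "((\<lambda>x. B (x + \<delta> n)) has_real_derivative H (x + \<delta> n)) (at x)"
        "((\<lambda>x. B (x + - \<delta> n)) has_real_derivative H (x - \<delta> n)) (at x)"
        using B' [of "x + \<delta> n"] B' [of "x + - \<delta> n"] unfolding DERIV_shift by simp_all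
      then have "(K n has_real_derivative G n x) (at x)"
        unfolding K_def G_def by (intro DERIV_cdivide DERIV_diff) simp_all
      then show "(K n has_vector_derivative G n x) (at x within {p..q})"
        by (simp add: has_real_derivative_iff_has_vector_derivative has_vector_derivative_at_within)
    qed
    have GN: "G N integrable_on {p..q}" using int by blast
    have "(\<lambda>n. integral {p..q} (G (n + N))) \<longlonglongrightarrow> integral {p..q} g"
    proof (rule dominated_convergence(2) [OF _ GN])
      show "G (k + N) integrable_on {p..q}" for k using int [of "k + N"] by auto
      fix x assume x: "x \<in> {p..q}"
      then have d: "\<delta> n < x" if "n \<ge> N" for n using N [OF that] c by auto
      show "norm (G (k + N) x) \<le> G N x" for k using Gdec [of N x "k + N"] G0 [of "k + N" x] d by simp
      show "(\<lambda>k. G (k + N) x) \<longlonglongrightarrow> g x" using Glim x p by (intro LIMSEQ_ignore_initial_segment) auto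
    qed
    moreover have "integral {p..q} (G (n + N)) = K (n + N) q - K (n + N) p" for n
      using int [of "n + N"] by (simp add: integral_unique)
    ultimately have l1: "(\<lambda>n. K (n + N) q - K (n + N) p) \<longlonglongrightarrow> integral {p..q} g" by simp
    have Kl: "(\<lambda>n. K n x) \<longlonglongrightarrow> H x" if "x > c" for x
    proof -
      have D: "((\<lambda>h. (B (x + h) - B x) / h) \<longlongrightarrow> H x) (at 0)"
        using B' [OF that] by (simp add: DERIV_def)
      have f1: "filterlim \<delta> (at 0) sequentially"
        using \<delta>0 \<delta>(1) by (auto simp: filterlim_at intro!: always_eventually) (metis less_irrefl)
      have f2: "filterlim (\<lambda>n. - \<delta> n) (at 0) sequentially"
        using tendsto_minus [OF \<delta>0] \<delta>(1) by (auto simp: filterlim_at intro!: always_eventually) (metis less_irrefl)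
      have "(\<lambda>n. ((B (x + \<delta> n) - B x) / \<delta> n + (B (x + - \<delta> n) - B x) / (- \<delta> n)) / 2) \<longlonglongrightarrow> (H x + H x) / 2"
        by (intro tendsto_intros filterlim_compose [OF D f1] filterlim_compose [OF D f2]) simp
      moreover have "((B (x + \<delta> n) - B x) / \<delta> n + (B (x + - \<delta> n) - B x) / (- \<delta> n)) / 2 = K n x" for n
        using \<delta>(1) [of n] by (simp add: K_def field_simps)
      ultimately show ?thesis by simp
    qed
    have "(\<lambda>n. K (n + N) q - K (n + N) p) \<longlonglongrightarrow> H q - H p"
      by (rule LIMSEQ_ignore_initial_segment [where f = "\<lambda>n. K n q - K n p"], intro tendsto_diff Kl) (use c p in auto)
    then show ?thesis using l1 LIMSEQ_unique by blast
  qed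
  have "(H has_real_derivative g x) (at x)" if x: "x > 0" for x
  proof -
    define p where "p = x / 2"
    have p: "0 < p" "p < x" using x by (auto simp: p_def)
    have "continuous_on {p..x + 1} g" using p by (intro continuous_on_subset [OF gcont]) auto
    then have "((\<lambda>x. integral {p..x} g) has_real_derivative g x) (at x within {p..x + 1})"
      using p by (intro integral_has_real_derivative) auto
    then have "((\<lambda>x. H p + integral {p..x} g) has_real_derivative 0 + g x) (at x)"
      using p by (intro DERIV_add DERIV_const) (simp add: at_within_Icc_at)
    then have "((\<lambda>x. H p + integral {p..x} g) has_real_derivative g x) (at x)" by simp
    then show ?thesis
    proof (rule has_field_derivative_transform_within_open)
      show "open {p<..}" "x \<in> {p<..}" using p by auto
      fix y assume "y \<in> {p<..}"
      then show "H p + integral {p..y} g = H y" using diff [of p y] p by simp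
    qed
  qed
  then show ?thesis using that g0 gc by blast
qed

lemma log_convex_increments_imp_log_convex_deriv:
  assumes "log_convex_increments H"
  shows "H differentiable_on {0<..} \<and> log_convex_on {0<..} (deriv H) \<and> convex_on {0<..} (deriv H)"
proof -
  obtain g where g: "\<And>x. x > 0 \<Longrightarrow> (H has_real_derivative g x) (at x)"
    "\<And>x. x > 0 \<Longrightarrow> g x \<ge> 0" "\<And>\<beta>. convex_on {0<..} (\<lambda>x. exp (\<beta> * x) * g x)"
    by (rule log_convex_increments_deriv [OF assms]) blast
  have d: "deriv H x = g x" if "x > 0" for x using g(1) [OF that] by (rule DERIV_imp_deriv)
  have "convex_on {0<..} (\<lambda>x. exp (\<beta> * x) * deriv H x)" for \<beta>
    by (rule convex_on_transform [OF g(3) [of \<beta>]]) (simp add: d)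
  then have "log_convex_on {0<..} (deriv H)"
    using g(2) d by (intro log_convex_on_if_exp_convex) auto
  moreover have "H differentiable_on {0<..}"
    unfolding differentiable_on_def
    using g(1) by (metis differentiable_at_withinI greaterThan_iff real_differentiable_def)
  ultimately show ?thesis by (simp add: log_convex_on_imp_convex_on)
qed

section \<open>Renewal sequences with log-convex weights\<close>

text \<open>Coefficients of the power series of 1 / (A - F(s)), where F(s) is the sum of f j s^j
  over j >= 1; the weights are therefore read from index 1 on.\<close>

fun renewal :: "real \<Rightarrow> (nat \<Rightarrow> real) \<Rightarrow> nat \<Rightarrow> real" where
  "renewal A f 0 = 1 / A"
| "renewal A f (Suc n) = (\<Sum>i\<le>n. f (Suc i) * renewal A f (n - i)) / A"

lemma renewal_pos:
  assumes "A > 0" "\<And>j. f (Suc j) > 0"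
  shows "renewal A f n > 0"
proof (induction n rule: less_induct)
  case (less n)
  show ?case
  proof (cases n)
    case (Suc m)
    have "(\<Sum>i\<le>m. f (Suc i) * renewal A f (m - i)) > 0"
      using Suc less assms by (intro sum_pos mult_pos_pos) auto
    then show ?thesis using Suc assms by simp
  qed (use assms in simp)
qed

lemma log_convex_seq_ratio_mono:
  fixes s :: "nat \<Rightarrow> real"
  assumes "\<And>n. s n > 0" "\<And>n. (s (Suc n))\<^sup>2 \<le> s n * s (Suc (Suc n))"
  shows "incseq (\<lambda>n. s (Suc n) / s n)"
proof (rule incseq_SucI)
  fix n
  show "s (Suc n) / s n \<le> s (Suc (Suc n)) / s (Suc n)"
    using assms(1) [of n] assms(1) [of "Suc n"] assms(2) [of n]
    by (simp add: field_simps power2_eq_square)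
qed

text \<open>Compare consecutive ratios: the differences below are nonpositive for the recent terms, and
  the remaining boundary term is positive; passing from the weights f (i+1) to f (i+2) favours the
  boundary term.\<close>
lemma renewal_log_convex:
  assumes A: "A > 0" and pos: "\<And>j. f (Suc j) > 0"
    and lc: "\<And>j. (f (Suc (Suc j)))\<^sup>2 \<le> f (Suc j) * f (Suc (Suc (Suc j)))"
  shows "(renewal A f (Suc n))\<^sup>2 \<le> renewal A f n * renewal A f (Suc (Suc n))"
proof -
  define u where "u = renewal A f"
  have u: "u n > 0" for n unfolding u_def using renewal_pos [of A f, OF A pos] .
  have rec: "A * u (Suc n) = (\<Sum>i\<le>n. f (Suc i) * u (n - i))" for n
    using A by (simp add: u_def)
  have u0: "A * u 0 = 1" using A by (simp add: u_def)
  define q where "q = (\<lambda>n. u (Suc n) / u n)"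
  have "q n \<le> q (Suc n)" for n
  proof (induction n rule: less_induct)
    case (less n)
    define r where "r = q n"
    have r: "u (Suc n) = r * u n" using u [of n] by (simp add: r_def q_def)
    have qr: "q i \<le> r" if "i \<le> n" for i
      using that
    proof (induction i rule: inc_induct)
      case (step k)
      then show ?case using less.IH [of k] by simp
    qed (simp add: r_def)
    define d where "d = (\<lambda>i. u (n - i) - r * u (n - Suc i))"
    have d0: "d i \<le> 0" if "i < n" for i
    proof -
      have "q (n - Suc i) \<le> r" by (rule qr) simp
      then show ?thesis
        using u [of "n - Suc i"] that by (simp add: q_def d_def field_simps Suc_diff_Suc)
    qed
    \<comment> \<open>Subtracting \<open>r\<close> times the recursion for \<open>u (Suc n)\<close>
      from the one for \<open>u (Suc (Suc n))\<close> cancels the newest terms, because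
      \<open>u (Suc n) = r * u n\<close>.\<close>
    have "A * (u (Suc (Suc n)) - r * u (Suc n)) =
        f (Suc (Suc n)) * u 0 + (\<Sum>i<n. f (Suc (Suc i)) * d i)"
    proof -
      have "A * u (Suc (Suc n)) = f (Suc 0) * u (Suc n) + (\<Sum>i\<le>n. f (Suc (Suc i)) * u (n - i))"
        unfolding rec [of "Suc n"] sum.atMost_Suc_shift by simp
      also have "(\<Sum>i\<le>n. f (Suc (Suc i)) * u (n - i)) =
          (\<Sum>i<n. f (Suc (Suc i)) * u (n - i)) + f (Suc (Suc n)) * u 0"
        by (simp add: lessThan_Suc_atMost [symmetric])
      finally have 1: "A * u (Suc (Suc n)) = f (Suc 0) * u (Suc n) +
          ((\<Sum>i<n. f (Suc (Suc i)) * u (n - i)) + f (Suc (Suc n)) * u 0)" .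
      have 2: "A * u (Suc n) = f (Suc 0) * u n + (\<Sum>i<n. f (Suc (Suc i)) * u (n - Suc i))"
        unfolding rec [of n] lessThan_Suc_atMost [symmetric] sum.lessThan_Suc_shift by simp
      have "A * (u (Suc (Suc n)) - r * u (Suc n)) = A * u (Suc (Suc n)) - r * (A * u (Suc n))"
        by (simp add: algebra_simps)
      also have "\<dots> = f (Suc (Suc n)) * u 0 + (\<Sum>i<n. f (Suc (Suc i)) * d i)"
        unfolding 1 2 d_def
        by (simp add: r algebra_simps sum_distrib_left sum_subtractf)
      finally show ?thesis .
    qed
    also have "\<dots> \<ge> 0"
    proof (cases n)
      case 0
      then show ?thesis using pos [of "Suc 0"] u [of 0] by simp
    next
      case (Suc m)
      define Q where "Q = f (Suc (Suc n)) / f (Suc n)"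
      have Q: "f (Suc (Suc n)) = Q * f (Suc n)" "Q > 0"
        using pos [of n] pos [of "Suc n"] by (auto simp: Q_def)
      have fQ: "f (Suc (Suc i)) \<le> Q * f (Suc i)" if "i < n" for i
      proof -
        have "incseq (\<lambda>i. f (Suc (Suc i)) / f (Suc i))"
          by (rule log_convex_seq_ratio_mono [where s = "\<lambda>i. f (Suc i)"]) (use pos lc in auto)
        from incseqD [OF this, of i n] that show ?thesis
          using pos [of i] by (simp add: Q_def field_simps)
      qed
      \<comment> \<open>The same subtraction one index lower vanishes. Scaling it by
        \<open>Q\<close> reproduces the boundary term of the target, and replacing the remaining
        weights only increases the sum: \<open>d i\<close> is nonpositive and no earlier ratio of
        weights exceeds \<open>Q\<close>.\<close>
      have "0 = A * (u (Suc n) - r * u n)" using r by simp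
      also have "\<dots> = A * u (Suc n) - r * (A * u (Suc m))" by (simp add: Suc algebra_simps)
      also have "\<dots> = f (Suc n) * u 0 + (\<Sum>i<n. f (Suc i) * d i)"
      proof -
        have 1: "A * u (Suc n) = (\<Sum>i<n. f (Suc i) * u (n - i)) + f (Suc n) * u 0"
          unfolding rec lessThan_Suc_atMost [symmetric] by simp
        have 2: "A * u (Suc m) = (\<Sum>i<n. f (Suc i) * u (n - Suc i))"
          unfolding rec lessThan_Suc_atMost [symmetric] by (simp add: Suc)
        show ?thesis unfolding 1 2 d_def
          by (simp add: algebra_simps sum_distrib_left sum_subtractf)
      qed
      finally have "0 = Q * (f (Suc n) * u 0 + (\<Sum>i<n. f (Suc i) * d i))" by simp
      also have "\<dots> = f (Suc (Suc n)) * u 0 + (\<Sum>i<n. Q * f (Suc i) * d i)"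
        by (simp add: Q(1) algebra_simps sum_distrib_left)
      also have "\<dots> \<le> f (Suc (Suc n)) * u 0 + (\<Sum>i<n. f (Suc (Suc i)) * d i)"
        by (intro add_left_mono sum_mono mult_right_mono_neg fQ d0) auto
      finally show ?thesis .
    qed
    finally have "r * u (Suc n) \<le> u (Suc (Suc n))" using A by (simp add: zero_le_mult_iff)
    then show ?case using u [of "Suc n"] by (simp add: q_def r_def field_simps)
  qed
  from this [of n] show ?thesis
    unfolding u_def [symmetric] using u [of n] u [of "Suc n"]
    by (simp add: q_def field_simps power2_eq_square)
qed

text \<open>Convergence has to be secured first: bounding the triangular double sum of the recursion
  by the full square gives A S <= 1 + F S for every partial sum S, hence S <= 1 / (A - F). The
  Cauchy product then determines the value.\<close>

lemma renewal_generating_function: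
  assumes A: "A > 0" and pos: "\<And>j. f (Suc j) > 0" and s: "s \<ge> 0"
    and F: "(\<lambda>j. f (Suc j) * s ^ Suc j) sums F" and FA: "F < A"
  shows "(\<lambda>n. renewal A f n * s ^ n) sums (1 / (A - F))"
proof -
  define a where "a = (\<lambda>j. f (Suc j) * s ^ Suc j)"
  define b where "b = (\<lambda>n. renewal A f n * s ^ n)"
  have a0: "a j \<ge> 0" for j using pos [of j] s by (simp add: a_def)
  have b0: "b n \<ge> 0" for n using renewal_pos [of A f n, OF A pos] s by (simp add: b_def)
  have aF: "a sums F" using F by (simp add: a_def)
  have rec: "A * b (Suc n) = (\<Sum>i\<le>n. a i * b (n - i))" for n
  proof -
    have "A * b (Suc n) = (\<Sum>i\<le>n. f (Suc i) * renewal A f (n - i)) * s ^ Suc n"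
      using A by (simp add: b_def)
    also have "\<dots> = (\<Sum>i\<le>n. a i * b (n - i))"
      unfolding sum_distrib_right
    proof (rule sum.cong [OF refl])
      fix i assume "i \<in> {..n}"
      then have "s ^ Suc n = s ^ Suc i * s ^ (n - i)" by (simp add: power_add [symmetric])
      then show "f (Suc i) * renewal A f (n - i) * s ^ Suc n = a i * b (n - i)"
        by (simp add: a_def b_def)
    qed
    finally show ?thesis .
  qed
  have bnd: "(\<Sum>n<N. b n) \<le> 1 / (A - F)" for N
  proof (cases N)
    case 0
    then show ?thesis using FA by simp
  next
    case (Suc M)
    have "A * (\<Sum>n<Suc M. b n) = A * b 0 + (\<Sum>n<M. \<Sum>i\<le>n. a i * b (n - i))"
      unfolding sum.lessThan_Suc_shift by (simp add: distrib_left sum_distrib_left rec)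
    also have "A * b 0 = 1" using A by (simp add: b_def)
    also have "(\<Sum>n<M. \<Sum>i\<le>n. a i * b (n - i)) = (\<Sum>(i, j)\<in>{(i, j). i + j < M}. a i * b j)"
      by (simp add: sum.triangle_reindex)
    also have "\<dots> \<le> (\<Sum>(i, j)\<in>{..<M} \<times> {..<M}. a i * b j)"
      by (rule sum_mono2) (auto simp: a0 b0)
    also have "\<dots> = (\<Sum>i<M. a i) * (\<Sum>j<M. b j)"
      by (simp add: sum_product sum.cartesian_product)
    also have "\<dots> \<le> F * (\<Sum>n<Suc M. b n)"
    proof (rule mult_mono)
      show "(\<Sum>i<M. a i) \<le> F"
        using sum_le_suminf [of a "{..<M}"] aF a0 by (simp add: sums_iff)
      show "0 \<le> F" using suminf_nonneg [of a] aF a0 by (simp add: sums_iff)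
    qed (use b0 in \<open>auto intro: sum_nonneg\<close>)
    finally have "(\<Sum>n<Suc M. b n) * (A - F) \<le> 1" by (simp add: algebra_simps)
    then show ?thesis using FA Suc by (simp add: field_simps)
  qed
  have sb: "summable b"
    by (rule summableI_nonneg_bounded [OF b0 bnd])
  have "(\<lambda>k. \<Sum>i\<le>k. a i * b (k - i)) sums (suminf a * suminf b)"
    by (rule Cauchy_product_sums) (use a0 b0 sb aF in \<open>auto simp: sums_iff\<close>)
  then have "(\<lambda>n. A * b (Suc n)) sums (F * suminf b)"
    using aF by (simp add: rec sums_iff)
  moreover have "(\<lambda>n. A * b (Suc n)) sums (A * (suminf b - b 0))"
    using sb by (intro sums_mult) (simp add: sums_Suc_iff summable_sums)
  ultimately have "F * suminf b = A * (suminf b - b 0)" by (rule sums_unique2)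
  moreover have "A * b 0 = 1" using A by (simp add: b_def)
  ultimately have "suminf b * (A - F) = 1" by (simp add: algebra_simps)
  then have "suminf b = 1 / (A - F)" using FA by (simp add: field_simps)
  then show ?thesis using sb by (simp add: sums_iff b_def)
qed

text \<open>Arithmetic-geometric mean inequality for the two neighbours of the middle term. The
  factor r^n is the lattice version of the tilt exp (\<beta> x).\<close>

lemma log_convex_seq_weighted:
  fixes s :: "nat \<Rightarrow> real"
  assumes "\<And>n. s n > 0" "\<And>n. (s (Suc n))\<^sup>2 \<le> s n * s (Suc (Suc n))" and r: "r > 0"
  shows "2 * (r ^ Suc n * s (Suc n)) \<le> r ^ n * s n + r ^ Suc (Suc n) * s (Suc (Suc n))"
proof -
  let ?a = "s n" and ?b = "s (Suc n)" and ?c = "r\<^sup>2 * s (Suc (Suc n))"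
  have "(2 * (r * ?b))\<^sup>2 = 4 * r\<^sup>2 * ?b\<^sup>2" by (simp add: power_mult_distrib)
  also have "\<dots> \<le> 4 * r\<^sup>2 * (s n * s (Suc (Suc n)))"
    using assms(2) [of n] by (intro mult_left_mono) auto
  also have "\<dots> = 4 * (?a * ?c)" by simp
  also have "\<dots> \<le> (?a + ?c)\<^sup>2"
    using zero_le_power2 [of "?a - ?c"] by (simp add: power2_eq_square algebra_simps)
  finally have "2 * (r * ?b) \<le> ?a + ?c"
    by (rule power2_le_imp_le) (use assms(1) [of n] assms(1) [of "Suc (Suc n)"] in simp)
  then have "r ^ n * (2 * (r * ?b)) \<le> r ^ n * (?a + ?c)" using r by (intro mult_left_mono) auto
  then show ?thesis by (simp add: algebra_simps power2_eq_square)
qed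

text \<open>Compares the slopes on both sides of m. Denominators are cleared so that the inequality
  can be rescaled and passed to a limit even when lattice points coincide.\<close>

lemma convex_seq_three_points:
  fixes a :: "nat \<Rightarrow> real"
  assumes "\<And>n. 2 * a (Suc n) \<le> a n + a (Suc (Suc n))" and "i \<le> m" "m \<le> l"
  shows "(real l - real i) * a m \<le> (real l - real m) * a i + (real m - real i) * a l"
proof -
  define d where "d = (\<lambda>n. a (Suc n) - a n)"
  have "incseq d" by (rule incseq_SucI) (use assms(1) in \<open>simp add: d_def algebra_simps\<close>)
  have 1: "a m - a i \<le> (real m - real i) * d m"
  proof -
    have "a m - a i = (\<Sum>j=i..<m. d j)" unfolding d_def by (simp add: sum_Suc_diff' assms(2))
    also have "\<dots> \<le> (\<Sum>j=i..<m. d m)" using \<open>incseq d\<close> by (intro sum_mono) (auto simp: incseq_def)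
    finally show ?thesis using assms(2) by (simp add: of_nat_diff)
  qed
  have 2: "(real l - real m) * d m \<le> a l - a m"
  proof -
    have "(real l - real m) * d m = (\<Sum>j=m..<l. d m)" using assms(3) by (simp add: of_nat_diff)
    also have "\<dots> \<le> (\<Sum>j=m..<l. d j)" using \<open>incseq d\<close> by (intro sum_mono) (auto simp: incseq_def)
    also have "\<dots> = a l - a m" unfolding d_def by (simp add: sum_Suc_diff' assms(3))
    finally show ?thesis .
  qed
  have "(real l - real m) * (a m - a i) \<le> (real l - real m) * ((real m - real i) * d m)"
    using 1 assms(3) by (intro mult_left_mono) auto
  also have "\<dots> = (real m - real i) * ((real l - real m) * d m)" by simp
  also have "\<dots> \<le> (real m - real i) * (a l - a m)"
    using 2 assms(2) by (intro mult_left_mono) auto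
  finally show ?thesis by (simp add: algebra_simps)
qed

text \<open>The block sums \<open>S (n + N) - S n\<close> are sums of translates of
  \<open>u\<close>, and the tilted second-difference inequality is linear, so it passes from
  \<open>u\<close> to them.\<close>

lemma log_convex_seq_increments:
  fixes u :: "nat \<Rightarrow> real"
  assumes "\<And>n. u n > 0" "\<And>n. (u (Suc n))\<^sup>2 \<le> u n * u (Suc (Suc n))" and r: "r > 0"
    and "i \<le> m" "m \<le> l"
  defines "S \<equiv> \<lambda>n. \<Sum>j\<le>n. u j"
  shows "(real l - real i) * (r ^ m * (S (m + N) - S m)) \<le>
    (real l - real m) * (r ^ i * (S (i + N) - S i)) + (real m - real i) * (r ^ l * (S (l + N) - S l))"
proof -
  define s where "s = (\<lambda>i. \<Sum>j<N. u (i + Suc j))"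
  have S: "S (i + N) - S i = s i" for i
    unfolding S_def s_def by (induction N) auto
  have "2 * (r ^ Suc n * s (Suc n)) \<le> r ^ n * s n + r ^ Suc (Suc n) * s (Suc (Suc n))" for n
  proof -
    have "(\<Sum>j<N. 2 * (r ^ Suc n * u (Suc n + Suc j))) \<le>
        (\<Sum>j<N. r ^ n * u (n + Suc j) + r ^ Suc (Suc n) * u (Suc (Suc n) + Suc j))"
    proof (rule sum_mono)
      fix j
      show "2 * (r ^ Suc n * u (Suc n + Suc j)) \<le>
        r ^ n * u (n + Suc j) + r ^ Suc (Suc n) * u (Suc (Suc n) + Suc j)"
        using log_convex_seq_weighted [where s = "\<lambda>n. u (n + Suc j)", OF _ _ r, of n]
          assms(1) assms(2) by simp
    qed
    then show ?thesis by (simp add: s_def sum_distrib_left sum.distrib del: power_Suc)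
  qed
  from convex_seq_three_points [where a = "\<lambda>n. r ^ n * s n", OF this assms(4,5)]
  show ?thesis by (simp add: S)
qed

section \<open>Laplace transforms and convolutions\<close>

text \<open>With values in \<open>ennreal\<close>, Tonelli's theorem makes the algebra of transforms
  and convolutions free of integrability conditions.\<close>

definition laplace :: "(real \<Rightarrow> ennreal) \<Rightarrow> real \<Rightarrow> ennreal" where
  "laplace f \<theta> = (\<integral>\<^sup>+x. f x * ennreal (exp (- \<theta> * x)) \<partial>lborel)"

definition conv :: "(real \<Rightarrow> ennreal) \<Rightarrow> (real \<Rightarrow> ennreal) \<Rightarrow> real \<Rightarrow> ennreal" where
  "conv f g x = (\<integral>\<^sup>+y. f (x - y) * g y \<partial>lborel)"

lemma conv_measurable [measurable]:
  assumes [measurable]: "f \<in> borel_measurable borel" "g \<in> borel_measurable borel"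
  shows "conv f g \<in> borel_measurable borel"
  unfolding conv_def by measurable

lemma nn_integral_lborel_translate:
  fixes f :: "real \<Rightarrow> ennreal"
  assumes "f \<in> borel_measurable borel"
  shows "(\<integral>\<^sup>+x. f (x + t) \<partial>lborel) = (\<integral>\<^sup>+x. f x \<partial>lborel)"
  using nn_integral_real_affine [OF assms, of 1 t] by (simp add: add.commute)

lemma conv_assoc:
  assumes [measurable]: "f \<in> borel_measurable borel" "g \<in> borel_measurable borel"
    "h \<in> borel_measurable borel"
  shows "conv f (conv g h) x = conv (conv f g) h x"
proof -
  have "conv f (conv g h) x = (\<integral>\<^sup>+y. (\<integral>\<^sup>+z. f (x - y) * (g (y - z) * h z) \<partial>lborel) \<partial>lborel)"
    unfolding conv_def by (simp add: nn_integral_cmult)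
  also have "\<dots> = (\<integral>\<^sup>+z. (\<integral>\<^sup>+y. f (x - y) * (g (y - z) * h z) \<partial>lborel) \<partial>lborel)"
    by (rule lborel_pair.Fubini') measurable
  also have "\<dots> = (\<integral>\<^sup>+z. conv f g (x - z) * h z \<partial>lborel)"
  proof (rule nn_integral_cong)
    fix z
    have "(\<integral>\<^sup>+y. f (x - y) * (g (y - z) * h z) \<partial>lborel) = (\<integral>\<^sup>+y. f (x - y) * g (y - z) * h z \<partial>lborel)"
      by (simp add: mult.assoc)
    also have "\<dots> = (\<integral>\<^sup>+y. f (x - y) * g (y - z) \<partial>lborel) * h z"
      by (rule nn_integral_multc) measurable
    also have "(\<integral>\<^sup>+y. f (x - y) * g (y - z) \<partial>lborel) = (\<integral>\<^sup>+y. f (x - (y + z)) * g (y + z - z) \<partial>lborel)"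
      by (rule nn_integral_lborel_translate [symmetric]) measurable
    also have "\<dots> = conv f g (x - z)" unfolding conv_def by (simp add: algebra_simps)
    finally show "(\<integral>\<^sup>+y. f (x - y) * (g (y - z) * h z) \<partial>lborel) = conv f g (x - z) * h z" .
  qed
  finally show ?thesis by (simp add: conv_def)
qed

lemma conv_commute:
  assumes [measurable]: "f \<in> borel_measurable borel" "g \<in> borel_measurable borel"
  shows "conv f g x = conv g f x"
proof -
  have "conv f g x = (\<integral>\<^sup>+y. f (x - (x + (-1) * y)) * g (x + (-1) * y) \<partial>lborel)"
    unfolding conv_def by (subst nn_integral_real_affine [where c = "-1" and t = x]) auto
  then show ?thesis by (simp add: conv_def mult.commute)
qed

lemma laplace_conv:
  assumes [measurable]: "f \<in> borel_measurable borel" "g \<in> borel_measurable borel"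
  shows "laplace (conv f g) \<theta> = laplace f \<theta> * laplace g \<theta>"
proof -
  have e: "ennreal (exp (- \<theta> * (x - y))) * ennreal (exp (- \<theta> * y)) = ennreal (exp (- \<theta> * x))" for x y
    by (simp add: ennreal_mult [symmetric] mult_exp_exp algebra_simps)
  have "laplace (conv f g) \<theta> =
      (\<integral>\<^sup>+x. (\<integral>\<^sup>+y. (f (x - y) * ennreal (exp (- \<theta> * (x - y)))) * (g y * ennreal (exp (- \<theta> * y))) \<partial>lborel) \<partial>lborel)"
    unfolding laplace_def conv_def
  proof (rule nn_integral_cong)
    fix x
    have "(\<integral>\<^sup>+y. f (x - y) * g y \<partial>lborel) * ennreal (exp (- \<theta> * x)) =
        (\<integral>\<^sup>+y. f (x - y) * g y * ennreal (exp (- \<theta> * x)) \<partial>lborel)"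
      by (rule nn_integral_multc [symmetric]) measurable
    also have "\<dots> = (\<integral>\<^sup>+y. (f (x - y) * ennreal (exp (- \<theta> * (x - y)))) * (g y * ennreal (exp (- \<theta> * y))) \<partial>lborel)"
    proof (rule nn_integral_cong)
      fix y
      show "f (x - y) * g y * ennreal (exp (- \<theta> * x)) =
          (f (x - y) * ennreal (exp (- \<theta> * (x - y)))) * (g y * ennreal (exp (- \<theta> * y)))"
        unfolding e [of x y, symmetric] by (simp only: ac_simps)
    qed
    finally show "(\<integral>\<^sup>+y. f (x - y) * g y \<partial>lborel) * ennreal (exp (- \<theta> * x)) =
        (\<integral>\<^sup>+y. (f (x - y) * ennreal (exp (- \<theta> * (x - y)))) * (g y * ennreal (exp (- \<theta> * y))) \<partial>lborel)" .
  qed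
  also have "\<dots> = (\<integral>\<^sup>+y. (\<integral>\<^sup>+x. (f (x - y) * ennreal (exp (- \<theta> * (x - y)))) * (g y * ennreal (exp (- \<theta> * y))) \<partial>lborel) \<partial>lborel)"
    by (rule lborel_pair.Fubini') measurable
  also have "\<dots> = (\<integral>\<^sup>+y. laplace f \<theta> * (g y * ennreal (exp (- \<theta> * y))) \<partial>lborel)"
  proof (rule nn_integral_cong)
    fix y
    let ?F = "\<lambda>x. f x * ennreal (exp (- \<theta> * x))"
    have "(\<integral>\<^sup>+x. ?F (x - y) * (g y * ennreal (exp (- \<theta> * y))) \<partial>lborel) = (\<integral>\<^sup>+x. ?F (x + (- y)) \<partial>lborel) * (g y * ennreal (exp (- \<theta> * y)))"
      by (subst nn_integral_multc) auto
    also have "(\<integral>\<^sup>+x. ?F (x + (- y)) \<partial>lborel) = laplace f \<theta>"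
      unfolding laplace_def by (rule nn_integral_lborel_translate) measurable
    finally show "(\<integral>\<^sup>+x. ?F (x - y) * (g y * ennreal (exp (- \<theta> * y))) \<partial>lborel) = laplace f \<theta> * (g y * ennreal (exp (- \<theta> * y)))" .
  qed
  also have "\<dots> = laplace f \<theta> * laplace g \<theta>"
    unfolding laplace_def by (rule nn_integral_cmult) measurable
  finally show ?thesis .
qed

text \<open>In the variable exp (-x) the values of the Laplace transform are moments of a measure on
  the unit interval, which polynomial approximation determines.\<close>
lemma laplace_unique:
  assumes [measurable]: "f \<in> borel_measurable borel" "g \<in> borel_measurable borel"
    and supp: "\<And>x. x < 0 \<Longrightarrow> f x = 0" "\<And>x. x < 0 \<Longrightarrow> g x = 0"
    and eq: "\<And>n::nat. laplace f (\<theta>0 + real n) = laplace g (\<theta>0 + real n)"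
    and fin: "laplace f \<theta>0 < \<infinity>"
  shows "AE x in lborel. f x = g x"
proof -
  \<comment> \<open>Truncating at 0 keeps \<open>h\<close> in (0, 1] on the whole line; negative
    arguments carry no mass, so the moments are unaffected.\<close>
  define h where "h = (\<lambda>x::real. exp (- max 0 x))"
  have [measurable]: "h \<in> borel_measurable borel" unfolding h_def by measurable
  have h01: "0 < h x" "h x \<le> 1" for x by (auto simp: h_def)
  define E where "E = (\<lambda>x. ennreal (exp (- \<theta>0 * x)))"
  have [measurable]: "E \<in> borel_measurable borel" unfolding E_def by measurable
  \<comment> \<open>Tilting by \<theta>0 turns the values of the transform at \<theta>0 + n into the
    moments of \<open>h\<close> under a finite measure.\<close>
  define D where "D = (\<lambda>f. density lborel (\<lambda>x. f x * E x))"
  have moment: "(\<integral>\<^sup>+x. ennreal (h x ^ n) \<partial>D k) = laplace k (\<theta>0 + real n)"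
    if [measurable]: "k \<in> borel_measurable borel" and s: "\<And>x. x < 0 \<Longrightarrow> k x = 0" for k n
  proof -
    have "(\<integral>\<^sup>+x. ennreal (h x ^ n) \<partial>D k) = (\<integral>\<^sup>+x. k x * E x * ennreal (h x ^ n) \<partial>lborel)"
      unfolding D_def by (subst nn_integral_density) auto
    also have "\<dots> = laplace k (\<theta>0 + real n)"
      unfolding laplace_def
    proof (rule nn_integral_cong)
      fix x
      show "k x * E x * ennreal (h x ^ n) = k x * ennreal (exp (- (\<theta>0 + real n) * x))"
      proof (cases "x < 0")
        case False
        then have "exp (- \<theta>0 * x) * h x ^ n = exp (- (\<theta>0 + real n) * x)"
          by (simp add: h_def exp_of_nat_mult [symmetric] mult_exp_exp algebra_simps)
        then have "E x * ennreal (h x ^ n) = ennreal (exp (- (\<theta>0 + real n) * x))"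
          using h01(1) [of x] unfolding E_def by (subst ennreal_mult [symmetric]) auto
        then show ?thesis by (simp add: mult.assoc)
      qed (simp add: s)
    qed
    finally show ?thesis .
  qed
  let ?M = "D f" and ?N = "D g"
  have sets [simp]: "sets (D k) = sets borel" "space (D k) = UNIV" for k by (simp_all add: D_def)
  have M1: "emeasure ?M UNIV = laplace f \<theta>0" using moment [of f 0] supp by simp
  have N1: "emeasure ?N UNIV = laplace f \<theta>0" using moment [of g 0] supp eq [of 0] by simp
  interpret M: finite_measure ?M
    using M1 fin by (intro finite_measureI) (auto simp: less_top)
  interpret N: finite_measure ?N
    using N1 fin by (intro finite_measureI) (auto simp: less_top)
  have bint: "integrable ?M k" "integrable ?N k"
    if "k \<in> borel_measurable borel" "\<And>x. \<bar>k x\<bar> \<le> B" for k :: "real \<Rightarrow> real" and B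
    using that by (auto intro!: M.integrable_const_bound [where B = B] N.integrable_const_bound [where B = B]
        simp: measurable_cong_sets [of "D f" borel borel borel] measurable_cong_sets [of "D g" borel borel borel])
  have pow: "(\<integral>x. h x ^ n \<partial>?M) = (\<integral>x. h x ^ n \<partial>?N)" for n
  proof -
    have "(\<integral>\<^sup>+x. ennreal (h x ^ n) \<partial>?M) = (\<integral>\<^sup>+x. ennreal (h x ^ n) \<partial>?N)"
      by (simp add: moment supp eq)
    then show ?thesis
      using h01(1) by (subst (1 2) integral_eq_nn_integral) (auto simp: less_imp_le D_def)
  qed
  have poly: "(\<integral>x. (\<Sum>i\<le>n. a i * h x ^ i) \<partial>?M) = (\<integral>x. (\<Sum>i\<le>n. a i * h x ^ i) \<partial>?N)"
    for a :: "nat \<Rightarrow> real" and n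
  proof -
    have hb: "\<bar>h x ^ i\<bar> \<le> 1" for x i using h01 [of x] by (simp add: power_le_one)
    have [measurable]: "(\<lambda>x. h x ^ i) \<in> borel_measurable borel" for i by measurable
    have i: "integrable ?M (\<lambda>x. a i * h x ^ i)" "integrable ?N (\<lambda>x. a i * h x ^ i)" for i
      by (intro integrable_mult_right bint [where B = 1] hb; measurable)+
    show ?thesis
      by (simp only: Bochner_Integration.integral_sum [OF i(1)]
          Bochner_Integration.integral_sum [OF i(2)] integral_mult_right_zero pow)
  qed
  have cont: "(\<integral>x. k (h x) \<partial>?M) = (\<integral>x. k (h x) \<partial>?N)"
    if k: "continuous_on {0..1} k" and [measurable]: "k \<in> borel_measurable borel"
      and kb: "\<And>s. \<bar>k s\<bar> \<le> B" for k :: "real \<Rightarrow> real" and B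
  proof (rule ccontr)
    assume ne: "(\<integral>x. k (h x) \<partial>?M) \<noteq> (\<integral>x. k (h x) \<partial>?N)"
    \<comment> \<open>The summand 1 makes \<open>C\<close> positive and turns the final estimate
      into the contradiction e C <= e (C - 1).\<close>
    define C where "C = measure ?M UNIV + measure ?N UNIV + 1"
    have C: "C > 0" by (simp add: C_def add_nonneg_pos)
    define e where "e = \<bar>(\<integral>x. k (h x) \<partial>?M) - (\<integral>x. k (h x) \<partial>?N)\<bar> / C"
    have e: "e > 0" using ne C by (simp add: e_def)
    obtain p where p: "real_polynomial_function p" "\<And>x. x \<in> {0..1} \<Longrightarrow> \<bar>k x - p x\<bar> < e"
      using Stone_Weierstrass_real_polynomial_function [OF _ k e] by auto
    obtain a n where pa: "p = (\<lambda>x. \<Sum>i\<le>n. a i * x ^ i)"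
      using p(1) by (auto simp: real_polynomial_function_iff_sum)
    have ph: "\<bar>k (h x) - p (h x)\<bar> \<le> e" for x using p(2) [of "h x"] h01 [of x] by simp
    have pb: "\<bar>p (h x)\<bar> \<le> B + e" for x using ph [of x] kb [of "h x"] by linarith
    have [measurable]: "p \<in> borel_measurable borel" unfolding pa by measurable
    have ik: "integrable ?M (\<lambda>x. k (h x))" "integrable ?N (\<lambda>x. k (h x))"
      by (intro bint [where B = B] kb; measurable)+
    have ip: "integrable ?M (\<lambda>x. p (h x))" "integrable ?N (\<lambda>x. p (h x))"
      by (intro bint [where B = "B + e"] pb; measurable)+
    have 1: "\<bar>(\<integral>x. k (h x) \<partial>?M) - (\<integral>x. p (h x) \<partial>?M)\<bar> \<le> e * measure ?M UNIV"
    proof -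
      have "\<bar>(\<integral>x. k (h x) - p (h x) \<partial>?M)\<bar> \<le> (\<integral>x. e \<partial>?M)"
        by (rule integral_abs_bound_integral) (use ik ip ph in auto)
      then show ?thesis using ik ip by (simp add: mult.commute)
    qed
    have 2: "\<bar>(\<integral>x. k (h x) \<partial>?N) - (\<integral>x. p (h x) \<partial>?N)\<bar> \<le> e * measure ?N UNIV"
    proof -
      have "\<bar>(\<integral>x. k (h x) - p (h x) \<partial>?N)\<bar> \<le> (\<integral>x. e \<partial>?N)"
        by (rule integral_abs_bound_integral) (use ik ip ph in auto)
      then show ?thesis using ik ip by (simp add: mult.commute)
    qed
    have "(\<integral>x. p (h x) \<partial>?M) = (\<integral>x. p (h x) \<partial>?N)" unfolding pa by (rule poly)
    then have "e * C \<le> e * (measure ?M UNIV + measure ?N UNIV)"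
      using 1 2 C unfolding e_def by (simp add: distrib_left)
    then show False using e by (simp add: C_def)
  qed
  have lt: "measure ?M {x. h x < c} = measure ?N {x. h x < c}" for c
  proof -
    \<comment> \<open>Continuous ramps of width 1/n below \<open>c\<close>, converging pointwise to
      the indicator of s < c.\<close>
    define k where "k = (\<lambda>n::nat. \<lambda>s::real. min 1 (max 0 (real n * (c - s))))"
    have kb: "\<bar>k n s\<bar> \<le> 1" for n s by (auto simp: k_def)
    have [measurable]: "k n \<in> borel_measurable borel" for n unfolding k_def by measurable
    have kc: "continuous_on {0..1} (k n)" for n unfolding k_def by (intro continuous_intros)
    have lim: "(\<lambda>n. k n s) \<longlonglongrightarrow> indicator {s. s < c} s" for s
    proof (cases "s < c")
      case True
      obtain N :: nat where N: "1 / (c - s) < real N" using reals_Archimedean2 by blast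
      have "k n s = 1" if "n \<ge> N" for n
      proof -
        have "1 / (c - s) < real n" using N that by (meson less_le_trans of_nat_le_iff)
        then have "1 < real n * (c - s)" using True by (simp add: field_simps)
        then show ?thesis by (simp add: k_def)
      qed
      then have "(\<lambda>n. k n s) \<longlonglongrightarrow> 1" by (intro tendsto_eventually eventually_sequentiallyI [of N])
      then show ?thesis using True by simp
    next
      case False
      then have "k n s = 0" for n by (simp add: k_def mult_nonneg_nonpos)
      then show ?thesis using False by simp
    qed
    have lM: "(\<lambda>n. \<integral>x. k n (h x) \<partial>?M) \<longlonglongrightarrow> (\<integral>x. indicator {s. s < c} (h x) \<partial>?M)"
      by (rule integral_dominated_convergence [where w = "\<lambda>_. 1"]) (use kb lim M.integrable_const [of "1::real"] in \<open>auto simp: D_def\<close>)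
    have lN: "(\<lambda>n. \<integral>x. k n (h x) \<partial>?N) \<longlonglongrightarrow> (\<integral>x. indicator {s. s < c} (h x) \<partial>?N)"
      by (rule integral_dominated_convergence [where w = "\<lambda>_. 1"]) (use kb lim N.integrable_const [of "1::real"] in \<open>auto simp: D_def\<close>)
    have "(\<integral>x. indicator {s. s < c} (h x) \<partial>?M) = (\<integral>x. indicator {s. s < c} (h x) \<partial>?N :: real)"
      using LIMSEQ_unique [OF lM] lN cont [OF kc _ kb] by simp
    moreover have "(\<lambda>x. indicator {s. s < c} (h x) :: real) = indicator {x. h x < c}"
      by (auto simp: indicator_def)
    ultimately show ?thesis by simp
  qed
  \<comment> \<open>The two sets differ at most at negative arguments, where the density vanishes.
    Half-lines determine the measure.\<close>
  have tail: "emeasure (D k) {c<..} = emeasure (D k) {x. h x < exp (- c)}"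
    if [measurable]: "k \<in> borel_measurable borel" and s: "\<And>x. x < 0 \<Longrightarrow> k x = 0" for k c
  proof (rule emeasure_eq_AE)
    show "AE x in D k. x \<in> {c<..} \<longleftrightarrow> x \<in> {x. h x < exp (- c)}"
      unfolding D_def
    proof (subst AE_density)
      show "AE x in lborel. 0 < k x * E x \<longrightarrow> x \<in> {c<..} \<longleftrightarrow> x \<in> {x. h x < exp (- c)}"
      proof (intro AE_I2 impI)
        fix x assume "0 < k x * E x"
        then have "x \<ge> 0" using s [of x] by (cases "x < 0") auto
        then show "x \<in> {c<..} \<longleftrightarrow> x \<in> {x. h x < exp (- c)}" by (simp add: h_def)
      qed
    qed measurable
  qed (auto simp: D_def)
  have "?M = ?N"
  proof (rule measure_eqI_lessThan)
    fix c :: real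
    show "emeasure ?M {c<..} < \<infinity>" using M.emeasure_finite [of "{c<..}"] unfolding infinity_ennreal_def less_top .
    show "emeasure ?M {c<..} = emeasure ?N {c<..}"
    proof -
      have "emeasure ?M {x. h x < exp (- c)} = emeasure ?N {x. h x < exp (- c)}"
        using lt [of "exp (- c)"] by (simp add: M.emeasure_eq_measure N.emeasure_eq_measure)
      then show ?thesis by (simp add: tail supp)
    qed
  qed auto
  then have "AE x in lborel. f x * E x = g x * E x"
    unfolding D_def by (intro sigma_finite_measure.density_unique [OF sigma_finite_lborel]) auto
  then show ?thesis
  proof eventually_elim
    case (elim x)
    have "E x \<noteq> 0" "E x \<noteq> top" by (auto simp: E_def)
    then show ?case using elim by (simp add: mult.commute [of _ "E x"] ennreal_mult_cancel_left)
  qed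
qed

section \<open>Riemann sums and tails of Levy measures\<close>

lemma nn_integral_step_function:
  fixes \<phi> :: "nat \<Rightarrow> ennreal"
  assumes N: "N > 0"
  shows "(\<integral>\<^sup>+x. \<phi> (nat \<lfloor>N * x\<rfloor>) * indicator {0..} x \<partial>lborel) = (\<Sum>j. \<phi> j * ennreal (1 / N))"
proof -
  let ?I = "\<lambda>j. {real j / N..<(real j + 1) / N}"
  have mem: "x \<in> ?I j \<longleftrightarrow> 0 \<le> x \<and> j = nat \<lfloor>N * x\<rfloor>" for x j
  proof -
    have "x \<in> ?I j \<longleftrightarrow> real j \<le> N * x \<and> N * x < real j + 1"
      using N by (auto simp: field_simps)
    also have "\<dots> \<longleftrightarrow> 0 \<le> x \<and> j = nat \<lfloor>N * x\<rfloor>"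
    proof
      assume h: "real j \<le> N * x \<and> N * x < real j + 1"
      then have "\<lfloor>N * x\<rfloor> = int j" by (intro floor_unique) auto
      moreover have "0 \<le> N * x" using h by (meson of_nat_0_le_iff order_trans)
      ultimately show "0 \<le> x \<and> j = nat \<lfloor>N * x\<rfloor>" using N by (simp add: zero_le_mult_iff)
    next
      assume h: "0 \<le> x \<and> j = nat \<lfloor>N * x\<rfloor>"
      then have "0 \<le> N * x" using N by simp
      then have "real j = of_int \<lfloor>N * x\<rfloor>" using h by simp
      then show "real j \<le> N * x \<and> N * x < real j + 1" by linarith
    qed
    finally show ?thesis .
  qed
  have ind: "indicator (?I j) x = (if 0 \<le> x \<and> j = nat \<lfloor>N * x\<rfloor> then 1 else 0 :: ennreal)" for j x
    unfolding indicator_def using mem [of x j] by simp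
  have "(\<integral>\<^sup>+x. \<phi> (nat \<lfloor>N * x\<rfloor>) * indicator {0..} x \<partial>lborel)
      = (\<integral>\<^sup>+x. (\<Sum>j. \<phi> j * indicator (?I j) x) \<partial>lborel)"
  proof (rule nn_integral_cong)
    fix x :: real
    have "(\<Sum>j. \<phi> j * indicator (?I j) x) = (\<Sum>j\<in>{nat \<lfloor>N * x\<rfloor>}. \<phi> j * indicator (?I j) x)"
      by (rule suminf_finite) (simp_all only: ind, simp_all)
    then show "\<phi> (nat \<lfloor>N * x\<rfloor>) * indicator {0..} x = (\<Sum>j. \<phi> j * indicator (?I j) x)"
      by (simp only: ind) (simp add: indicator_def)
  qed
  also have "\<dots> = (\<Sum>j. \<integral>\<^sup>+x. \<phi> j * indicator (?I j) x \<partial>lborel)"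
    by (rule nn_integral_suminf) measurable
  also have "\<dots> = (\<Sum>j. \<phi> j * ennreal (1 / N))"
    using N by (intro suminf_cong) (simp add: nn_integral_cmult_indicator divide_right_mono diff_divide_distrib [symmetric])
  finally show ?thesis .
qed

lemma floor_over_tendsto:
  "(\<lambda>n. of_int \<lfloor>real (Suc n) * x\<rfloor> / real (Suc n)) \<longlonglongrightarrow> x"
proof (rule tendsto_sandwich)
  have "(\<lambda>n. x - 1 / real (Suc n)) \<longlonglongrightarrow> x - 0"
    by (intro tendsto_intros LIMSEQ_Suc [OF lim_1_over_n])
  then show "(\<lambda>n. x - 1 / real (Suc n)) \<longlonglongrightarrow> x" by simp
  show "\<forall>\<^sub>F n in sequentially. x - 1 / real (Suc n) \<le> of_int \<lfloor>real (Suc n) * x\<rfloor> / real (Suc n)"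
  proof (rule always_eventually, rule allI)
    fix n
    have "(real (Suc n) * x - 1) / real (Suc n) \<le> of_int \<lfloor>real (Suc n) * x\<rfloor> / real (Suc n)"
      by (rule divide_right_mono) linarith+
    then show "x - 1 / real (Suc n) \<le> of_int \<lfloor>real (Suc n) * x\<rfloor> / real (Suc n)"
      by (simp add: diff_divide_distrib del: of_nat_Suc)
  qed
  show "\<forall>\<^sub>F n in sequentially. of_int \<lfloor>real (Suc n) * x\<rfloor> / real (Suc n) \<le> x"
  proof (rule always_eventually, rule allI)
    fix n
    have "of_int \<lfloor>real (Suc n) * x\<rfloor> / real (Suc n) \<le> (real (Suc n) * x) / real (Suc n)"
      by (rule divide_right_mono) linarith+
    then show "of_int \<lfloor>real (Suc n) * x\<rfloor> / real (Suc n) \<le> x" by (simp del: of_nat_Suc)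
  qed
qed simp

text \<open>First-order vanishing at 0, which compensates a possible singularity of the tail of
  \<nu> there.\<close>

lemma exp_diff_le_linear:
  assumes "(t0::real) \<le> t" "0 \<le> t0" "0 \<le> x"
  shows "exp (- t0 * x) - exp (- t * x) \<le> (t - t0) * x"
proof -
  have "exp (- t0 * x) - exp (- t * x) = exp (- t0 * x) * (1 - exp (- (t - t0) * x))"
    by (simp add: algebra_simps mult_exp_exp)
  also have "\<dots> \<le> 1 * ((t - t0) * x)"
  proof (rule mult_mono)
    show "1 - exp (- (t - t0) * x) \<le> (t - t0) * x"
      using exp_ge_add_one_self [of "- (t - t0) * x"] by (simp add: algebra_simps)
    have "0 \<le> (t - t0) * x" using assms by simp
    then show "0 \<le> 1 - exp (- (t - t0) * x)" by (simp only: minus_mult_left [symmetric]) simp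
  qed (use assms in auto)
  finally show ?thesis by simp
qed

text \<open>The sample points floor(N x)/N of a cell other than the first are at least x/2, so a
  possible singularity of K at 0 is dominated by the rescaled K (x/2); the first cell does not
  contribute because the exponential difference vanishes at 0.\<close>
lemma riemann_sum_tendsto:
  fixes K :: "real \<Rightarrow> real"
  assumes K0: "\<And>x. 0 < x \<Longrightarrow> 0 \<le> K x" and Kdec: "\<And>x y. 0 < x \<Longrightarrow> x \<le> y \<Longrightarrow> K y \<le> K x"
    and Kc: "continuous_on {0<..} K" and Km [measurable]: "K \<in> borel_measurable borel"
    and t: "0 < t0" "t0 \<le> t"
    and fin: "(\<integral>\<^sup>+x. ennreal ((K (x / 2) + 1) * min ((t - t0) * x) (exp t0 * exp (- t0 * x))) * indicator {0<..} x \<partial>lborel) < \<infinity>"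
  defines "g \<equiv> \<lambda>x. exp (- t0 * x) - exp (- t * x)"
  shows "(\<lambda>n. \<Sum>j. ennreal ((K (real (Suc j) / real (Suc n)) + 1 / real (Suc n)) *
             g (real (Suc j) / real (Suc n)) / real (Suc n)))
         \<longlonglongrightarrow> (\<integral>\<^sup>+x. ennreal (K x * g x) * indicator {0<..} x \<partial>lborel)"
proof -
  have g0: "g 0 = 0" by (simp add: g_def)
  have gnn: "0 \<le> g x" if "0 \<le> x" for x using that t by (simp add: g_def mult_right_mono)
  have [measurable]: "g \<in> borel_measurable borel" unfolding g_def by measurable
  define N where "N = (\<lambda>n::nat. real (Suc n))"
  have N: "N n \<ge> 1" "N n > 0" for n by (auto simp: N_def)
  define \<phi> where "\<phi> = (\<lambda>n (j::nat). (K (real j / N n) + 1 / N n) * g (real j / N n))"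
  define S where "S = (\<lambda>n x. ennreal (\<phi> n (nat \<lfloor>N n * x\<rfloor>)) * indicator {0..} x)"
  have SI: "(\<integral>\<^sup>+x. S n x \<partial>lborel) = (\<Sum>j. ennreal ((K (real (Suc j) / real (Suc n)) + 1 / real (Suc n)) *
             g (real (Suc j) / real (Suc n)) / real (Suc n)))" for n
  proof -
    \<comment> \<open>The cell at 0 drops out because \<open>g 0 = 0\<close>, so the sum starts at
      index 1 and \<open>K\<close> is evaluated at positive points only.\<close>
    have z: "ennreal (\<phi> n 0) * ennreal (1 / N n) = 0" by (simp add: \<phi>_def g0)
    have "(\<integral>\<^sup>+x. S n x \<partial>lborel) = (\<Sum>j. ennreal (\<phi> n j) * ennreal (1 / N n))"
      unfolding S_def by (rule nn_integral_step_function) (rule N)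
    also have "\<dots> = (\<Sum>j. ennreal (\<phi> n (Suc j)) * ennreal (1 / N n))"
      using suminf_offset [OF summableI, of "\<lambda>j. ennreal (\<phi> n j) * ennreal (1 / N n)" 1] z by simp
    also have "\<dots> = (\<Sum>j. ennreal (\<phi> n (Suc j) / N n))"
      using K0 gnn N [of n] unfolding \<phi>_def
      by (intro suminf_cong) (auto simp: ennreal_mult' [symmetric] intro!: mult_nonneg_nonneg add_nonneg_nonneg)
    finally show ?thesis by (simp add: \<phi>_def N_def)
  qed
  \<comment> \<open>For the sample point y belonging to x, g y <= (t - t0) x because y <= x, and g y
    <= exp t0 exp (- t0 x) because y >= x - 1, the mesh being at most 1. The summand 1 bounds 1 /
    \<open>N n\<close>.\<close>
  define w where "w = (\<lambda>x. ennreal ((K (x / 2) + 1) * min ((t - t0) * x) (exp t0 * exp (- t0 * x))) * indicator {0<..} x)"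
  have "(\<lambda>n. \<integral>\<^sup>+x. S n x \<partial>lborel) \<longlonglongrightarrow> (\<integral>\<^sup>+x. ennreal (K x * g x) * indicator {0<..} x \<partial>lborel)"
  proof (rule nn_integral_dominated_convergence [where w = w])
    show "S n \<in> borel_measurable lborel" for n unfolding S_def \<phi>_def by measurable
    show "(\<lambda>x. ennreal (K x * g x) * indicator {0<..} x) \<in> borel_measurable lborel" by measurable
    show "w \<in> borel_measurable lborel" unfolding w_def by measurable
    show "integral\<^sup>N lborel w < \<infinity>" using fin by (simp add: w_def)
    show "AE x in lborel. S n x \<le> w x" for n
    proof (rule AE_I2)
      fix x :: real
      show "S n x \<le> w x"
      proof (cases "x > 0 \<and> nat \<lfloor>N n * x\<rfloor> \<noteq> 0")
        case False
        then have "S n x = 0"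
        proof (cases "x < 0")
          case False
          with \<open>\<not> (x > 0 \<and> nat \<lfloor>N n * x\<rfloor> \<noteq> 0)\<close> have "nat \<lfloor>N n * x\<rfloor> = 0"
            by (cases "x = 0") auto
          then show ?thesis by (simp add: S_def \<phi>_def g0)
        qed (simp add: S_def)
        then show ?thesis by simp
      next
        case True
        define y where "y = real (nat \<lfloor>N n * x\<rfloor>) / N n"
        have f: "real (nat \<lfloor>N n * x\<rfloor>) = of_int \<lfloor>N n * x\<rfloor>" using True N [of n] by simp
        have "real (nat \<lfloor>N n * x\<rfloor>) \<ge> 1" using True by linarith
        then have "N n * x / 2 \<le> real (nat \<lfloor>N n * x\<rfloor>)" using f by linarith
        then have y1: "x / 2 \<le> y" unfolding y_def using N [of n] by (simp add: field_simps)
        have y2: "y \<le> x" unfolding y_def f using N [of n] by (simp add: field_simps)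
        have "N n * x - N n \<le> real (nat \<lfloor>N n * x\<rfloor>)" using f N(1) [of n] by linarith
        then have y3: "x - 1 \<le> y" unfolding y_def using N [of n] by (simp add: field_simps)
        have y0: "0 < y" using y1 True by simp
        have "K y + 1 / N n \<le> K (x / 2) + 1"
          using Kdec [of "x / 2" y] y1 True N [of n] by (intro add_mono) auto
        moreover have "g y \<le> min ((t - t0) * x) (exp t0 * exp (- t0 * x))"
        proof (rule min.boundedI)
          have "g y \<le> (t - t0) * y" unfolding g_def by (rule exp_diff_le_linear) (use t y0 in auto)
          also have "\<dots> \<le> (t - t0) * x" using y2 t by (intro mult_left_mono) auto
          finally show "g y \<le> (t - t0) * x" .
          have "g y \<le> exp (- t0 * y)" by (simp add: g_def)
          also have "\<dots> \<le> exp (t0 + - t0 * x)"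
            using mult_left_mono [OF y3, of t0] t by (simp add: algebra_simps)
          finally show "g y \<le> exp t0 * exp (- t0 * x)" by (simp only: exp_add)
        qed
        ultimately have "(K y + 1 / N n) * g y \<le> (K (x / 2) + 1) * min ((t - t0) * x) (exp t0 * exp (- t0 * x))"
          using K0 [of "x / 2"] gnn [of y] y0 True by (intro mult_mono) auto
        then show ?thesis using True by (simp add: S_def w_def \<phi>_def y_def ennreal_leI)
      qed
    qed
    show "AE x in lborel. (\<lambda>n. S n x) \<longlonglongrightarrow> ennreal (K x * g x) * indicator {0<..} x"
    proof (rule AE_I2)
      fix x :: real
      show "(\<lambda>n. S n x) \<longlonglongrightarrow> ennreal (K x * g x) * indicator {0<..} x"
      proof (cases "x > 0")
        case False
        then have "S n x = 0" for n
          by (cases "x = 0") (auto simp: S_def \<phi>_def g0)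
        then show ?thesis using False by simp
      next
        case True
        have l: "(\<lambda>n. real (nat \<lfloor>N n * x\<rfloor>) / N n) \<longlonglongrightarrow> x"
        proof -
          have "real (nat \<lfloor>N n * x\<rfloor>) = of_int \<lfloor>N n * x\<rfloor>" for n
            using True N(2) [of n] by simp
          then show ?thesis using floor_over_tendsto [of x] by (simp add: N_def del: of_nat_Suc)
        qed
        have "isCont K x" using Kc True by (simp add: continuous_on_eq_continuous_at)
        then have 1: "(\<lambda>n. K (real (nat \<lfloor>N n * x\<rfloor>) / N n)) \<longlonglongrightarrow> K x"
          by (rule isCont_tendsto_compose [OF _ l])
        have 2: "(\<lambda>n. 1 / N n) \<longlonglongrightarrow> 0" unfolding N_def by (rule LIMSEQ_Suc [OF lim_1_over_n])
        have "isCont g x" unfolding g_def by (intro continuous_intros)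
        then have 3: "(\<lambda>n. g (real (nat \<lfloor>N n * x\<rfloor>) / N n)) \<longlonglongrightarrow> g x"
          by (rule isCont_tendsto_compose [OF _ l])
        have "(\<lambda>n. \<phi> n (nat \<lfloor>N n * x\<rfloor>)) \<longlonglongrightarrow> (K x + 0) * g x"
          unfolding \<phi>_def by (intro tendsto_mult tendsto_add 1 2 3)
        then have "(\<lambda>n. ennreal (\<phi> n (nat \<lfloor>N n * x\<rfloor>))) \<longlonglongrightarrow> ennreal (K x * g x)" by simp
        then show ?thesis using True by (simp add: S_def)
      qed
    qed
  qed
  then show ?thesis by (simp only: SI)
qed

section \<open>Tails of a Levy measure\<close>

lemma levy_measure_sets:
  assumes "levy_measure \<nu>"
  shows "space \<nu> = {0<..}" "\<And>x. 0 \<le> x \<Longrightarrow> {x<..} \<in> sets \<nu>"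
    "(\<lambda>z. z) \<in> borel_measurable \<nu>"
proof -
  have s: "sets \<nu> = sets (restrict_space borel {0<..})" using assms by (simp add: levy_measure_def)
  then have "space \<nu> = space (restrict_space borel ({0<..} :: real set))" by (rule sets_eq_imp_space_eq)
  then show "space \<nu> = {0<..}" by (simp add: space_restrict_space)
  show "{x<..} \<in> sets \<nu>" if "0 \<le> x" for x
    using that unfolding s by (subst sets_restrict_space_iff) auto
  show "(\<lambda>z. z) \<in> borel_measurable \<nu>"
    by (subst measurable_cong_sets [OF s refl]) (rule measurable_restrict_space1, simp)
qed

text \<open>Markov's inequality for min 1 z^2, which is at least \<open>c\<close> beyond x.\<close>

lemma levy_measure_tail_finite:
  assumes L: "levy_measure \<nu>" and x: "0 < x"
  shows "emeasure \<nu> {x<..} < \<infinity>"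
proof -
  have i: "integrable \<nu> (\<lambda>x. min 1 (x\<^sup>2))" using L by (simp add: levy_measure_def)
  define c where "c = min 1 (x\<^sup>2)"
  have c: "c > 0" using x by (simp add: c_def)
  have "ennreal c * emeasure \<nu> {x<..} = (\<integral>\<^sup>+z. ennreal c * indicator {x<..} z \<partial>\<nu>)"
    using levy_measure_sets [OF L] x by (simp add: nn_integral_cmult_indicator)
  also have "\<dots> \<le> (\<integral>\<^sup>+z. ennreal (norm (min 1 (z\<^sup>2))) \<partial>\<nu>)"
  proof (rule nn_integral_mono)
    fix z
    show "ennreal c * indicator {x<..} z \<le> ennreal (norm (min 1 (z\<^sup>2)))"
    proof (cases "z > x")
      case True
      then have "x\<^sup>2 \<le> z\<^sup>2" using x by (intro power_mono) auto
      then show ?thesis using True by (auto simp: c_def min_def intro!: ennreal_leI)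
    qed simp
  qed
  also have "\<dots> < \<infinity>" using i by (simp add: integrable_iff_bounded)
  finally show ?thesis using c by (auto simp: ennreal_mult_less_top)
qed

text \<open>Tonelli on the pairs with 0 < x < c z. The scale \<open>c\<close> is 1 in the
  integration by parts and 2 where the tail is evaluated at x / 2.\<close>

lemma nn_integral_levy_tail:
  assumes L: "levy_measure \<nu>" and [measurable]: "m \<in> borel_measurable borel" and c: "0 < c"
  shows "(\<integral>\<^sup>+x. emeasure \<nu> {x / c<..} * (m x * indicator {0<..} x) \<partial>lborel) =
    (\<integral>\<^sup>+z. (\<integral>\<^sup>+x. m x * indicator {0..c * z} x \<partial>lborel) \<partial>\<nu>)"
proof -
  interpret sigma_finite_measure \<nu> using L by (simp add: levy_measure_def)
  interpret pair_sigma_finite lborel \<nu> ..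
  note [measurable] = levy_measure_sets(3) [OF L]
  have sp: "space \<nu> = {0<..}" by (rule levy_measure_sets(1) [OF L])
  define F where "F = (\<lambda>x z. if x < c * z then m x * indicator {0<..} x else 0)"
  have "(\<integral>\<^sup>+x. emeasure \<nu> {x / c<..} * (m x * indicator {0<..} x) \<partial>lborel) =
      (\<integral>\<^sup>+x. (\<integral>\<^sup>+z. F x z \<partial>\<nu>) \<partial>lborel)"
  proof (rule nn_integral_cong)
    fix x :: real
    show "emeasure \<nu> {x / c<..} * (m x * indicator {0<..} x) = (\<integral>\<^sup>+z. F x z \<partial>\<nu>)"
    proof (cases "x > 0")
      case True
      have "(\<integral>\<^sup>+z. F x z \<partial>\<nu>) = (\<integral>\<^sup>+z. m x * indicator {x / c<..} z \<partial>\<nu>)"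
        using True c by (intro nn_integral_cong) (auto simp: F_def indicator_def field_simps)
      also have "\<dots> = m x * emeasure \<nu> {x / c<..}"
        using True c levy_measure_sets(2) [OF L] by (simp add: nn_integral_cmult_indicator)
      finally show ?thesis using True by (simp add: mult.commute)
    next
      case False
      then have "F x z = 0" for z by (simp add: F_def)
      then show ?thesis using False by simp
    qed
  qed
  also have "\<dots> = (\<integral>\<^sup>+z. (\<integral>\<^sup>+x. F x z \<partial>lborel) \<partial>\<nu>)"
    by (rule Fubini' [symmetric]) (unfold F_def, measurable)
  also have "\<dots> = (\<integral>\<^sup>+z. (\<integral>\<^sup>+x. m x * indicator {0..c * z} x \<partial>lborel) \<partial>\<nu>)"
  proof (rule nn_integral_cong)
    fix z
    show "(\<integral>\<^sup>+x. F x z \<partial>lborel) = (\<integral>\<^sup>+x. m x * indicator {0..c * z} x \<partial>lborel)"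
    proof (rule nn_integral_cong_AE)
      show "AE x in lborel. F x z = m x * indicator {0..c * z} x"
        using AE_lborel_singleton [of 0] AE_lborel_singleton [of "c * z"]
        by eventually_elim (auto simp: F_def indicator_def)
    qed
  qed
  finally show ?thesis .
qed

section \<open>Limits of renewal sequences\<close>

lemma nn_integral_exp_atLeast:
  assumes "0 < (t::real)"
  shows "(\<integral>\<^sup>+x. ennreal (exp (- t * x)) * indicator {a..} x \<partial>lborel) = ennreal (exp (- t * a) / t)"
proof -
  have "(\<integral>\<^sup>+x. ennreal (exp (- t * x)) * indicator {a..} x \<partial>lborel) = ennreal (0 - (- exp (- t * a) / t))"
  proof (rule nn_integral_FTC_atLeast)
    show "((\<lambda>x. - exp (- t * x) / t) has_real_derivative exp (- t * x)) (at x)" for x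
      using assms by (auto intro!: derivative_eq_intros)
    have "LIM x at_top. - t * x :> at_bot"
      using assms by (intro filterlim_tendsto_neg_mult_at_bot [OF tendsto_const _ filterlim_ident]) auto
    then have "((\<lambda>x. exp (- t * x)) \<longlongrightarrow> 0) at_top"
      by (rule filterlim_compose [OF exp_at_bot])
    then have "((\<lambda>x. - exp (- t * x) / t) \<longlongrightarrow> - 0 / t) at_top"
      by (intro tendsto_intros) (use assms in auto)
    then show "((\<lambda>x. - exp (- t * x) / t) \<longlongrightarrow> 0) at_top" by simp
  qed auto
  then show ?thesis by simp
qed

lemma countable_avoid:
  fixes a b :: real
  assumes "countable D" "a < b"
  obtains y where "a < y" "y < b" "y \<notin> D"
proof -
  have "\<not> {a<..<b} \<subseteq> D"
    using uncountable_open_interval [of a b] assms countable_subset by auto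
  then show ?thesis using that by (meson greaterThanLessThan_iff subsetI)
qed

lemma countable_avoid_seq:
  assumes "countable D"
  obtains h :: "nat \<Rightarrow> real" where "\<And>n. h n > 0" "\<And>n. h n \<notin> D" "h \<longlonglongrightarrow> 0"
proof -
  have "\<exists>y. 0 < y \<and> y < 1 / real (Suc n) \<and> y \<notin> D" for n
    by (rule countable_avoid [OF assms, of 0 "1 / real (Suc n)"]) auto
  then obtain h where h: "\<And>n. 0 < h n" "\<And>n. h n < 1 / real (Suc n)" "\<And>n. h n \<notin> D"
    by metis
  have "h \<longlonglongrightarrow> 0"
    by (rule tendsto_sandwich [OF _ _ tendsto_const LIMSEQ_Suc [OF lim_1_over_n]])
      (use h in \<open>auto intro!: always_eventually less_imp_le\<close>)
  then show ?thesis using that h by blast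
qed

text \<open>The distribution functions of the renewal sequences, rescaled to the lattices of width
  1/(n+1), have a pointwise limit along a subsequence by the Helly selection theorem, applied after
  the bounded transformation 1 - exp (- v).\<close>
lemma renewal_limit:
  fixes A :: "nat \<Rightarrow> real" and f :: "nat \<Rightarrow> nat \<Rightarrow> real" and F :: "nat \<Rightarrow> real \<Rightarrow> real"
  assumes t0: "t0 > 0" and m0: "m0 > 0"
    and fpos: "\<And>n j. f n (Suc j) > 0"
    and flc: "\<And>n j. (f n (Suc (Suc j)))\<^sup>2 \<le> f n (Suc j) * f n (Suc (Suc (Suc j)))"
    and Fsum: "\<And>n t. t \<ge> t0 \<Longrightarrow> (\<lambda>j. f n (Suc j) * exp (- t / real (Suc n)) ^ Suc j) sums F n t"
    and A: "\<And>n. A n = m0 + F n t0"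
    and lim: "\<And>t. t \<ge> t0 \<Longrightarrow> (\<lambda>n. A n - F n t) \<longlonglongrightarrow> d t"
  obtains V where "mono V" "\<And>x. x < 0 \<Longrightarrow> V x = 0" "\<And>x. 0 \<le> V x" "log_convex_increments V"
    "\<And>t. t > t0 \<Longrightarrow> laplace (\<lambda>x. ennreal (V x)) t = ennreal (1 / (t * d t))"
proof -
  define N where "N = (\<lambda>n::nat. real (Suc n))"
  have N: "N n > 0" for n by (simp add: N_def)
  define e where "e = (\<lambda>n t. exp (- t / N n))"
  have Fs: "(\<lambda>j. f n (Suc j) * e n t ^ Suc j) sums F n t" if "t \<ge> t0" for n t
    using Fsum [OF that] by (simp add: e_def N_def)
  have Fdec: "F n t \<le> F n t0" if "t \<ge> t0" for n t
  proof (rule sums_le [OF _ Fs [OF that] Fs [OF order_refl]])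
    fix j
    have "e n t ^ Suc j \<le> e n t0 ^ Suc j"
      using that N [of n] by (intro power_mono) (auto simp: e_def field_simps)
    then show "f n (Suc j) * e n t ^ Suc j \<le> f n (Suc j) * e n t0 ^ Suc j"
      using fpos [of n j] by (intro mult_left_mono) auto
  qed
  have F0: "0 \<le> F n t" if "t \<ge> t0" for n t
    by (rule sums_le [OF _ sums_zero Fs [OF that]]) (use fpos in \<open>auto simp: e_def less_imp_le\<close>)
  have Ap: "A n > 0" for n using A F0 [of t0 n] m0 by (simp add: add_pos_nonneg)
  have Dm: "m0 \<le> A n - F n t" if "t \<ge> t0" for n t using A [of n] Fdec [OF that] by simp
  have dm: "m0 \<le> d t" if "t \<ge> t0" for t
    by (rule LIMSEQ_le_const [OF lim [OF that]]) (use Dm that in auto)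

  \<comment> \<open>Rescaled renewal distribution functions\<close>
  define u where "u = (\<lambda>n. renewal (A n) (f n))"
  have upos: "u n j > 0" for n j unfolding u_def by (rule renewal_pos [of "A n" "f n", OF Ap fpos])
  have ulc: "(u n (Suc j))\<^sup>2 \<le> u n j * u n (Suc (Suc j))" for n j
    unfolding u_def by (rule renewal_log_convex [of "A n" "f n", OF Ap fpos flc])
  have usum: "(\<lambda>j. u n j * e n t ^ j) sums (1 / (A n - F n t))" if "t \<ge> t0" for n t
    unfolding u_def
    by (rule renewal_generating_function [of "A n" "f n", OF Ap fpos _ Fs [OF that]])
      (use Dm [OF that, of n] m0 in \<open>auto simp: e_def\<close>)
  define S where "S = (\<lambda>n m. \<Sum>j\<le>m. u n j)"
  have Smono: "S n m \<le> S n l" if "m \<le> l" for n m l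
    unfolding S_def using that upos by (intro sum_mono2) (auto simp: less_imp_le)
  have S0: "0 < S n m" for n m unfolding S_def using upos by (intro sum_pos) auto
  define v where "v = (\<lambda>n x. if x < 0 then 0 else S n (nat \<lfloor>N n * x\<rfloor>))"
  have v0: "0 \<le> v n x" for n x using S0 by (auto simp: v_def less_imp_le)
  have vmono: "mono (v n)" for n
  proof (rule monoI)
    fix x y :: real assume "x \<le> y"
    then have "nat \<lfloor>N n * x\<rfloor> \<le> nat \<lfloor>N n * y\<rfloor>"
      using N [of n] by (intro nat_mono floor_mono mult_left_mono) auto
    then show "v n x \<le> v n y" using \<open>x \<le> y\<close> Smono S0 by (auto simp: v_def less_imp_le)
  qed
  \<comment> \<open>Chernoff bound uniform in n: a jump at \<open>real j / N n\<close> <= x is at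
    most exp (t0 x) times its tilted mass, and the total tilted mass at \<open>t0\<close> is 1 / m0
    because \<open>A n - F n t0 = m0\<close>.\<close>
  define B where "B = (\<lambda>x. exp (t0 * x) / m0)"
  have vB: "v n x \<le> B x" if "x \<ge> 0" for n x
  proof -
    have "S n (nat \<lfloor>N n * x\<rfloor>) \<le> (\<Sum>j\<le>nat \<lfloor>N n * x\<rfloor>. exp (t0 * x) * (u n j * e n t0 ^ j))"
      unfolding S_def
    proof (rule sum_mono)
      fix j assume "j \<in> {..nat \<lfloor>N n * x\<rfloor>}"
      then have "j \<le> nat \<lfloor>N n * x\<rfloor>" by simp
      moreover have "0 \<le> N n * x" using that N [of n] by simp
      ultimately have "real j \<le> N n * x" by (simp add: le_nat_floor le_nat_iff le_floor_iff)
      then have "t0 * (real j / N n) \<le> t0 * x"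
        using N [of n] t0 by (intro mult_left_mono) (auto simp: field_simps)
      then have "1 \<le> exp (t0 * x - t0 * (real j / N n))" by simp
      also have "\<dots> = exp (t0 * x) * e n t0 ^ j"
        unfolding e_def exp_of_nat_mult [symmetric] mult_exp_exp by (simp add: algebra_simps)
      finally have "u n j * 1 \<le> u n j * (exp (t0 * x) * e n t0 ^ j)"
        using upos [of n j] by (intro mult_left_mono) auto
      then show "u n j \<le> exp (t0 * x) * (u n j * e n t0 ^ j)" by (simp add: ac_simps)
    qed
    also have "\<dots> = exp (t0 * x) * (\<Sum>j\<le>nat \<lfloor>N n * x\<rfloor>. u n j * e n t0 ^ j)"
      by (simp add: sum_distrib_left)
    also have "\<dots> \<le> exp (t0 * x) * (1 / (A n - F n t0))"
    proof (rule mult_left_mono)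
      have s: "summable (\<lambda>j. u n j * e n t0 ^ j)" "(\<Sum>j. u n j * e n t0 ^ j) = 1 / (A n - F n t0)"
        using usum [of t0 n] by (simp_all add: sums_iff)
      show "(\<Sum>j\<le>nat \<lfloor>N n * x\<rfloor>. u n j * e n t0 ^ j) \<le> 1 / (A n - F n t0)"
        unfolding s(2) [symmetric] using upos
        by (intro sum_le_suminf s(1)) (auto simp: e_def less_imp_le)
    qed simp
    finally show ?thesis using that by (simp add: v_def B_def A)
  qed
  have vrc: "continuous (at_right x) (v n)" for n x
  proof -
    have "\<forall>\<^sub>F y in at_right x. v n y = v n x"
    proof (cases "x < 0")
      case True
      have "\<forall>\<^sub>F y in at_right x. y < 0" using True by (auto simp: eventually_at_right)
      then show ?thesis by eventually_elim (use True in \<open>simp add: v_def\<close>)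
    next
      case False
      define b where "b = (of_int \<lfloor>N n * x\<rfloor> + 1) / N n"
      have "x < b" unfolding b_def using N [of n] by (simp add: pos_less_divide_eq mult.commute [of x])
      then have "\<forall>\<^sub>F y in at_right x. x < y \<and> y < b"
        by (auto simp: eventually_at_right)
      then show ?thesis
      proof eventually_elim
        case (elim y)
        have "\<lfloor>N n * y\<rfloor> = \<lfloor>N n * x\<rfloor>"
        proof (rule floor_unique)
          have "of_int \<lfloor>N n * x\<rfloor> \<le> N n * x" by simp
          also have "\<dots> \<le> N n * y" using elim N [of n] by simp
          finally show "of_int \<lfloor>N n * x\<rfloor> \<le> N n * y" .
          show "N n * y < of_int \<lfloor>N n * x\<rfloor> + 1"
            using elim N [of n] by (simp add: b_def field_simps)
        qed
        then show ?case using elim False by (simp add: v_def)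
      qed
    qed
    then have "(v n \<longlongrightarrow> v n x) (at_right x)" by (rule tendsto_eventually)
    then show ?thesis by (simp add: continuous_within)
  qed

  \<comment> \<open>Pointwise limit along a subsequence\<close>
  have h1: "continuous (at_right x) (\<lambda>x. 1 - exp (- v n x))" for n x
    by (intro continuous_intros vrc)
  have h2: "mono (\<lambda>x. 1 - exp (- v n x))" for n
    using vmono [of n] by (auto simp: mono_def)
  have h3: "\<bar>1 - exp (- v n x)\<bar> \<le> 1" for n x using v0 [of n x] by simp
  obtain s G where s: "strict_mono (s :: nat \<Rightarrow> nat)" and Grc: "\<And>x. continuous (at_right x) G"
    and Gm: "mono G" and Gl: "\<And>x. continuous (at x) G \<Longrightarrow> (\<lambda>n. 1 - exp (- v (s n) x)) \<longlonglongrightarrow> G x"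
    using Helly_selection [of "\<lambda>n x. 1 - exp (- v n x)", OF h1 h2 h3] by blast
  define D where "D = {x. \<not> isCont G x}"
  have cD: "countable D" unfolding D_def by (rule mono_ctble_discont [OF Gm])
  \<comment> \<open>The uniform bound \<open>B\<close> keeps the transformed limit strictly below 1,
    so that undoing the transformation gives a finite function.\<close>
  have G1: "G x < 1" for x
  proof -
    obtain y where y: "max x 0 < y" "y \<notin> D"
      using countable_avoid [OF cD, of "max x 0" "max x 0 + 1"] by auto
    have "G y \<le> 1 - exp (- B y)"
    proof (rule LIMSEQ_le_const2)
      show "(\<lambda>n. 1 - exp (- v (s n) y)) \<longlonglongrightarrow> G y" using y by (intro Gl) (simp add: D_def)
      show "\<exists>N. \<forall>n\<ge>N. 1 - exp (- v (s n) y) \<le> 1 - exp (- B y)" using vB y by auto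
    qed
    moreover have "G x \<le> G y" using Gm y by (auto simp: mono_def)
    moreover have "exp (- B y) > 0" by simp
    ultimately show ?thesis by linarith
  qed
  have Gneg: "G x = 0" if "x < 0" for x
  proof -
    have z: "G y = 0" if "y < 0" "y \<notin> D" for y
      using Gl [of y] that by (simp add: D_def v_def LIMSEQ_const_iff)
    obtain y1 where y1: "x - 1 < y1" "y1 < x" "y1 \<notin> D" using countable_avoid [OF cD, of "x - 1" x] by auto
    obtain y2 where y2: "x < y2" "y2 < 0" "y2 \<notin> D" using countable_avoid [OF cD \<open>x < 0\<close>] by auto
    have "G y1 \<le> G x" "G x \<le> G y2" using Gm y1 y2 by (auto simp: mono_def)
    then show ?thesis using z [of y1] z [of y2] y1 y2 by simp
  qed
  have G0: "0 \<le> G x" for x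
    using monoD [OF Gm, of "min x (-1)" x] Gneg [of "min x (-1)"] by simp
  define V where "V = (\<lambda>x. - ln (1 - G x))"
  have Vm: "mono V"
  proof (rule monoI)
    fix x y :: real assume "x \<le> y"
    then show "V x \<le> V y" using Gm G1 [of x] G1 [of y] by (auto simp: V_def mono_def)
  qed
  have Vneg: "V x = 0" if "x < 0" for x using Gneg [OF that] by (simp add: V_def)
  have V0: "0 \<le> V x" for x using G0 [of x] G1 [of x] by (simp add: V_def)
  have Vrc: "(V \<longlongrightarrow> V x) (at_right x)" for x
    using Grc [of x] G1 [of x] unfolding V_def continuous_within
    by (intro tendsto_minus tendsto_ln tendsto_diff tendsto_const) auto
  have Vc: "isCont V x" if "x \<notin> D" for x
    using that G1 [of x] unfolding V_def D_def by (intro continuous_intros) auto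
  have Vl: "(\<lambda>n. v (s n) x) \<longlonglongrightarrow> V x" if "x \<notin> D" for x
  proof -
    have "(\<lambda>n. - ln (1 - (1 - exp (- v (s n) x)))) \<longlonglongrightarrow> V x"
      unfolding V_def using that G1 [of x]
      by (intro tendsto_minus tendsto_ln tendsto_diff tendsto_const Gl) (auto simp: D_def)
    then show ?thesis by simp
  qed
  \<comment> \<open>Convergence along moving arguments, because lattice points only approximate x.
    Monotonicity traps the values between continuity points a < x < b.\<close>
  have Vl': "(\<lambda>n. v (s n) (y n)) \<longlonglongrightarrow> V x" if x: "x \<notin> D" and y: "y \<longlonglongrightarrow> x" for x y
  proof (rule LIMSEQ_I)
    fix r :: real assume r: "r > 0"
    have "isCont V x" by (rule Vc [OF x])
    then obtain \<delta> where \<delta>: "\<delta> > 0" "\<And>z. \<bar>z - x\<bar> < \<delta> \<Longrightarrow> \<bar>V z - V x\<bar> < r / 2"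
      using r unfolding continuous_at_eps_delta dist_real_def by (metis half_gt_zero)
    obtain a where a: "x - \<delta> < a" "a < x" "a \<notin> D" using countable_avoid [OF cD, of "x - \<delta>" x] \<delta> by auto
    obtain b where b: "x < b" "b < x + \<delta>" "b \<notin> D" using countable_avoid [OF cD, of x "x + \<delta>"] \<delta> by auto
    have "\<bar>V a - V x\<bar> < r / 2" "\<bar>V b - V x\<bar> < r / 2" using \<delta>(2) [of a] \<delta>(2) [of b] a b by auto
    then have 1: "V x - r < V a" "V b < V x + r" using r by linarith+
    have "\<forall>\<^sub>F n in sequentially. V x - r < v (s n) a" using order_tendstoD(1) [OF Vl [OF a(3)]] 1 by blast
    moreover have "\<forall>\<^sub>F n in sequentially. v (s n) b < V x + r" using order_tendstoD(2) [OF Vl [OF b(3)]] 1 by blast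
    moreover have "\<forall>\<^sub>F n in sequentially. a < y n" using order_tendstoD(1) [OF y] a by blast
    moreover have "\<forall>\<^sub>F n in sequentially. y n < b" using order_tendstoD(2) [OF y] b by blast
    ultimately have "\<forall>\<^sub>F n in sequentially. norm (v (s n) (y n) - V x) < r"
    proof eventually_elim
      case (elim n)
      have "v (s n) a \<le> v (s n) (y n)" "v (s n) (y n) \<le> v (s n) b"
        using vmono [of "s n"] elim by (auto simp: mono_def)
      then show ?case using elim by simp
    qed
    then show "\<exists>no. \<forall>n\<ge>no. norm (v (s n) (y n) - V x) < r" by (simp add: eventually_sequentially)
  qed

  \<comment> \<open>Laplace transform of the limit\<close>
  have lap: "laplace (\<lambda>x. ennreal (V x)) t = ennreal (1 / (t * d t))" if t: "t > t0" for t
  proof -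
    have tp: "t > 0" using t t0 by simp
    have [measurable]: "v n \<in> borel_measurable borel" for n by (rule borel_measurable_mono [OF vmono])
    have [measurable]: "V \<in> borel_measurable borel" by (rule borel_measurable_mono [OF Vm])
    \<comment> \<open>A jump of size \<open>u n j\<close> at the lattice point contributes its
      tilted mass divided by t; the generating function adds these up.\<close>
    have lv: "laplace (\<lambda>x. ennreal (v n x)) t = ennreal (1 / (A n - F n t) / t)" for n
    proof -
      have "laplace (\<lambda>x. ennreal (v n x)) t =
          (\<integral>\<^sup>+x. (\<Sum>j. ennreal (u n j) * (ennreal (exp (- t * x)) * indicator {real j / N n..} x)) \<partial>lborel)"
        unfolding laplace_def
      proof (rule nn_integral_cong)
        fix x :: real
        have mem: "real j / N n \<le> x \<longleftrightarrow> 0 \<le> x \<and> j \<le> nat \<lfloor>N n * x\<rfloor>" for j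
        proof -
          have "real j / N n \<le> x \<longleftrightarrow> real j \<le> N n * x" using N [of n] by (simp add: field_simps)
          also have "\<dots> \<longleftrightarrow> 0 \<le> N n * x \<and> j \<le> nat \<lfloor>N n * x\<rfloor>"
          proof
            assume h: "real j \<le> N n * x"
            then show "0 \<le> N n * x \<and> j \<le> nat \<lfloor>N n * x\<rfloor>"
              using of_nat_0_le_iff [of j, where 'a = real] by (auto simp: le_nat_floor)
          next
            assume h: "0 \<le> N n * x \<and> j \<le> nat \<lfloor>N n * x\<rfloor>"
            then have "real j \<le> real (nat \<lfloor>N n * x\<rfloor>)" using of_nat_mono by blast
            also have "\<dots> \<le> N n * x" using h by simp
            finally show "real j \<le> N n * x" .
          qed
          finally show ?thesis using N [of n] by (simp add: zero_le_mult_iff)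
        qed
        have ind: "indicator {real j / N n..} x = (if 0 \<le> x \<and> j \<le> nat \<lfloor>N n * x\<rfloor> then 1 else 0 :: ennreal)" for j
          unfolding indicator_def using mem [of j] by simp
        have "(\<Sum>j. ennreal (u n j) * (ennreal (exp (- t * x)) * indicator {real j / N n..} x)) =
            (\<Sum>j\<le>nat \<lfloor>N n * x\<rfloor>. ennreal (u n j) * (ennreal (exp (- t * x)) * indicator {real j / N n..} x))"
          by (rule suminf_finite) (simp_all only: ind, simp_all)
        also have "\<dots> = (\<Sum>j\<le>nat \<lfloor>N n * x\<rfloor>. if 0 \<le> x then ennreal (u n j) * ennreal (exp (- t * x)) else 0)"
          by (rule sum.cong) (simp_all only: ind, auto)
        also have "\<dots> = ennreal (v n x) * ennreal (exp (- t * x))"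
          using upos [of n] by (auto simp: v_def S_def sum_distrib_right [symmetric] sum_ennreal less_imp_le)
        finally show "ennreal (v n x) * ennreal (exp (- t * x)) =
          (\<Sum>j. ennreal (u n j) * (ennreal (exp (- t * x)) * indicator {real j / N n..} x))" by simp
      qed
      also have "\<dots> = (\<Sum>j. \<integral>\<^sup>+x. ennreal (u n j) * (ennreal (exp (- t * x)) * indicator {real j / N n..} x) \<partial>lborel)"
        by (rule nn_integral_suminf) measurable
      also have "\<dots> = (\<Sum>j. ennreal (u n j * e n t ^ j / t))"
      proof (rule suminf_cong)
        fix j
        have "(\<integral>\<^sup>+x. ennreal (u n j) * (ennreal (exp (- t * x)) * indicator {real j / N n..} x) \<partial>lborel) =
            ennreal (u n j) * ennreal (exp (- t * (real j / N n)) / t)"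
          unfolding nn_integral_exp_atLeast [OF tp, symmetric] by (rule nn_integral_cmult) measurable
        also have "exp (- t * (real j / N n)) = e n t ^ j"
          by (simp add: e_def exp_of_nat_mult [symmetric] ac_simps)
        also have "ennreal (u n j) * ennreal (e n t ^ j / t) = ennreal (u n j * e n t ^ j / t)"
          using upos [of n j] tp by (simp add: ennreal_mult' [symmetric] e_def less_imp_le)
        finally show "(\<integral>\<^sup>+x. ennreal (u n j) * (ennreal (exp (- t * x)) * indicator {real j / N n..} x) \<partial>lborel) =
            ennreal (u n j * e n t ^ j / t)" .
      qed
      also have "\<dots> = ennreal (1 / (A n - F n t) / t)"
      proof -
        have "(\<lambda>j. u n j * e n t ^ j / t) sums (1 / (A n - F n t) / t)"
          using usum t by (intro sums_divide) auto
        then show ?thesis using upos tp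
          by (subst suminf_ennreal2) (auto simp: sums_iff e_def less_imp_le)
      qed
      finally show ?thesis .
    qed
    \<comment> \<open>The uniform bound \<open>B\<close> grows like exp (t0 x), so domination works
      for t strictly above \<open>t0\<close>.\<close>
    have l1: "(\<lambda>n. laplace (\<lambda>x. ennreal (v (s n) x)) t) \<longlonglongrightarrow> laplace (\<lambda>x. ennreal (V x)) t"
      unfolding laplace_def
    proof (rule nn_integral_dominated_convergence [where w = "\<lambda>x. ennreal (1 / m0) * (ennreal (exp (- (t - t0) * x)) * indicator {0..} x)"])
      show "(\<integral>\<^sup>+x. ennreal (1 / m0) * (ennreal (exp (- (t - t0) * x)) * indicator {0..} x) \<partial>lborel) < \<infinity>"
        using nn_integral_exp_atLeast [of "t - t0" 0] t
        by (subst nn_integral_cmult) (auto simp del: minus_diff_eq simp: ennreal_mult_less_top)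
      show "AE x in lborel. ennreal (v (s n) x) * ennreal (exp (- t * x)) \<le> ennreal (1 / m0) * (ennreal (exp (- (t - t0) * x)) * indicator {0..} x)" for n
      proof (rule AE_I2)
        fix x :: real
        show "ennreal (v (s n) x) * ennreal (exp (- t * x)) \<le> ennreal (1 / m0) * (ennreal (exp (- (t - t0) * x)) * indicator {0..} x)"
        proof (cases "x < 0")
          case False
          have "v (s n) x * exp (- t * x) \<le> B x * exp (- t * x)"
            using vB [of x "s n"] False by (intro mult_right_mono) auto
          also have "\<dots> = 1 / m0 * exp (- (t - t0) * x)"
            by (simp add: B_def mult_exp_exp algebra_simps)
          finally show ?thesis using False v0 [of "s n" x] m0
            by (simp add: ennreal_mult [symmetric] ennreal_leI)
        qed (simp add: v_def)
      qed
      have "AE x in lborel. x \<notin> D"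
        using cD by (intro AE_not_in countable_imp_null_set_lborel)
      then show "AE x in lborel. (\<lambda>n. ennreal (v (s n) x) * ennreal (exp (- t * x))) \<longlonglongrightarrow> ennreal (V x) * ennreal (exp (- t * x))"
      proof eventually_elim
        case (elim x)
        have "(\<lambda>n. ennreal (v (s n) x * exp (- t * x))) \<longlonglongrightarrow> ennreal (V x * exp (- t * x))"
          by (intro tendsto_ennrealI tendsto_mult Vl elim tendsto_const)
        then show ?case using v0 V0 by (simp add: ennreal_mult [symmetric])
      qed
    qed measurable
    have dp: "d t > 0" using dm [of t] t m0 by simp
    have "(\<lambda>n. 1 / (A n - F n t) / t) \<longlonglongrightarrow> 1 / d t / t"
      using dp tp t by (intro tendsto_intros lim) auto
    then have "(\<lambda>n. ennreal (1 / (A (s n) - F (s n) t) / t)) \<longlonglongrightarrow> ennreal (1 / d t / t)"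
      by (intro tendsto_ennrealI) (rule LIMSEQ_subseq_LIMSEQ [OF _ s, unfolded o_def])
    then have "laplace (\<lambda>x. ennreal (V x)) t = ennreal (1 / d t / t)"
      using l1 LIMSEQ_unique unfolding lv by blast
    then show ?thesis by (simp add: mult.commute)
  qed

  \<comment> \<open>Log-convexity of the increments of the limit\<close>
  have lci: "log_convex_increments V"
    unfolding log_convex_increments_def
  proof (intro conjI allI impI)
    show "V x \<le> V (x + \<eta>)" if "0 < \<eta>" "0 < x" for x \<eta> using Vm that by (simp add: mono_def)
    fix \<eta> \<beta> :: real assume \<eta>: "0 < \<eta>"
    define Q where "Q = (\<lambda>x. exp (\<beta> * x) * (V (x + \<eta>) - V x))"
    have three: "(y - x) * Q z \<le> (y - z) * Q x + (z - x) * Q y"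
      if xyz: "0 < x" "x < z" "z < y" and nD: "x \<notin> D" "y \<notin> D" "z \<notin> D" "x + \<eta> \<notin> D" "y + \<eta> \<notin> D" "z + \<eta> \<notin> D"
      for x y z
    proof -
      define i where "i = (\<lambda>x n. nat \<lfloor>N (s n) * x\<rfloor>)"
      have ir: "real (i w n) = of_int \<lfloor>N (s n) * w\<rfloor>" if "0 < w" for w n
        using that N [of "s n"] by (simp add: i_def)
      have il: "(\<lambda>n. real (i w n) / N (s n)) \<longlonglongrightarrow> w" if "0 < w" for w
      proof -
        have a: "filterlim (\<lambda>n. N (s n)) at_top sequentially"
          unfolding N_def
          by (intro filterlim_compose [OF filterlim_real_sequentially] filterlim_compose [OF filterlim_Suc] filterlim_subseq s)
        have b: "(\<lambda>n. w - 1 / N (s n)) \<longlonglongrightarrow> w - 0"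
          by (intro tendsto_diff tendsto_const tendsto_divide_0 [OF tendsto_const] filterlim_at_top_imp_at_infinity a)
        show ?thesis
        proof (rule tendsto_sandwich [OF _ _ _ tendsto_const])
          show "(\<lambda>n. w - 1 / N (s n)) \<longlonglongrightarrow> w" using b by simp
          have "w - 1 / N (s n) \<le> real (i w n) / N (s n)" for n
          proof -
            have "(N (s n) * w - 1) / N (s n) \<le> real (i w n) / N (s n)"
              unfolding ir [OF that] using N [of "s n"] by (intro divide_right_mono) linarith+
            then show ?thesis using N [of "s n"] by (simp add: diff_divide_distrib)
          qed
          then show "\<forall>\<^sub>F n in sequentially. w - 1 / N (s n) \<le> real (i w n) / N (s n)" by simp
          have "real (i w n) / N (s n) \<le> w" for n
            unfolding ir [OF that] using N [of "s n"] by (simp add: pos_divide_le_eq mult.commute [of w])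
          then show "\<forall>\<^sub>F n in sequentially. real (i w n) / N (s n) \<le> w" by simp
        qed
      qed
      have imono: "i w n \<le> i w' n" if "w \<le> w'" for w w' n
        unfolding i_def using that N [of "s n"] by (intro nat_mono floor_mono mult_left_mono) auto
      \<comment> \<open>All arguments are rounded to the lattice, the shift \<eta> separately, so
        that the discrete inequality applies exactly, with tilt factor exp (\<beta> / N) and a
        common block length.\<close>
      define P where "P = (\<lambda>w n. exp (\<beta> * (real (i w n) / N (s n))) *
          (v (s n) (real (i w n) / N (s n) + real (i \<eta> n) / N (s n)) - v (s n) (real (i w n) / N (s n))))"
      have vS: "v (s n) (real j / N (s n)) = S (s n) j" for n j
        using N [of "s n"] by (simp add: v_def divide_less_0_iff)
      have PS: "P w n = exp (\<beta> / N (s n)) ^ i w n * (S (s n) (i w n + i \<eta> n) - S (s n) (i w n))" for w n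
        unfolding P_def add_divide_distrib [symmetric] of_nat_add [symmetric] vS
        by (simp add: exp_of_nat_mult [symmetric] ac_simps)
      have Pl: "P w \<longlonglongrightarrow> Q w" if "0 < w" "w \<notin> D" "w + \<eta> \<notin> D" for w
        unfolding P_def Q_def using that \<eta>
        by (intro tendsto_mult tendsto_exp tendsto_diff tendsto_const Vl' tendsto_add il)
      have ineq: "(real (i y n) / N (s n) - real (i x n) / N (s n)) * P z n \<le>
          (real (i y n) / N (s n) - real (i z n) / N (s n)) * P x n +
          (real (i z n) / N (s n) - real (i x n) / N (s n)) * P y n" for n
      proof -
        have "(real (i y n) - real (i x n)) * P z n \<le>
          (real (i y n) - real (i z n)) * P x n + (real (i z n) - real (i x n)) * P y n"
          unfolding PS S_def
          by (rule log_convex_seq_increments) (use upos ulc imono xyz in auto)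
        then have "((real (i y n) - real (i x n)) * P z n) / N (s n) \<le>
          ((real (i y n) - real (i z n)) * P x n + (real (i z n) - real (i x n)) * P y n) / N (s n)"
          using N [of "s n"] by (intro divide_right_mono) auto
        then show ?thesis by (simp add: add_divide_distrib diff_divide_distrib left_diff_distrib)
      qed
      have pos: "0 < x" "0 < y" "0 < z" using xyz by auto
      have 1: "(\<lambda>n. (real (i y n) / N (s n) - real (i x n) / N (s n)) * P z n) \<longlonglongrightarrow> (y - x) * Q z"
        by (intro tendsto_mult tendsto_diff il pos Pl nD)
      have 2: "(\<lambda>n. (real (i y n) / N (s n) - real (i z n) / N (s n)) * P x n +
          (real (i z n) / N (s n) - real (i x n) / N (s n)) * P y n) \<longlonglongrightarrow> (y - z) * Q x + (z - x) * Q y"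
        by (intro tendsto_add tendsto_mult tendsto_diff il pos Pl nD)
      show ?thesis by (rule LIMSEQ_le [OF 1 2]) (use ineq in auto)
    qed
    have three': "(y - x) * Q z \<le> (y - z) * Q x + (z - x) * Q y"
      if xyz: "0 < x" "x < z" "z < y" for x y z
    proof -
      \<comment> \<open>Shifts that would move one of the six arguments onto a discontinuity of
        \<open>G\<close>. They are countable, so positive shifts tending to 0 can avoid them, and
        right continuity of \<open>V\<close> then removes the shift.\<close>
      define D' where "D' = (\<Union>w\<in>{x, y, z, x + \<eta>, y + \<eta>, z + \<eta>}. (\<lambda>d. d - w) ` D)"
      have "countable D'" unfolding D'_def using cD by auto
      then obtain h where h: "\<And>n. h n > 0" "\<And>n. h n \<notin> D'" "h \<longlonglongrightarrow> 0"
        by (rule countable_avoid_seq) blast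
      have nD: "w + h n \<notin> D" if "w \<in> {x, y, z, x + \<eta>, y + \<eta>, z + \<eta>}" for w n
      proof
        assume "w + h n \<in> D"
        then have "h n \<in> (\<lambda>d. d - w) ` D" by (intro image_eqI [of _ _ "w + h n"]) auto
        then show False using h(2) [of n] that unfolding D'_def by blast
      qed
      have Vh: "(\<lambda>n. V (w + h n)) \<longlonglongrightarrow> V w" for w
      proof (rule filterlim_compose [OF Vrc])
        have "(\<lambda>n. w + h n) \<longlonglongrightarrow> w + 0" by (intro tendsto_intros h)
        then show "filterlim (\<lambda>n. w + h n) (at_right w) sequentially"
          using h(1) by (auto simp: filterlim_at less_imp_neq [symmetric])
      qed
      have Qh: "(\<lambda>n. Q (w + h n)) \<longlonglongrightarrow> Q w" for w
      proof -
        have "(\<lambda>n. exp (\<beta> * (w + h n)) * (V ((w + \<eta>) + h n) - V (w + h n))) \<longlonglongrightarrow>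
            exp (\<beta> * (w + 0)) * (V (w + \<eta>) - V w)"
          by (intro tendsto_intros h Vh)
        then show ?thesis by (simp add: Q_def add.assoc add.commute [of \<eta>] add.left_commute)
      qed
      have "(y - x) * Q (z + h n) \<le> (y - z) * Q (x + h n) + (z - x) * Q (y + h n)" for n
      proof -
        have n1: "w + h n \<notin> D" if "w \<in> {x, y, z}" for w using that by (intro nD) auto
        have n2: "w + h n + \<eta> \<notin> D" if "w \<in> {x, y, z}" for w
          using nD [of "w + \<eta>" n] that by (auto simp: add.assoc add.commute [of \<eta>])
        have "(y + h n - (x + h n)) * Q (z + h n) \<le>
            (y + h n - (z + h n)) * Q (x + h n) + (z + h n - (x + h n)) * Q (y + h n)"
          by (rule three) (use xyz h(1) [of n] n1 n2 in auto)
        then show ?thesis by simp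
      qed
      then show ?thesis
        by (intro LIMSEQ_le [of "\<lambda>n. (y - x) * Q (z + h n)" _ "\<lambda>n. (y - z) * Q (x + h n) + (z - x) * Q (y + h n)"]
          tendsto_intros Qh) auto
    qed
    have "convex_on {0<..} Q"
    proof (rule convex_on_linorderI)
      fix w x y :: real
      assume w: "0 < w" "w < 1" and xy: "x \<in> {0<..}" "y \<in> {0<..}" "x < y"
      define z where "z = (1 - w) * x + w * y"
      have e: "z - x = w * (y - x)" "y - z = (1 - w) * (y - x)" by (simp_all add: z_def algebra_simps)
      have "x < z" "z < y" using e w xy by (metis diff_gt_0_iff_gt mult_pos_pos)+
      from three' [OF _ this] xy have "(y - x) * Q z \<le> (y - x) * ((1 - w) * Q x + w * Q y)"
        unfolding e by (simp add: algebra_simps)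
      then have "Q z \<le> (1 - w) * Q x + w * Q y" using xy by simp
      then show "Q ((1 - w) *\<^sub>R x + w *\<^sub>R y) \<le> (1 - w) * Q x + w * Q y" by (simp add: z_def)
    qed (simp add: convex_real_interval)
    then show "convex_on {0<..} (\<lambda>x. exp (\<beta> * x) * (V (x + \<eta>) - V x))" by (simp add: Q_def)
  qed
  show ?thesis by (rule that [OF Vm Vneg V0 lci lap])
qed

section \<open>Existence of scale functions with log-convex increments\<close>

text \<open>Follows from 1 <= 1 + y^3 = (1 + y) (1 - y + y^2) and 1 + y <= exp y; the quadratic
  order is what matters, not the constant.\<close>

lemma exp_minus_upper:
  assumes "0 \<le> (y::real)"
  shows "exp (- y) - 1 + y \<le> y\<^sup>2"
proof -
  have "1 \<le> (1 + y) * (1 - y + y\<^sup>2)"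
    using assms by (simp add: algebra_simps power2_eq_square)
  also have "\<dots> \<le> exp y * (1 - y + y\<^sup>2)"
  proof (rule mult_right_mono)
    have "0 \<le> (y - 1)\<^sup>2 + y" using assms by simp
    then show "0 \<le> 1 - y + y\<^sup>2" by (simp add: power2_eq_square algebra_simps)
  qed simp
  finally have "exp (- y) * 1 \<le> exp (- y) * (exp y * (1 - y + y\<^sup>2))" by (intro mult_left_mono) auto
  then show ?thesis by (simp add: mult.assoc [symmetric] mult_exp_exp)
qed

definition levy_integrand :: "real \<Rightarrow> real \<Rightarrow> real" where
  "levy_integrand \<theta> z = exp (- \<theta> * z) - 1 + \<theta> * z * indicator {0<..1} z"

lemma levy_integrand_bound:
  assumes "0 \<le> \<theta>" "0 < z"
  shows "\<bar>levy_integrand \<theta> z\<bar> \<le> (1 + \<theta>\<^sup>2) * min 1 (z\<^sup>2)"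
proof (cases "z \<le> 1")
  case True
  have "0 \<le> levy_integrand \<theta> z"
    using True assms exp_ge_add_one_self [of "- \<theta> * z"] by (simp add: levy_integrand_def)
  moreover have "levy_integrand \<theta> z \<le> (\<theta> * z)\<^sup>2"
    using True assms exp_minus_upper [of "\<theta> * z"] by (simp add: levy_integrand_def)
  moreover have "(\<theta> * z)\<^sup>2 \<le> (1 + \<theta>\<^sup>2) * z\<^sup>2" by (simp add: power_mult_distrib algebra_simps)
  moreover have "min 1 (z\<^sup>2) = z\<^sup>2" using True assms by (simp add: power_le_one)
  ultimately show ?thesis by simp
next
  case False
  then have "min 1 (z\<^sup>2) = 1" by (simp add: one_le_power)
  moreover have "\<bar>levy_integrand \<theta> z\<bar> \<le> 1 + \<theta>\<^sup>2"
    using False assms by (simp add: levy_integrand_def) (smt (verit) exp_gt_zero zero_le_power2)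
  ultimately show ?thesis by simp
qed

text \<open>\<open>G\<close> is what remains of
  \<open>levy_integrand t z / t - levy_integrand t0 z / t0\<close>: after division by \<theta> the
  two compensators agree and cancel.\<close>

lemma nn_integral_exp_diff:
  assumes "0 < (t0::real)" "t0 \<le> t" "0 \<le> z"
  defines "G \<equiv> (1 - exp (- t0 * z)) / t0 - (1 - exp (- t * z)) / t"
  shows "(\<integral>\<^sup>+x. ennreal (exp (- t0 * x) - exp (- t * x)) * indicator {0..z} x \<partial>lborel) = ennreal G" "0 \<le> G"
proof -
  define P where "P = (\<lambda>x. (1 - exp (- t0 * x)) / t0 - (1 - exp (- t * x)) / t)"
  have d: "(P has_real_derivative exp (- t0 * x) - exp (- t * x)) (at x)" for x
    unfolding P_def using assms by (auto intro!: derivative_eq_intros)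
  have nn: "0 \<le> exp (- t0 * x) - exp (- t * x)" if "0 \<le> x" for x
    using that assms by (simp add: mult_right_mono)
  have "(\<integral>\<^sup>+x. ennreal (exp (- t0 * x) - exp (- t * x)) * indicator {0..z} x \<partial>lborel) = ennreal (P z - P 0)"
    by (rule nn_integral_FTC_Icc) (use d nn assms in \<open>auto intro: has_field_derivative_at_within\<close>)
  then show "(\<integral>\<^sup>+x. ennreal (exp (- t0 * x) - exp (- t * x)) * indicator {0..z} x \<partial>lborel) = ennreal G"
    by (simp add: P_def G_def)
  have "P 0 \<le> P z"
    by (rule DERIV_nonneg_imp_nondecreasing [OF \<open>0 \<le> z\<close>]) (use d nn in blast)
  then show "0 \<le> G" by (simp add: P_def G_def)
qed

locale levy_exponent =
  fixes \<gamma> \<sigma> :: real and \<nu> :: "real measure"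
  assumes L: "levy_measure \<nu>"
    and lc: "log_convex_on {0<..} (\<lambda>x. measure \<nu> {x<..})"
begin

definition k :: "real \<Rightarrow> real" where "k x = measure \<nu> {x<..}"

abbreviation \<psi> :: "real \<Rightarrow> real" where "\<psi> \<equiv> laplace_exponent \<gamma> \<sigma> \<nu>"

lemma k_nonneg: "0 \<le> k x" by (simp add: k_def)

lemma emeasure_tail: "0 < x \<Longrightarrow> emeasure \<nu> {x<..} = ennreal (k x)"
  using levy_measure_tail_finite [OF L, of x] by (simp add: k_def emeasure_eq_ennreal_measure)

lemma k_antimono: "0 < x \<Longrightarrow> x \<le> y \<Longrightarrow> k y \<le> k x"
  unfolding k_def
  by (rule measure_mono_fmeasurable)
    (use levy_measure_tail_finite [OF L] levy_measure_sets(2) [OF L] in \<open>auto simp: fmeasurable_def\<close>)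

lemma k_continuous: "continuous_on {0<..} k"
  using log_convex_on_imp_convex_on [OF lc] unfolding k_def
  by (intro convex_on_continuous) auto

text \<open>Lattice points are equally spaced, so the midpoint case is the form in which the weights
  inherit log-convexity.\<close>

lemma k_log_convex:
  assumes "0 < x" "0 < y"
  shows "(k ((x + y) / 2))\<^sup>2 \<le> k x * k y"
proof -
  have "\<forall>u\<in>{0<..<1}. k ((1 - u) * x + u * y) \<le> k x powr (1 - u) * k y powr u"
    using lc assms unfolding log_convex_on_def k_def by simp
  then have "k ((1 - 1/2) * x + 1/2 * y) \<le> k x powr (1 - 1/2) * k y powr (1/2)"
    by (rule bspec) simp
  then have "k ((x + y) / 2) \<le> sqrt (k x) * sqrt (k y)"
    using k_nonneg by (simp add: powr_half_sqrt field_simps)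
  then have "(k ((x + y) / 2))\<^sup>2 \<le> (sqrt (k x) * sqrt (k y))\<^sup>2"
    using k_nonneg by (intro power_mono) auto
  then show ?thesis using k_nonneg by (simp add: power_mult_distrib)
qed

lemma integrable_min: "integrable \<nu> (\<lambda>x. min 1 (x\<^sup>2))"
  using L by (simp add: levy_measure_def)

lemma levy_integrand_measurable [measurable]: "levy_integrand \<theta> \<in> borel_measurable \<nu>"
proof -
  note [measurable] = levy_measure_sets(3) [OF L]
  have "{z \<in> space \<nu>. z \<in> {0<..1}} \<in> sets \<nu>" by measurable
  then show ?thesis unfolding levy_integrand_def by measurable
qed

lemma levy_integrand_integrable:
  assumes "0 \<le> \<theta>"
  shows "integrable \<nu> (levy_integrand \<theta>)"
proof (rule Bochner_Integration.integrable_bound)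
  show "integrable \<nu> (\<lambda>z. (1 + \<theta>\<^sup>2) * min 1 (z\<^sup>2))" using integrable_min by simp
  show "AE z in \<nu>. norm (levy_integrand \<theta> z) \<le> norm ((1 + \<theta>\<^sup>2) * min 1 (z\<^sup>2))"
  proof (rule AE_I2)
    fix z assume "z \<in> space \<nu>"
    then have "\<bar>levy_integrand \<theta> z\<bar> \<le> (1 + \<theta>\<^sup>2) * min 1 (z\<^sup>2)"
      using levy_integrand_bound [OF assms] levy_measure_sets(1) [OF L] by simp
    then show "norm (levy_integrand \<theta> z) \<le> norm ((1 + \<theta>\<^sup>2) * min 1 (z\<^sup>2))" by simp
  qed
qed measurable

lemma psi_eq: "\<psi> \<theta> = \<gamma> * \<theta> + \<sigma>\<^sup>2 * \<theta>\<^sup>2 / 2 + integral\<^sup>L \<nu> (levy_integrand \<theta>)"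
  by (simp add: laplace_exponent_def levy_integrand_def [abs_def])

text \<open>Integration by parts in the Levy-Khintchine formula, applied to differences so that the drift
  and the compensator cancel.\<close>
lemma psi_quotient_diff:
  assumes t: "0 < t0" "t0 \<le> t"
  defines "\<Delta> \<equiv> \<psi> t / t - \<psi> t0 / t0 - \<sigma>\<^sup>2 * (t - t0) / 2"
  shows "(\<integral>\<^sup>+x. ennreal (k x * (exp (- t0 * x) - exp (- t * x))) * indicator {0<..} x \<partial>lborel) = ennreal \<Delta>"
    and "0 \<le> \<Delta>"
proof -
  let ?g = "\<lambda>x. exp (- t0 * x) - exp (- t * x)"
  let ?G = "\<lambda>z. (1 - exp (- t0 * z)) / t0 - (1 - exp (- t * z)) / t"
  have q: "levy_integrand t z / t - levy_integrand t0 z / t0 = ?G z" for z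
    using t by (simp add: levy_integrand_def field_simps)
  have i: "integrable \<nu> (\<lambda>z. levy_integrand t z / t - levy_integrand t0 z / t0)"
    using t by (intro Bochner_Integration.integrable_diff integrable_divide levy_integrand_integrable) auto
  have G: "(\<integral>z. ?G z \<partial>\<nu>) = \<Delta>"
  proof -
    have "(\<integral>z. ?G z \<partial>\<nu>) = integral\<^sup>L \<nu> (levy_integrand t) / t - integral\<^sup>L \<nu> (levy_integrand t0) / t0"
      unfolding q [symmetric] using t
      by (subst Bochner_Integration.integral_diff) (auto intro!: integrable_divide levy_integrand_integrable)
    also have "\<dots> = \<Delta>"
      unfolding \<Delta>_def psi_eq using t by (simp add: field_simps power2_eq_square)
    finally show ?thesis .
  qed
  have G0: "0 \<le> ?G z" if "z \<in> space \<nu>" for z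
    using nn_integral_exp_diff(2) [OF t, of z] that levy_measure_sets(1) [OF L] by simp
  show "0 \<le> \<Delta>" unfolding G [symmetric] by (rule integral_nonneg_AE) (use G0 in auto)
  have "(\<integral>\<^sup>+x. ennreal (k x * ?g x) * indicator {0<..} x \<partial>lborel) =
      (\<integral>\<^sup>+x. emeasure \<nu> {x / 1<..} * (ennreal (?g x) * indicator {0<..} x) \<partial>lborel)"
    by (intro nn_integral_cong) (auto simp: indicator_def emeasure_tail ennreal_mult' k_nonneg)
  also have "\<dots> = (\<integral>\<^sup>+z. (\<integral>\<^sup>+x. ennreal (?g x) * indicator {0..1 * z} x \<partial>lborel) \<partial>\<nu>)"
    by (rule nn_integral_levy_tail [OF L]) auto
  also have "\<dots> = (\<integral>\<^sup>+z. ennreal (?G z) \<partial>\<nu>)"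
    using nn_integral_exp_diff(1) [OF t] levy_measure_sets(1) [OF L] by (intro nn_integral_cong) simp
  also have "\<dots> = ennreal \<Delta>"
    unfolding G [symmetric] by (rule nn_integral_eq_integral) (use i G0 q in auto)
  finally show "(\<integral>\<^sup>+x. ennreal (k x * ?g x) * indicator {0<..} x \<partial>lborel) = ennreal \<Delta>" .
qed

section \<open>Convexity and growth of the Laplace exponent\<close>

lemma psi_quotient_mono: "0 < t0 \<Longrightarrow> t0 \<le> t \<Longrightarrow> \<psi> t0 / t0 \<le> \<psi> t / t"
proof -
  assume t: "0 < t0" "t0 \<le> t"
  have "0 \<le> \<sigma>\<^sup>2 * (t - t0) / 2" using t by simp
  then show ?thesis using psi_quotient_diff(2) [OF t] by linarith
qed

lemma psi_zero: "\<psi> 0 = 0"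
  by (simp add: laplace_exponent_def)

lemma psi_convex: "convex_on {0..} \<psi>"
proof (rule convex_onI)
  fix u x y :: real assume u: "0 < u" "u < 1" and xy: "x \<in> {0..}" "y \<in> {0..}"
  let ?z = "(1 - u) * x + u * y"
  have z: "0 \<le> ?z" using u xy by (intro add_nonneg_nonneg mult_nonneg_nonneg) auto
  have e: "exp (- ?z * s) \<le> (1 - u) * exp (- x * s) + u * exp (- y * s)" for s
  proof -
    have "exp ((1 - u) * (- x * s) + u * (- y * s)) \<le> (1 - u) * exp (- x * s) + u * exp (- y * s)"
      using convex_onD [OF exp_convex, of u "- x * s" "- y * s"] u by simp
    then show ?thesis by (simp add: algebra_simps)
  qed
  have "integral\<^sup>L \<nu> (levy_integrand ?z) \<le> (\<integral>s. (1 - u) * levy_integrand x s + u * levy_integrand y s \<partial>\<nu>)"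
  proof (rule integral_mono)
    show "levy_integrand ?z s \<le> (1 - u) * levy_integrand x s + u * levy_integrand y s" for s
      using e [of s] by (simp add: levy_integrand_def algebra_simps)
  qed (use z xy in \<open>auto intro!: levy_integrand_integrable\<close>)
  also have "\<dots> = (1 - u) * integral\<^sup>L \<nu> (levy_integrand x) + u * integral\<^sup>L \<nu> (levy_integrand y)"
    using xy by (subst Bochner_Integration.integral_add) (auto intro!: levy_integrand_integrable)
  finally have 1: "integral\<^sup>L \<nu> (levy_integrand ?z) \<le>
      (1 - u) * integral\<^sup>L \<nu> (levy_integrand x) + u * integral\<^sup>L \<nu> (levy_integrand y)" .
  have "0 \<le> u * (1 - u) * (x - y)\<^sup>2" using u by simp
  also have "\<dots> = (1 - u) * x\<^sup>2 + u * y\<^sup>2 - ?z\<^sup>2"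
    by (simp add: power2_eq_square algebra_simps)
  finally have "\<sigma>\<^sup>2 / 2 * ?z\<^sup>2 \<le> \<sigma>\<^sup>2 / 2 * ((1 - u) * x\<^sup>2 + u * y\<^sup>2)"
    by (intro mult_left_mono) auto
  then have 2: "\<sigma>\<^sup>2 * ?z\<^sup>2 / 2 \<le> (1 - u) * (\<sigma>\<^sup>2 * x\<^sup>2 / 2) + u * (\<sigma>\<^sup>2 * y\<^sup>2 / 2)"
    by (simp add: distrib_left ac_simps)
  have 3: "\<gamma> * ((1 - u) * x) + \<gamma> * (u * y) = (1 - u) * (\<gamma> * x) + u * (\<gamma> * y)" by (simp add: algebra_simps)
  show "\<psi> ((1 - u) *\<^sub>R x + u *\<^sub>R y) \<le> (1 - u) * \<psi> x + u * \<psi> y"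
    unfolding psi_eq distrib_left real_scaleR_def using 1 2 3 by linarith
qed (simp add: convex_real_interval)

lemma psi_continuous: "continuous_on {0<..} \<psi>"
proof -
  have "convex_on {0<..} \<psi>"
    by (rule convex_on_subset [OF psi_convex]) (auto simp: convex_real_interval)
  then show ?thesis by (intro convex_on_continuous) auto
qed

text \<open>Growth is at least linear with slope \<psi> t1 / t1, since \<psi> t / t is
  nondecreasing.\<close>

lemma psi_superlinear:
  assumes "0 < t1" "0 < \<psi> t1"
  obtains t where "t1 \<le> t" "C < \<psi> t"
proof -
  define t where "t = max t1 (\<bar>C\<bar> * t1 / \<psi> t1 + t1)"
  have t: "t1 \<le> t" "\<bar>C\<bar> * t1 / \<psi> t1 < t" "0 < t"
    using assms by (simp_all add: t_def less_max_iff_disj add_nonneg_pos)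
  have "C \<le> \<bar>C\<bar> * t1 / \<psi> t1 * (\<psi> t1 / t1)" using assms by simp
  also have "\<dots> < t * (\<psi> t1 / t1)" using t assms by (intro mult_strict_right_mono) auto
  also have "\<dots> \<le> t * (\<psi> t / t)" using psi_quotient_mono [of t1 t] t assms by (intro mult_left_mono) auto
  also have "\<dots> = \<psi> t" using t by simp
  finally show ?thesis using that t by blast
qed

text \<open>Supplies the integrable majorant for the Riemann sums. After Tonelli the inner integral
  over [0, 2 z] is of order z^2 near 0, because the minimum is of order x there, and bounded for
  large z; this is what min 1 z^2 controls.\<close>

lemma dominating_integral_finite:
  assumes t: "0 < t0" "t0 \<le> t" and \<rho>: "0 \<le> \<rho>"
  shows "(\<integral>\<^sup>+x. ennreal ((k (x / 2) + \<rho> + 1) * min ((t - t0) * x) (exp t0 * exp (- t0 * x))) * indicator {0<..} x \<partial>lborel) < \<infinity>"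
proof -
  define m where "m = (\<lambda>x. min ((t - t0) * x) (exp t0 * exp (- t0 * x)))"
  have [measurable]: "m \<in> borel_measurable borel" unfolding m_def by measurable
  have m0: "0 \<le> m x" if "0 \<le> x" for x using that t by (simp add: m_def)
  have mI: "(\<integral>\<^sup>+x. ennreal (m x) * indicator {0..} x \<partial>lborel) \<le> ennreal (exp t0 / t0)"
  proof -
    have "(\<integral>\<^sup>+x. ennreal (m x) * indicator {0..} x \<partial>lborel) \<le>
        (\<integral>\<^sup>+x. ennreal (exp t0) * (ennreal (exp (- t0 * x)) * indicator {0..} x) \<partial>lborel)"
      by (intro nn_integral_mono) (auto simp: m_def indicator_def ennreal_mult [symmetric] intro!: ennreal_leI)
    also have "\<dots> = ennreal (exp t0) * ennreal (exp (- t0 * 0) / t0)"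
      using nn_integral_exp_atLeast [OF t(1), of 0] by (subst nn_integral_cmult) auto
    also have "\<dots> = ennreal (exp t0 / t0)" using t by (simp add: ennreal_mult' [symmetric])
    finally show ?thesis .
  qed
  \<comment> \<open>The first summand comes from integrating (t - t0) x over [0, 2 z] when z <= 1,
    the second is the bound \<open>mI\<close> on the full integral.\<close>
  define C where "C = 2 * (t - t0) + exp t0 / t0"
  have inner: "(\<integral>\<^sup>+x. ennreal (m x) * indicator {0..2 * z} x \<partial>lborel) \<le> ennreal (C * min 1 (z\<^sup>2))"
    if z: "0 < z" for z
  proof (cases "z \<le> 1")
    case True
    have "(\<integral>\<^sup>+x. ennreal (m x) * indicator {0..2 * z} x \<partial>lborel) \<le>
        (\<integral>\<^sup>+x. ennreal ((t - t0) * x) * indicator {0..2 * z} x \<partial>lborel)"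
      by (intro nn_integral_mono) (auto simp: m_def indicator_def intro!: ennreal_leI)
    also have "\<dots> = ennreal ((t - t0) * (2 * z)\<^sup>2 / 2 - (t - t0) * 0\<^sup>2 / 2)"
      by (rule nn_integral_FTC_Icc [where F = "\<lambda>x. (t - t0) * x\<^sup>2 / 2"])
        (use t z in \<open>auto intro!: derivative_eq_intros\<close>)
    also have "(t - t0) * (2 * z)\<^sup>2 / 2 - (t - t0) * 0\<^sup>2 / 2 = 2 * (t - t0) * z\<^sup>2"
      by (simp add: power2_eq_square)
    also have "ennreal (2 * (t - t0) * z\<^sup>2) \<le> ennreal (C * min 1 (z\<^sup>2))"
    proof -
      have "min 1 (z\<^sup>2) = z\<^sup>2" using True z by (simp add: power_le_one)
      then show ?thesis using t by (simp add: C_def mult_right_mono ennreal_leI)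
    qed
    finally show ?thesis .
  next
    case False
    have "(\<integral>\<^sup>+x. ennreal (m x) * indicator {0..2 * z} x \<partial>lborel) \<le> (\<integral>\<^sup>+x. ennreal (m x) * indicator {0..} x \<partial>lborel)"
      by (intro nn_integral_mono) (auto simp: indicator_def)
    also note mI
    also have "ennreal (exp t0 / t0) \<le> ennreal (C * min 1 (z\<^sup>2))"
    proof -
      have "min 1 (z\<^sup>2) = 1" using False by (simp add: one_le_power)
      then show ?thesis using t by (intro ennreal_leI) (simp add: C_def)
    qed
    finally show ?thesis .
  qed
  have 1: "(\<integral>\<^sup>+x. emeasure \<nu> {x / 2<..} * (ennreal (m x) * indicator {0<..} x) \<partial>lborel) < \<infinity>"
  proof -
    have "(\<integral>\<^sup>+x. emeasure \<nu> {x / 2<..} * (ennreal (m x) * indicator {0<..} x) \<partial>lborel) =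
        (\<integral>\<^sup>+z. (\<integral>\<^sup>+x. ennreal (m x) * indicator {0..2 * z} x \<partial>lborel) \<partial>\<nu>)"
      by (rule nn_integral_levy_tail [OF L]) auto
    also have "\<dots> \<le> (\<integral>\<^sup>+z. ennreal (norm (C * min 1 (z\<^sup>2))) \<partial>\<nu>)"
    proof (rule nn_integral_mono)
      fix z assume "z \<in> space \<nu>"
      then have "0 < z" using levy_measure_sets(1) [OF L] by simp
      from inner [OF this] show "(\<integral>\<^sup>+x. ennreal (m x) * indicator {0..2 * z} x \<partial>lborel) \<le> ennreal (norm (C * min 1 (z\<^sup>2)))"
        by (rule order_trans) (auto intro: ennreal_leI)
    qed
    also have "\<dots> < \<infinity>"
    proof -
      have "integrable \<nu> (\<lambda>z. C * min 1 (z\<^sup>2))" using integrable_min by simp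
      then show ?thesis unfolding integrable_iff_bounded by blast
    qed
    finally show ?thesis .
  qed
  have 2: "(\<integral>\<^sup>+x. ennreal (\<rho> + 1) * (ennreal (m x) * indicator {0..} x) \<partial>lborel) < \<infinity>"
    using mI by (subst nn_integral_cmult) (auto simp: ennreal_mult_less_top intro: le_less_trans)
  have "(\<integral>\<^sup>+x. ennreal ((k (x / 2) + \<rho> + 1) * m x) * indicator {0<..} x \<partial>lborel) \<le>
     (\<integral>\<^sup>+x. emeasure \<nu> {x / 2<..} * (ennreal (m x) * indicator {0<..} x) + ennreal (\<rho> + 1) * (ennreal (m x) * indicator {0..} x) \<partial>lborel)"
  proof (rule nn_integral_mono)
    fix x :: real
    show "ennreal ((k (x / 2) + \<rho> + 1) * m x) * indicator {0<..} x \<le>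
      emeasure \<nu> {x / 2<..} * (ennreal (m x) * indicator {0<..} x) + ennreal (\<rho> + 1) * (ennreal (m x) * indicator {0..} x)"
    proof (cases "0 < x")
      case True
      have "ennreal ((k (x / 2) + \<rho> + 1) * m x) = ennreal (k (x / 2) * m x + (\<rho> + 1) * m x)"
        by (simp add: algebra_simps)
      also have "\<dots> = ennreal (k (x / 2)) * ennreal (m x) + ennreal (\<rho> + 1) * ennreal (m x)"
        using m0 [of x] True k_nonneg [of "x / 2"] \<rho> by (simp add: ennreal_mult ennreal_plus)
      finally show ?thesis using True by (simp add: emeasure_tail)
    qed simp
  qed
  also have "\<dots> = (\<integral>\<^sup>+x. emeasure \<nu> {x / 2<..} * (ennreal (m x) * indicator {0<..} x) \<partial>lborel) +
      (\<integral>\<^sup>+x. ennreal (\<rho> + 1) * (ennreal (m x) * indicator {0..} x) \<partial>lborel)"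
  proof (rule nn_integral_add)
    define kk where "kk = (\<lambda>x. indicator {0<..} x *\<^sub>R k (x / 2))"
    have [measurable]: "kk \<in> borel_measurable borel" unfolding kk_def
      by (rule borel_measurable_continuous_on_indicator)
        (auto intro!: continuous_on_compose2 [OF k_continuous] continuous_intros)
    have "(\<lambda>x. emeasure \<nu> {x / 2<..} * (ennreal (m x) * indicator {0<..} x)) = (\<lambda>x. ennreal (kk x) * ennreal (m x))"
      by (auto simp: fun_eq_iff emeasure_tail indicator_def kk_def)
    moreover have "(\<lambda>x. ennreal (kk x) * ennreal (m x)) \<in> borel_measurable lborel"
      by measurable
    ultimately show "(\<lambda>x. emeasure \<nu> {x / 2<..} * (ennreal (m x) * indicator {0<..} x)) \<in> borel_measurable lborel"
      by (simp only:)
  qed measurable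
  also have "\<dots> < \<infinity>"
    using 1 2 unfolding infinity_ennreal_def ennreal_add_less_top by (rule conjI)
  finally show ?thesis unfolding m_def .
qed

lemma scale_function_exists:
  assumes \<rho>: "0 \<le> \<rho>" and t0: "0 < t0" and \<psi>0: "\<rho> < \<psi> t0"
  obtains V where "mono V" "\<And>x. x < 0 \<Longrightarrow> V x = 0" "\<And>x. 0 \<le> V x" "log_convex_increments V"
    "\<And>t. t > t0 \<Longrightarrow> laplace (\<lambda>x. ennreal (V x)) t = ennreal (1 / (\<psi> t - \<rho>))"
proof -
  \<comment> \<open>The value of (\<psi> t - \<rho>) / t at the anchor, which the integrals of
    differences cannot see.\<close>
  define m0 where "m0 = (\<psi> t0 - \<rho>) / t0"
  have m0: "m0 > 0" using t0 \<psi>0 by (simp add: m0_def)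
  define K where "K = (\<lambda>x. indicator {0<..} x *\<^sub>R k x + \<rho>)"
  have K: "K x = k x + \<rho>" if "0 < x" for x using that by (simp add: K_def)
  have K0: "0 \<le> K x" for x using \<rho> k_nonneg by (simp add: K_def)
  have Kdec: "K y \<le> K x" if "0 < x" "x \<le> y" for x y using that k_antimono by (simp add: K)
  have Kc: "continuous_on {0<..} K"
  proof -
    have "continuous_on {0<..} (\<lambda>x. k x + \<rho>)" by (intro continuous_intros k_continuous)
    then show ?thesis by (rule continuous_on_eq) (simp add: K)
  qed
  have Km: "K \<in> borel_measurable borel" unfolding K_def
    by (intro borel_measurable_add borel_measurable_continuous_on_indicator k_continuous) auto
  define N where "N = (\<lambda>n::nat. real (Suc n))"
  have N: "N n > 0" for n by (simp add: N_def)
  \<comment> \<open>The summand 1 / N makes the weights positive even where the tail and \<rho>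
    vanish; its total contribution to the differences tends to 0 with the mesh.\<close>
  define \<kappa> where "\<kappa> = (\<lambda>n j. (K (real j / N n) + 1 / N n) / N n)"
  \<comment> \<open>Gaussian part as a point mass on the first site: \<sigma>^2 N / 2 times exp (-
    t0 / N) - exp (- t / N) tends to \<sigma>^2 (t - t0) / 2.\<close>
  define f where "f = (\<lambda>n j. \<kappa> n j + (if j = Suc 0 then \<sigma>\<^sup>2 * N n / 2 else 0))"
  have \<kappa>0: "0 < \<kappa> n j" for n j
    unfolding \<kappa>_def using K0 N by (intro divide_pos_pos add_nonneg_pos) auto
  have fpos: "f n (Suc j) > 0" for n j
    unfolding f_def using \<kappa>0 N [of n] by (intro add_pos_nonneg) auto
  have \<kappa>lc: "(\<kappa> n (Suc (Suc j)))\<^sup>2 \<le> \<kappa> n (Suc j) * \<kappa> n (Suc (Suc (Suc j)))" for n j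
  proof -
    \<comment> \<open>Adding the constant \<open>c\<close> preserves log-convexity: the cross term
      needs 2 m <= a + b, which is the arithmetic-geometric mean inequality.\<close>
    define x y c where "x = real (Suc j) / N n" and "y = real (Suc (Suc (Suc j))) / N n" and "c = \<rho> + 1 / N n"
    have xy: "0 < x" "0 < y" and c: "0 \<le> c" using N [of n] \<rho> by (auto simp: x_def y_def c_def)
    have mid: "real (Suc (Suc j)) / N n = (x + y) / 2" using N [of n] by (simp add: x_def y_def field_simps)
    let ?a = "k x" and ?b = "k y" and ?m = "k ((x + y) / 2)"
    have m: "?m\<^sup>2 \<le> ?a * ?b" by (rule k_log_convex [OF xy])
    have "(2 * ?m)\<^sup>2 \<le> 4 * (?a * ?b)" using m by (simp add: power_mult_distrib)
    also have "\<dots> \<le> (?a + ?b)\<^sup>2"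
      using zero_le_power2 [of "?a - ?b"] by (simp add: power2_eq_square algebra_simps)
    finally have "2 * ?m \<le> ?a + ?b" by (rule power2_le_imp_le) (simp add: k_nonneg)
    then have "c * (2 * ?m) \<le> c * (?a + ?b)" using c by (rule mult_left_mono)
    then have "(?m + c)\<^sup>2 \<le> (?a + c) * (?b + c)" using m by (simp add: power2_eq_square algebra_simps)
    then have "(?m + c)\<^sup>2 / (N n * N n) \<le> (?a + c) * (?b + c) / (N n * N n)"
      by (rule divide_right_mono) simp
    moreover have "\<kappa> n (Suc j) = (?a + c) / N n" "\<kappa> n (Suc (Suc (Suc j))) = (?b + c) / N n"
      "\<kappa> n (Suc (Suc j)) = (?m + c) / N n"
      using xy by (simp_all only: \<kappa>_def mid x_def [symmetric] y_def [symmetric]) (simp_all add: K c_def add.assoc)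
    ultimately show ?thesis by (simp add: power2_eq_square)
  qed
  have flc: "(f n (Suc (Suc j)))\<^sup>2 \<le> f n (Suc j) * f n (Suc (Suc (Suc j)))" for n j
  proof -
    \<comment> \<open>Raising the first weight is harmless, as it occurs in these inequalities only
      on the larger side.\<close>
    have "\<kappa> n (Suc j) * \<kappa> n (Suc (Suc (Suc j))) \<le> f n (Suc j) * \<kappa> n (Suc (Suc (Suc j)))"
      using N [of n] \<kappa>0 [of n] by (intro mult_right_mono) (auto simp: f_def less_imp_le)
    then show ?thesis using \<kappa>lc [of n j] by (simp add: f_def)
  qed
  define F where "F = (\<lambda>n t. \<Sum>j. f n (Suc j) * exp (- t / N n) ^ Suc j)"
  have Fs: "(\<lambda>j. f n (Suc j) * exp (- t / N n) ^ Suc j) sums F n t" if "t \<ge> t0" for n t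
  proof -
    define B where "B = \<kappa> n (Suc 0) + \<sigma>\<^sup>2 * N n / 2"
    have fB: "f n (Suc j) \<le> B" for j
    proof -
      have "K (real (Suc j) / N n) \<le> K (real (Suc 0) / N n)"
        using N [of n] by (intro Kdec divide_right_mono) auto
      then have "\<kappa> n (Suc j) \<le> \<kappa> n (Suc 0)"
        unfolding \<kappa>_def using N [of n] by (intro divide_right_mono add_right_mono) auto
      moreover have "0 \<le> \<sigma>\<^sup>2 * N n / 2" using N [of n] by simp
      ultimately show ?thesis by (auto simp: f_def B_def)
    qed
    have x: "0 < exp (- t / N n)" "exp (- t / N n) < 1" using that t0 N [of n] by auto
    have "summable (\<lambda>j. B * exp (- t / N n) ^ Suc j)"
      by (intro summable_mult summable_ignore_initial_segment [where k = 1, simplified] summable_geometric) (use x in simp)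
    then have "summable (\<lambda>j. f n (Suc j) * exp (- t / N n) ^ Suc j)"
      by (rule summable_comparison_test' [where N = 0])
        (use fB fpos x in \<open>auto simp: abs_mult less_imp_le intro!: mult_right_mono\<close>)
    then show ?thesis unfolding F_def by (rule summable_sums)
  qed
  define A where "A = (\<lambda>n. m0 + F n t0)"
  have lim: "(\<lambda>n. A n - F n t) \<longlonglongrightarrow> (\<psi> t - \<rho>) / t" if t: "t0 \<le> t" for t
  proof -
    have tp: "0 < t" using t t0 by simp
    let ?g = "\<lambda>x. exp (- t0 * x) - exp (- t * x)"
    have g0: "0 \<le> ?g x" if "0 \<le> x" for x using that t by (simp add: mult_right_mono)
    define a where "a = (\<lambda>n j. (K (real (Suc j) / real (Suc n)) + 1 / real (Suc n)) *
             ?g (real (Suc j) / real (Suc n)) / real (Suc n))"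
    have a0: "0 \<le> a n j" for n j
      unfolding a_def by (intro divide_nonneg_nonneg mult_nonneg_nonneg add_nonneg_nonneg K0 g0) auto
    define b where "b = (\<lambda>n. \<sigma>\<^sup>2 / 2 * (N n * ?g (1 / N n)))"
    have AF: "a n sums (A n - F n t - m0 - b n)" for n
    proof -
      have e: "exp (- s / N n) ^ j = exp (- s * (real j / N n))" for s j
        by (simp add: exp_of_nat_mult [symmetric] ac_simps)
      have "(\<lambda>j. f n (Suc j) * exp (- t0 / N n) ^ Suc j - f n (Suc j) * exp (- t / N n) ^ Suc j) sums (F n t0 - F n t)"
        by (intro sums_diff Fs t order_refl)
      moreover have "(\<lambda>j. if j = 0 then b n else 0) sums b n"
        using sums_single [of 0 "\<lambda>_. b n"] by simp
      ultimately have "(\<lambda>j. (f n (Suc j) * exp (- t0 / N n) ^ Suc j - f n (Suc j) * exp (- t / N n) ^ Suc j)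
          - (if j = 0 then b n else 0)) sums (F n t0 - F n t - b n)"
        by (rule sums_diff)
      moreover have "(f n (Suc j) * exp (- t0 / N n) ^ Suc j - f n (Suc j) * exp (- t / N n) ^ Suc j)
          - (if j = 0 then b n else 0) = a n j" for j
        unfolding e by (simp add: f_def a_def b_def \<kappa>_def N_def algebra_simps add_divide_distrib diff_divide_distrib)
      ultimately show ?thesis by (simp add: A_def)
    qed
    define \<Delta> where "\<Delta> = \<psi> t / t - \<psi> t0 / t0 - \<sigma>\<^sup>2 * (t - t0) / 2"
    \<comment> \<open>The constant \<rho> in \<open>K\<close> contributes \<rho> times the integral
      of exp (- t0 x) - exp (- t x) over the half-line, which is 1 / t0 - 1 / t.\<close>
    define R where "R = \<Delta> + \<rho> * (1 / t0 - 1 / t)"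
    have R: "(\<integral>\<^sup>+x. ennreal (K x * ?g x) * indicator {0<..} x \<partial>lborel) = ennreal R" and R0: "0 \<le> R"
    proof -
      have gI: "(\<integral>\<^sup>+x. ennreal (?g x) * indicator {0..} x \<partial>lborel) = ennreal (0 - (exp (- t * 0) / t - exp (- t0 * 0) / t0))"
      proof (rule nn_integral_FTC_atLeast)
        show "((\<lambda>x. exp (- t * x) / t - exp (- t0 * x) / t0) has_real_derivative ?g x) (at x)" for x
          using t0 tp by (auto intro!: derivative_eq_intros)
        have "((\<lambda>x. exp (- s * x)) \<longlongrightarrow> 0) at_top" if "0 < s" for s :: real
        proof (rule filterlim_compose [OF exp_at_bot])
          show "LIM x at_top. - s * x :> at_bot"
            using that by (intro filterlim_tendsto_neg_mult_at_bot [OF tendsto_const _ filterlim_ident]) auto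
        qed
        then have "((\<lambda>x. exp (- t * x) / t - exp (- t0 * x) / t0) \<longlongrightarrow> 0 / t - 0 / t0) at_top"
          using t0 tp by (intro tendsto_intros) auto
        then show "((\<lambda>x. exp (- t * x) / t - exp (- t0 * x) / t0) \<longlongrightarrow> 0) at_top" by simp
      qed (use g0 in auto)
      have pos: "0 \<le> 1 / t0 - 1 / t" using t t0 by (simp add: frac_le)
      define kk where "kk = (\<lambda>x. indicator {0<..} x *\<^sub>R k x)"
      have [measurable]: "kk \<in> borel_measurable borel" unfolding kk_def
        by (rule borel_measurable_continuous_on_indicator [OF _ k_continuous]) simp
      have "(\<integral>\<^sup>+x. ennreal (K x * ?g x) * indicator {0<..} x \<partial>lborel) =
          (\<integral>\<^sup>+x. ennreal (kk x * ?g x) + ennreal \<rho> * (ennreal (?g x) * indicator {0..} x) \<partial>lborel)"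
      proof (rule nn_integral_cong_AE)
        show "AE x in lborel. ennreal (K x * ?g x) * indicator {0<..} x =
          ennreal (kk x * ?g x) + ennreal \<rho> * (ennreal (?g x) * indicator {0..} x)"
          using AE_lborel_singleton [of 0]
        proof eventually_elim
          case (elim x)
          show ?case
          proof (cases "0 < x")
            case True
            then show ?thesis using g0 [of x] k_nonneg [of x] \<rho>
              by (simp add: K kk_def distrib_right ennreal_plus ennreal_mult)
          qed (use elim in \<open>simp add: kk_def\<close>)
        qed
      qed
      also have "\<dots> = (\<integral>\<^sup>+x. ennreal (kk x * ?g x) \<partial>lborel) + ennreal \<rho> * (\<integral>\<^sup>+x. ennreal (?g x) * indicator {0..} x \<partial>lborel)"
        by (subst nn_integral_add) (auto simp: nn_integral_cmult)
      also have "(\<integral>\<^sup>+x. ennreal (kk x * ?g x) \<partial>lborel) =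
          (\<integral>\<^sup>+x. ennreal (k x * ?g x) * indicator {0<..} x \<partial>lborel)"
        by (intro nn_integral_cong) (auto simp: indicator_def kk_def)
      also have "\<dots> = ennreal \<Delta>" unfolding \<Delta>_def by (rule psi_quotient_diff(1) [OF t0 t])
      also have "ennreal \<Delta> + ennreal \<rho> * (\<integral>\<^sup>+x. ennreal (?g x) * indicator {0..} x \<partial>lborel) = ennreal R"
        unfolding gI using psi_quotient_diff(2) [OF t0 t] pos \<rho>
        by (simp add: R_def \<Delta>_def ennreal_mult [symmetric] ennreal_plus [symmetric] del: ennreal_plus)
      finally show "(\<integral>\<^sup>+x. ennreal (K x * ?g x) * indicator {0<..} x \<partial>lborel) = ennreal R" .
      show "0 \<le> R" using psi_quotient_diff(2) [OF t0 t] pos \<rho> by (simp add: R_def \<Delta>_def)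
    qed
    have "(\<lambda>n. \<Sum>j. ennreal (a n j)) \<longlonglongrightarrow> ennreal R"
      unfolding a_def R [symmetric]
    proof (rule riemann_sum_tendsto [OF K0 Kdec Kc Km t0 t])
      have "(\<integral>\<^sup>+x. ennreal ((K (x / 2) + 1) * min ((t - t0) * x) (exp t0 * exp (- t0 * x))) * indicator {0<..} x \<partial>lborel) =
        (\<integral>\<^sup>+x. ennreal ((k (x / 2) + \<rho> + 1) * min ((t - t0) * x) (exp t0 * exp (- t0 * x))) * indicator {0<..} x \<partial>lborel)"
        by (intro nn_integral_cong) (auto simp: indicator_def K)
      then show "(\<integral>\<^sup>+x. ennreal ((K (x / 2) + 1) * min ((t - t0) * x) (exp t0 * exp (- t0 * x))) * indicator {0<..} x \<partial>lborel) < \<infinity>"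
        using dominating_integral_finite [OF t0 t \<rho>] by simp
    qed
    moreover have "(\<Sum>j. ennreal (a n j)) = ennreal (A n - F n t - m0 - b n)" for n
      using AF [of n] a0 by (subst suminf_ennreal2) (auto simp: sums_iff)
    moreover have "0 \<le> A n - F n t - m0 - b n" for n
      by (rule sums_le [OF _ sums_zero AF]) (rule a0)
    ultimately have 1: "(\<lambda>n. A n - F n t - m0 - b n) \<longlonglongrightarrow> R"
      using R0 by (intro tendsto_ennrealD) auto
    have 2: "b \<longlonglongrightarrow> \<sigma>\<^sup>2 / 2 * (t - t0)"
    proof -
      have "(?g has_real_derivative t - t0) (at 0)" by (auto intro!: derivative_eq_intros)
      then have "((\<lambda>h. ?g h / h) \<longlongrightarrow> t - t0) (at 0)" by (simp add: DERIV_def)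
      moreover have "filterlim (\<lambda>n. 1 / N n) (at 0) sequentially"
        unfolding N_def using LIMSEQ_Suc [OF lim_1_over_n] by (auto simp: filterlim_at)
      ultimately have "(\<lambda>n. ?g (1 / N n) / (1 / N n)) \<longlonglongrightarrow> t - t0" by (rule filterlim_compose)
      then have "(\<lambda>n. \<sigma>\<^sup>2 / 2 * (?g (1 / N n) / (1 / N n))) \<longlonglongrightarrow> \<sigma>\<^sup>2 / 2 * (t - t0)"
        by (intro tendsto_intros)
      then show ?thesis by (simp add: b_def mult.commute [of "N _"])
    qed
    have "(\<lambda>n. (A n - F n t - m0 - b n) + b n + m0) \<longlonglongrightarrow> R + \<sigma>\<^sup>2 / 2 * (t - t0) + m0"
      by (intro tendsto_add tendsto_const 1 2)
    moreover have "R + \<sigma>\<^sup>2 / 2 * (t - t0) + m0 = (\<psi> t - \<rho>) / t"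
      using t0 tp by (simp add: R_def \<Delta>_def m0_def field_simps)
    ultimately show ?thesis by simp
  qed
  obtain V where V: "mono V" "\<And>x. x < 0 \<Longrightarrow> V x = 0" "\<And>x. 0 \<le> V x" "log_convex_increments V"
    and VL: "\<And>t. t > t0 \<Longrightarrow> laplace (\<lambda>x. ennreal (V x)) t = ennreal (1 / (t * ((\<psi> t - \<rho>) / t)))"
    by (rule renewal_limit [of t0 m0 f F A "\<lambda>t. (\<psi> t - \<rho>) / t", OF t0 m0 fpos flc _ _ lim])
      (use Fs in \<open>auto simp: N_def A_def\<close>)
  show ?thesis
  proof (rule that [OF V])
    show "laplace (\<lambda>x. ennreal (V x)) t = ennreal (1 / (\<psi> t - \<rho>))" if "t > t0" for t
      using VL [OF that] that t0 by simp
  qed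
qed

end

section \<open>Monotone paths and mixtures\<close>

text \<open>Chernoff's bound: moments E exp (\<theta> X h) that stay bounded as \<theta> grows force X h <= 0.\<close>
lemma nonpos_exponent_imp_decreasing_paths:
  assumes S: "spectrally_negative_levy M X \<gamma> \<sigma> \<nu>"
    and np: "\<And>\<theta>. 0 \<le> \<theta> \<Longrightarrow> laplace_exponent \<gamma> \<sigma> \<nu> \<theta> \<le> 0"
  shows "decreasing_paths M X"
proof -
  have LP: "levy_process M X" using S by (simp add: spectrally_negative_levy_def)
  interpret prob_space M using LP by (simp add: levy_process_def)
  have Xm [measurable]: "X t \<in> borel_measurable M" if "0 \<le> t" for t
    using LP that by (simp add: levy_process_def)
  have mom: "integrable M (\<lambda>w. exp (\<theta> * X t w))" "(LINT w|M. exp (\<theta> * X t w)) \<le> 1"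
    if "0 \<le> t" "0 \<le> \<theta>" for t \<theta>
  proof -
    show "integrable M (\<lambda>w. exp (\<theta> * X t w))" using S that by (simp add: spectrally_negative_levy_def)
    have "(LINT w|M. exp (\<theta> * X t w)) = exp (t * laplace_exponent \<gamma> \<sigma> \<nu> \<theta>)"
      using S that by (simp add: spectrally_negative_levy_def)
    also have "\<dots> \<le> 1" using np [OF that(2)] that by (simp add: mult_nonneg_nonpos)
    finally show "(LINT w|M. exp (\<theta> * X t w)) \<le> 1" .
  qed
  have neg: "AE w in M. X t w \<le> 0" if t: "0 \<le> t" for t
  proof -
    have "AE w in M. X t w < 1 / real (Suc n)" for n
    proof -
      define \<epsilon> where "\<epsilon> = 1 / real (Suc n)"
      have \<epsilon>: "\<epsilon> > 0" by (simp add: \<epsilon>_def)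
      define B where "B = {w \<in> space M. \<epsilon> \<le> X t w}"
      have B [measurable]: "B \<in> sets M" unfolding B_def using Xm [OF t] by measurable
      have bnd: "prob B \<le> exp (- (real m * \<epsilon>))" for m :: nat
      proof -
        have "exp (real m * \<epsilon>) * prob B = (LINT w|M. exp (real m * \<epsilon>) * indicator B w)" by simp
        also have "\<dots> \<le> (LINT w|M. exp (real m * X t w))"
        proof (rule integral_mono)
          have "integrable M (indicator B :: _ \<Rightarrow> real)"
            by (rule integrable_real_indicator) (auto simp: emeasure_eq_measure)
          then show "integrable M (\<lambda>w. exp (real m * \<epsilon>) * indicator B w)" by simp
          show "exp (real m * \<epsilon>) * indicator B w \<le> exp (real m * X t w)" for w
            by (auto simp: indicator_def B_def mult_left_mono)
        qed (use mom t in auto)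
        also have "\<dots> \<le> 1" using mom t by simp
        finally have "exp (- (real m * \<epsilon>)) * (exp (real m * \<epsilon>) * prob B) \<le> exp (- (real m * \<epsilon>)) * 1"
          by (intro mult_left_mono) auto
        then show ?thesis by (simp add: mult.assoc [symmetric] mult_exp_exp)
      qed
      have "(\<lambda>m. exp (- \<epsilon>) ^ m) \<longlonglongrightarrow> 0" using \<epsilon> by (intro LIMSEQ_realpow_zero) auto
      then have "(\<lambda>m. exp (- (real m * \<epsilon>))) \<longlonglongrightarrow> 0" by (simp add: exp_of_nat_mult [symmetric])
      then have "prob B \<le> 0" by (rule LIMSEQ_le_const) (use bnd in auto)
      then have "prob B = 0" by (simp add: measure_le_0_iff)
      then have "AE w in M. w \<notin> B" by (intro AE_not_in) (auto simp: null_sets_def emeasure_eq_measure)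
      then show ?thesis by (rule AE_mp) (auto simp: B_def \<epsilon>_def intro!: AE_I2)
    qed
    then have "AE w in M. \<forall>n. X t w < 1 / real (Suc n)" by (simp add: AE_all_countable)
    then show ?thesis
    proof eventually_elim
      case (elim w)
      have "X t w \<le> 0"
        by (rule LIMSEQ_le_const [OF LIMSEQ_Suc [OF lim_1_over_n]]) (use elim less_imp_le in blast)
      then show ?case .
    qed
  qed
  have inc: "AE w in M. X t w \<le> X s w" if st: "0 \<le> s" "s \<le> t" for s t
  proof -
    have d: "distr M borel (\<lambda>w. X (s + (t - s)) w - X s w) = distr M borel (X (t - s))"
    proof -
      have "\<forall>s\<ge>0. \<forall>h\<ge>0. distr M borel (\<lambda>w. X (s + h) w - X s w) = distr M borel (X h)"
        using LP unfolding levy_process_def by blast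
      from this [rule_format, of s "t - s"] st show ?thesis by simp
    qed
    have [measurable]: "X t \<in> borel_measurable M" "X s \<in> borel_measurable M" "X (t - s) \<in> borel_measurable M"
      using st by (auto intro: Xm)
    have "AE x in distr M borel (X (t - s)). x \<le> 0"
      using neg [of "t - s"] st by (subst AE_distr_iff) auto
    then have "AE x in distr M borel (\<lambda>w. X (s + (t - s)) w - X s w). x \<le> 0" unfolding d .
    then have "AE w in M. X (s + (t - s)) w - X s w \<le> 0" by (subst (asm) AE_distr_iff) auto
    then show ?thesis by simp
  qed
  \<comment> \<open>Each comparison of two fixed times has its own null set; rational times need
    only countably many of them, and right continuity of the paths covers the other times.\<close>
  have "AE w in M. 0 \<le> s \<longrightarrow> s \<le> t \<longrightarrow> X t w \<le> X s w" for s t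
    using inc [of s t] by (cases "0 \<le> s \<and> s \<le> t") auto
  then have "AE w in M. \<forall>s\<in>\<rat>. \<forall>t\<in>\<rat>. 0 \<le> s \<longrightarrow> s \<le> t \<longrightarrow> X t w \<le> X s w"
    by (simp only: AE_ball_countable [OF countable_rat]) blast
  moreover have "AE w in M. \<forall>t\<ge>0. continuous (at_right t) (\<lambda>s. X s w)"
    using LP unfolding levy_process_def by auto
  ultimately show ?thesis
    unfolding decreasing_paths_def
  proof eventually_elim
    case (elim w)
    show ?case
    proof (intro allI impI)
      fix s t :: real assume st: "0 \<le> s" "s \<le> t"
      show "X t w \<le> X s w"
      proof (cases "s = t")
        case False
        \<comment> \<open>These rational times tend to s from the right while staying below t, so
          they precede the ones chosen beyond t.\<close>
        have "\<exists>r\<in>\<rat>. s < r \<and> r < min t (s + 1 / real (Suc n))" for n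
          using Rats_dense_in_real [of s "min t (s + 1 / real (Suc n))"] st False by auto
        then obtain p where p: "\<And>n. p n \<in> \<rat>" "\<And>n. s < p n" "\<And>n. p n < min t (s + 1 / real (Suc n))" by metis
        have "\<exists>r\<in>\<rat>. t < r \<and> r < t + 1 / real (Suc n)" for n
          using Rats_dense_in_real [of t "t + 1 / real (Suc n)"] by auto
        then obtain q where q: "\<And>n. q n \<in> \<rat>" "\<And>n. t < q n" "\<And>n. q n < t + 1 / real (Suc n)" by metis
        have seq: "(\<lambda>n. X (r n) w) \<longlonglongrightarrow> X u w"
          if r: "\<And>n. u < r n" "\<And>n. r n < u + 1 / real (Suc n)" and u: "0 \<le> u" for r u
        proof -
          have "(\<lambda>n. u + 1 / real (Suc n)) \<longlonglongrightarrow> u + 0"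
            by (intro tendsto_intros LIMSEQ_Suc [OF lim_1_over_n])
          then have "r \<longlonglongrightarrow> u"
            by (intro tendsto_sandwich [of "\<lambda>_. u" r _ "\<lambda>n. u + 1 / real (Suc n)"])
              (use r in \<open>auto intro!: always_eventually less_imp_le\<close>)
          then have "filterlim r (at_right u) sequentially"
            using r(1) by (auto simp: filterlim_at less_imp_neq [symmetric])
          moreover have "((\<lambda>s. X s w) \<longlongrightarrow> X u w) (at_right u)"
            using elim(2) u by (simp add: continuous_within)
          ultimately show ?thesis by (rule filterlim_compose [rotated])
        qed
        show ?thesis
        proof (rule LIMSEQ_le)
          show "(\<lambda>n. X (q n) w) \<longlonglongrightarrow> X t w" using q st by (intro seq) auto
          show "(\<lambda>n. X (p n) w) \<longlonglongrightarrow> X s w" using p st by (intro seq) auto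
          have "X (q n) w \<le> X (p n) w" for n
            using elim(1) p(1) [of n] q(1) [of n] p(2) [of n] p(3) [of n] q(2) [of n] st by auto
          then show "\<exists>N. \<forall>n\<ge>N. X (q n) w \<le> X (p n) w" by blast
        qed
      qed simp
    qed
  qed
qed

text \<open>The tilt exp (\<beta> (x + s)) factorizes, so translating by s >= 0 and dividing by exp
  (\<beta> s) preserves tilted convexity; the inequality is linear and can be integrated. Finiteness
  of H makes the translates integrable.\<close>

lemma log_convex_increments_mixture:
  assumes V: "log_convex_increments V" "mono V" "\<And>x. 0 \<le> V x"
    and \<mu>: "sets \<mu> = sets borel" "AE s in \<mu>. 0 \<le> s"
    and H: "\<And>x. 0 < x \<Longrightarrow> ennreal (H x) = (\<integral>\<^sup>+s. ennreal (V (x + s)) \<partial>\<mu>)" "\<And>x. 0 < x \<Longrightarrow> 0 \<le> H x"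
  shows "log_convex_increments H"
proof -
  have Vm: "V \<in> borel_measurable borel" by (rule borel_measurable_mono [OF V(2)])
  have m: "(\<lambda>s. V (x + s)) \<in> borel_measurable \<mu>" for x
    unfolding measurable_cong_sets [OF \<mu>(1) refl] using Vm by measurable
  have i: "integrable \<mu> (\<lambda>s. V (x + s))" "(\<integral>s. V (x + s) \<partial>\<mu>) = H x" if "0 < x" for x
  proof -
    show "integrable \<mu> (\<lambda>s. V (x + s))"
      using H(1) [OF that] V(3) by (intro integrableI_nonneg m) (auto simp: less_top [symmetric])
    have "(\<integral>s. V (x + s) \<partial>\<mu>) = enn2real (\<integral>\<^sup>+s. ennreal (V (x + s)) \<partial>\<mu>)"
      by (rule integral_eq_nn_integral [OF m]) (simp add: V(3))
    also have "\<dots> = H x" unfolding H(1) [OF that, symmetric] using H(2) [OF that] by simp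
    finally show "(\<integral>s. V (x + s) \<partial>\<mu>) = H x" .
  qed
  define D where "D = (\<lambda>\<eta> x. V (x + \<eta>) - V x)"
  have D: "integrable \<mu> (\<lambda>s. D \<eta> (x + s))" "(\<integral>s. D \<eta> (x + s) \<partial>\<mu>) = H (x + \<eta>) - H x"
    if "0 < x" "0 < \<eta>" for x \<eta>
    using i [of x] i [of "x + \<eta>"] that by (simp_all add: D_def ac_simps)
  show ?thesis
    unfolding log_convex_increments_def
  proof (intro conjI allI impI)
    fix \<eta> x :: real assume "0 < \<eta>" "0 < x"
    moreover from this have "0 \<le> (\<integral>s. D \<eta> (x + s) \<partial>\<mu>)"
      using V(2) by (intro integral_nonneg_AE AE_I2) (simp add: D_def mono_def)
    ultimately show "H x \<le> H (x + \<eta>)" by (simp add: D)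
  next
    fix \<eta> \<beta> :: real assume \<eta>: "0 < \<eta>"
    show "convex_on {0<..} (\<lambda>x. exp (\<beta> * x) * (H (x + \<eta>) - H x))"
    proof (rule convex_onI)
      fix u x y :: real assume u: "0 < u" "u < 1" and xy: "x \<in> {0<..}" "y \<in> {0<..}"
      let ?z = "(1 - u) * x + u * y"
      have z: "0 < ?z" using u xy by (simp add: add_pos_pos)
      have c: "convex_on {0<..} (\<lambda>x. exp (\<beta> * x) * D \<eta> x)"
        using V(1) \<eta> by (simp add: log_convex_increments_def D_def)
      have pw: "exp (\<beta> * z) * D \<eta> (z + s) \<le>
          (1 - u) * (exp (\<beta> * x) * D \<eta> (x + s)) + u * (exp (\<beta> * y) * D \<eta> (y + s))"
        if s: "0 \<le> s" and zdef: "z = ?z" for s z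
      proof -
        have e: "(1 - u) * (x + s) + u * (y + s) = z + s" by (simp add: zdef algebra_simps)
        have "exp (\<beta> * (z + s)) * D \<eta> (z + s) \<le>
          (1 - u) * (exp (\<beta> * (x + s)) * D \<eta> (x + s)) + u * (exp (\<beta> * (y + s)) * D \<eta> (y + s))"
          using convex_onD [OF c, of u "x + s" "y + s"] u xy s e by simp
        then have "exp (- \<beta> * s) * (exp (\<beta> * (z + s)) * D \<eta> (z + s)) \<le> exp (- \<beta> * s) *
          ((1 - u) * (exp (\<beta> * (x + s)) * D \<eta> (x + s)) + u * (exp (\<beta> * (y + s)) * D \<eta> (y + s)))"
          by (rule mult_left_mono) simp
        moreover have "exp (- \<beta> * s) * (exp (\<beta> * (w + s)) * B) = exp (\<beta> * w) * B" for w B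
          by (simp add: mult.assoc [symmetric] mult_exp_exp) (simp add: algebra_simps)
        ultimately show ?thesis
          by (simp only: distrib_left [of "exp (- \<beta> * s)"] mult.left_commute [of _ "1 - u"] mult.left_commute [of _ u])
      qed
      have "(\<integral>s. exp (\<beta> * ?z) * D \<eta> (?z + s) \<partial>\<mu>) \<le>
          (\<integral>s. (1 - u) * (exp (\<beta> * x) * D \<eta> (x + s)) + u * (exp (\<beta> * y) * D \<eta> (y + s)) \<partial>\<mu>)"
      proof (rule integral_mono_AE)
        show "AE s in \<mu>. exp (\<beta> * ?z) * D \<eta> (?z + s) \<le>
          (1 - u) * (exp (\<beta> * x) * D \<eta> (x + s)) + u * (exp (\<beta> * y) * D \<eta> (y + s))"
          using \<mu>(2) by eventually_elim (rule pw [OF _ refl])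
      qed (use D(1) z xy \<eta> in auto)
      also have "\<dots> = (1 - u) * (exp (\<beta> * x) * (H (x + \<eta>) - H x)) + u * (exp (\<beta> * y) * (H (y + \<eta>) - H y))"
        using D xy \<eta> by simp
      finally show "exp (\<beta> * ((1 - u) *\<^sub>R x + u *\<^sub>R y)) * (H ((1 - u) *\<^sub>R x + u *\<^sub>R y + \<eta>) - H ((1 - u) *\<^sub>R x + u *\<^sub>R y))
        \<le> (1 - u) * (exp (\<beta> * x) * (H (x + \<eta>) - H x)) + u * (exp (\<beta> * y) * (H (y + \<eta>) - H y))"
        using D(2) [OF z \<eta>] by simp
    qed (simp add: convex_real_interval)
  qed
qed

text \<open>Serves the case of a constant intensity, in which H is a pure exponential.\<close>

lemma log_convex_increments_exp:
  assumes "0 \<le> (c::real)" "0 \<le> \<Phi>" and H: "\<And>x. H x = c * exp (\<Phi> * x)"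
  shows "log_convex_increments H"
  unfolding log_convex_increments_def
proof (intro conjI allI impI)
  show "H x \<le> H (x + \<eta>)" if "0 < \<eta>" for x \<eta>
    unfolding H using that assms by (intro mult_left_mono) (auto intro: mult_left_mono)
  fix \<eta> \<beta> :: real assume \<eta>: "0 < \<eta>"
  have "convex_on {0<..} (\<lambda>x. (c * (exp (\<Phi> * \<eta>) - 1)) * exp ((\<beta> + \<Phi>) * x))"
  proof (rule convex_on_cmul)
    show "0 \<le> c * (exp (\<Phi> * \<eta>) - 1)" using assms \<eta> by simp
    show "convex_on {0<..} (\<lambda>x. exp ((\<beta> + \<Phi>) * x))"
    proof (rule convex_onI)
      fix u x y :: real assume "0 < u" "u < 1"
      then show "exp ((\<beta> + \<Phi>) * ((1 - u) *\<^sub>R x + u *\<^sub>R y)) \<le> (1 - u) * exp ((\<beta> + \<Phi>) * x) + u * exp ((\<beta> + \<Phi>) * y)"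
        using convex_onD [OF exp_convex, of u "(\<beta> + \<Phi>) * x" "(\<beta> + \<Phi>) * y"]
        by (simp add: algebra_simps)
    qed (simp add: convex_real_interval)
  qed
  then show "convex_on {0<..} (\<lambda>x. exp (\<beta> * x) * (H (x + \<eta>) - H x))"
    by (rule convex_on_transform) (simp add: H algebra_simps exp_add)
qed

section \<open>The resolvent equation\<close>

context levy_exponent
begin

text \<open>Monotonicity of \<psi> t / t gives \<psi> t >= \<phi> t / x0 > \<phi> beyond any root
  x0, so the level \<phi> > 0 is attained only once and the supremum in \<open>Phi\<close> is that
  root. Existence is the intermediate value theorem.\<close>

lemma Phi_props:
  assumes t1: "0 < t1" "0 < \<psi> t1" and \<phi>: "0 < \<phi>"
  shows "0 < Phi \<psi> \<phi>" "\<psi> (Phi \<psi> \<phi>) = \<phi>" "\<And>t. Phi \<psi> \<phi> < t \<Longrightarrow> \<phi> < \<psi> t"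
proof -
  obtain T where T: "t1 \<le> T" "\<phi> < \<psi> T" using psi_superlinear [OF t1] .
  \<comment> \<open>Convexity and \<psi> 0 = 0 give \<psi> (u T) <= u \<psi> T = \<phi> / 2, a
    positive starting point for the intermediate value theorem, inside the open half-line on which
    \<psi> has been shown continuous.\<close>
  define u where "u = \<phi> / (2 * \<psi> T)"
  have u: "0 < u" "u < 1" using T \<phi> by (auto simp: u_def field_simps)
  have Tp: "0 < T" using T t1 by simp
  have "\<psi> ((1 - u) *\<^sub>R 0 + u *\<^sub>R T) \<le> (1 - u) * \<psi> 0 + u * \<psi> T"
    using u Tp by (intro convex_onD [OF psi_convex]) auto
  then have low: "\<psi> (u * T) \<le> \<phi>" using T \<phi> by (simp add: psi_zero u_def)
  have uT: "u * T \<le> T" "0 < u * T" using u Tp by auto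
  have "continuous_on {u * T..T} \<psi>"
    using uT by (intro continuous_on_subset [OF psi_continuous]) auto
  then obtain x0 where x0: "u * T \<le> x0" "x0 \<le> T" "\<psi> x0 = \<phi>"
    using IVT' [of \<psi> "u * T" \<phi> T] low T uT by auto
  have x0p: "0 < x0" using x0 uT by simp
  have above: "\<phi> < \<psi> t" if "x0 < t" for t
  proof -
    have "\<phi> / x0 \<le> \<psi> t / t" using psi_quotient_mono [OF x0p, of t] that x0 by simp
    then have "\<phi> * t \<le> \<psi> t * x0" using x0p that by (simp add: field_simps)
    moreover have "\<phi> * x0 < \<phi> * t" using \<phi> that by simp
    ultimately have "\<phi> * x0 < \<psi> t * x0" by simp
    then show ?thesis using x0p by simp
  qed
  have "{\<theta>. 0 \<le> \<theta> \<and> \<psi> \<theta> = \<phi>} = {x0}"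
  proof (intro set_eqI iffI)
    fix y assume y: "y \<in> {\<theta>. 0 \<le> \<theta> \<and> \<psi> \<theta> = \<phi>}"
    then have yp: "0 < y" using psi_zero \<phi> by (cases "y = 0") auto
    have "\<not> y < x0"
    proof
      assume "y < x0"
      then have "\<phi> / y \<le> \<phi> / x0" using psi_quotient_mono [OF yp, of x0] x0 y by simp
      then show False using \<open>y < x0\<close> yp x0p \<phi> by (simp add: field_simps)
    qed
    moreover have "\<not> x0 < y" using above [of y] y by auto
    ultimately show "y \<in> {x0}" by simp
  qed (use x0 x0p in auto)
  then have "Phi \<psi> \<phi> = x0" by (simp add: Phi_def)
  then show "0 < Phi \<psi> \<phi>" "\<psi> (Phi \<psi> \<phi>) = \<phi>" "\<And>t. Phi \<psi> \<phi> < t \<Longrightarrow> \<phi> < \<psi> t"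
    using x0p x0 above by auto
qed

end

text \<open>The definition of a scale function prescribes no sign for W, so uniqueness of transforms
  is applied to the nonnegative functions W^+ and V + W^-.\<close>

lemma scale_function_unique:
  assumes W: "is_scale_function \<psi> p W" and t0: "Phi \<psi> p \<le> t0" and pos: "\<And>t. t0 < t \<Longrightarrow> p < \<psi> t"
    and V: "mono V" "\<And>x. x < 0 \<Longrightarrow> V x = 0" "\<And>x. 0 \<le> V x"
    and VL: "\<And>t. t0 < t \<Longrightarrow> laplace (\<lambda>x. ennreal (V x)) t = ennreal (1 / (\<psi> t - p))"
  shows "W \<in> borel_measurable borel" "AE x in lborel. W x = V x"
proof -
  have Wneg: "W x = 0" if "x < 0" for x using W that by (simp add: is_scale_function_def)
  have int: "set_integrable lborel {0..} (\<lambda>x. exp (- \<theta> * x) * W x)"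
    "(LINT x:{0..}|lborel. exp (- \<theta> * x) * W x) = inverse (\<psi> \<theta> - p)" if "t0 < \<theta>" for \<theta>
    using W that t0 by (auto simp: is_scale_function_def)
  define I where "I = (\<lambda>\<theta> x. indicator {0..} x *\<^sub>R (exp (- \<theta> * x) * W x))"
  have Iint: "integrable lborel (I \<theta>)" "integral\<^sup>L lborel (I \<theta>) = inverse (\<psi> \<theta> - p)" if "t0 < \<theta>" for \<theta>
    using int [OF that] by (simp_all add: set_integrable_def set_lebesgue_integral_def I_def)
  have IW: "I \<theta> x = exp (- \<theta> * x) * W x" for \<theta> x
    using Wneg [of x] by (cases "x < 0") (auto simp: I_def)
  \<comment> \<open>Integrability of one tilted copy yields its measurability, and undoing the tilt
    recovers W.\<close>
  show Wm [measurable]: "W \<in> borel_measurable borel"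
  proof -
    have [measurable]: "I (t0 + 1) \<in> borel_measurable borel"
      using Iint(1) [of "t0 + 1"] by (simp add: borel_measurable_integrable)
    have "(\<lambda>x. exp ((t0 + 1) * x) * I (t0 + 1) x) \<in> borel_measurable borel" by measurable
    moreover have "(\<lambda>x. exp ((t0 + 1) * x) * I (t0 + 1) x) = W"
    proof
      fix x
      have "exp ((t0 + 1) * x) * exp (- (t0 + 1) * x) = 1"
        by (simp only: mult_exp_exp mult_minus_left add.right_inverse exp_zero)
      then show "exp ((t0 + 1) * x) * I (t0 + 1) x = W x"
        by (simp only: IW mult.assoc [symmetric] mult_1_left)
    qed
    ultimately show ?thesis by simp
  qed
  have [measurable]: "V \<in> borel_measurable borel" by (rule borel_measurable_mono [OF V(1)])
  define P where "P = (\<lambda>x. ennreal (W x))"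
  define Q where "Q = (\<lambda>x. ennreal (- W x))"
  have [measurable]: "P \<in> borel_measurable borel" "Q \<in> borel_measurable borel"
    unfolding P_def Q_def by measurable
  have lapeq: "laplace P t = laplace (\<lambda>x. ennreal (V x) + Q x) t" "laplace P t < \<infinity>" if t: "t0 < t" for t
  proof -
    have P: "laplace P t = (\<integral>\<^sup>+x. ennreal (I t x) \<partial>lborel)"
      unfolding laplace_def P_def IW by (intro nn_integral_cong) (simp add: ennreal_mult'' mult.commute)
    have Q: "laplace Q t = (\<integral>\<^sup>+x. ennreal (- I t x) \<partial>lborel)"
      unfolding laplace_def Q_def IW
      by (intro nn_integral_cong) (simp add: ennreal_mult'' [symmetric] mult.commute)
    have fin: "laplace P t \<noteq> \<infinity>" "laplace Q t \<noteq> \<infinity>"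
      using Iint(1) [OF t] unfolding P Q real_integrable_def by auto
    then show "laplace P t < \<infinity>" by (simp add: less_top)
    have "enn2real (laplace P t) - enn2real (laplace Q t) = 1 / (\<psi> t - p)"
      using Iint [OF t] unfolding P Q by (simp add: real_lebesgue_integral_def divide_inverse)
    then have "enn2real (laplace P t) = 1 / (\<psi> t - p) + enn2real (laplace Q t)" by simp
    then have "ennreal (enn2real (laplace P t)) = ennreal (1 / (\<psi> t - p)) + ennreal (enn2real (laplace Q t))"
      using pos [OF t] by (simp add: ennreal_plus)
    then have "laplace P t = laplace (\<lambda>x. ennreal (V x)) t + laplace Q t"
      using fin by (simp add: VL [OF t] less_top)
    also have "\<dots> = laplace (\<lambda>x. ennreal (V x) + Q x) t"
      unfolding laplace_def by (subst nn_integral_add [symmetric]) (auto simp: distrib_right)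
    finally show "laplace P t = laplace (\<lambda>x. ennreal (V x) + Q x) t" .
  qed
  have "AE x in lborel. P x = ennreal (V x) + Q x"
    by (rule laplace_unique [where ?\<theta>0.0 = "t0 + 1"]) (use V Wneg lapeq in \<open>auto simp: P_def Q_def\<close>)
  then show "AE x in lborel. W x = V x"
  proof eventually_elim
    case (elim x)
    show ?case
    proof (cases "0 \<le> W x")
      case True
      then show ?thesis using elim V(3) [of x] by (simp add: P_def Q_def ennreal_neg)
    next
      case False
      then have "ennreal (V x) + ennreal (- W x) = 0" using elim by (simp add: P_def Q_def ennreal_neg)
      then show ?thesis using False by (simp add: ennreal_eq_0_iff)
    qed
  qed
qed

section \<open>Convolution identities and the resolvent equation\<close>

lemma conv_cong_AE:
  assumes "AE x in lborel. f x = f' x" and [measurable]: "f \<in> borel_measurable borel" "f' \<in> borel_measurable borel"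
  shows "conv f g x = conv f' g x"
  unfolding conv_def
proof (rule nn_integral_cong_AE)
  have "AE y in lborel. f (x + (-1) * y) = f' (x + (-1) * y)"
    by (rule AE_borel_affine [where P = "\<lambda>x. f x = f' x"]) (use assms in auto)
  then show "AE y in lborel. f (x - y) * g y = f' (x - y) * g y"
    by eventually_elim simp
qed

lemma conv_add_left:
  assumes [measurable]: "f \<in> borel_measurable borel" "f' \<in> borel_measurable borel" "g \<in> borel_measurable borel"
  shows "conv (\<lambda>x. f x + f' x) g x = conv f g x + conv f' g x"
  unfolding conv_def distrib_right by (rule nn_integral_add) measurable

lemma conv_add_right:
  assumes [measurable]: "f \<in> borel_measurable borel" "g \<in> borel_measurable borel" "g' \<in> borel_measurable borel"
  shows "conv f (\<lambda>x. g x + g' x) x = conv f g x + conv f g' x"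
  unfolding conv_def distrib_left by (rule nn_integral_add) measurable

lemma conv_cmult_left:
  assumes [measurable]: "f \<in> borel_measurable borel" "g \<in> borel_measurable borel"
  shows "conv (\<lambda>x. c * f x) g x = c * conv f g x"
  unfolding conv_def mult.assoc by (rule nn_integral_cmult) measurable

lemma conv_cmult_right:
  assumes [measurable]: "f \<in> borel_measurable borel" "g \<in> borel_measurable borel"
  shows "conv f (\<lambda>x. c * g x) x = c * conv f g x"
  unfolding conv_def mult.left_commute [of _ c] by (rule nn_integral_cmult) measurable

text \<open>Solves h + c (w * h) = E + w * e for h in terms of the resolvent v of w, without
  subtraction so that everything stays in the extended nonnegative reals.\<close>
lemma resolvent_equation:
  assumes m [measurable]: "v \<in> borel_measurable borel" "w \<in> borel_measurable borel" "h \<in> borel_measurable borel"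
    "E \<in> borel_measurable borel" "e \<in> borel_measurable borel"
    and res: "AE x in lborel. w x = v x + c * conv w v x"
    and eq: "\<And>x. h x + c * conv w h x = E x + conv w e x"
    and fin: "conv w e x < \<infinity>"
  shows "h x + c * conv v E x = E x + conv v e x"
proof -
  have exp: "conv w g y = conv v g y + c * conv v (conv w g) y" if [measurable]: "g \<in> borel_measurable borel" for g y
  proof -
    have "conv w g y = conv (\<lambda>x. v x + c * conv w v x) g y"
      by (rule conv_cong_AE [OF res]) measurable
    also have "\<dots> = conv v g y + c * conv (conv w v) g y"
      by (simp add: conv_add_left conv_cmult_left)
    also have "conv w v = conv v w" by (rule ext) (rule conv_commute, auto)
    also have "conv (conv v w) g y = conv v (conv w g) y" by (simp add: conv_assoc)
    finally show ?thesis .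
  qed
  have "conv w h x = conv v (\<lambda>y. h y + c * conv w h y) x"
    by (simp add: exp [of h x] conv_add_right conv_cmult_right)
  also have "\<dots> = conv v E x + conv v (conv w e) x"
    unfolding eq by (simp add: conv_add_right)
  finally have wh: "conv w h x = conv v E x + conv v (conv w e) x" .
  have we: "conv w e x = conv v e x + c * conv v (conv w e) x" by (rule exp) measurable
  have "(h x + c * conv v E x) + c * conv v (conv w e) x = h x + c * conv w h x"
    by (simp add: wh distrib_left ac_simps)
  also have "\<dots> = E x + conv w e x" by (rule eq)
  also have "\<dots> = E x + (conv v e x + c * conv v (conv w e) x)" using we by simp
  also have "\<dots> = (E x + conv v e x) + c * conv v (conv w e) x" by (simp add: ac_simps)
  finally have "c * conv v (conv w e) x + (h x + c * conv v E x) = c * conv v (conv w e) x + (E x + conv v e x)"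
    by (simp only: add.commute)
  \<comment> \<open>Cancellation in \<open>ennreal\<close> requires a finite term; this one is at
    most \<open>conv w e x\<close>.\<close>
  moreover have "c * conv v (conv w e) x \<noteq> top"
  proof
    assume "c * conv v (conv w e) x = top"
    then have "conv w e x = top" using we by simp
    then show False using fin by simp
  qed
  ultimately show ?thesis unfolding ennreal_add_left_cancel by simp
qed

section \<open>The omega-scale function\<close>

lemma conv_eq_zero:
  assumes "\<And>x. x < 0 \<Longrightarrow> f x = 0" "\<And>y. y < a \<Longrightarrow> g y = 0" "x < a"
  shows "conv f g x = 0"
proof -
  have "f (x - y) * g y = 0" for y using assms by (cases "y < a") auto
  then show ?thesis unfolding conv_def by (simp only:) simp
qed

context levy_exponent
begin

lemma omega_scale_log_convex_increments:
  assumes t1: "0 < t1" "0 < \<psi> t1"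
    and om: "discounting_intensity \<omega> a \<phi>" and W: "is_scale_function \<psi> \<phi> W"
    and H: "is_omega_scale_function \<psi> \<omega> a \<phi> W H"
  shows "log_convex_increments H"
proof -
  define \<Phi> where "\<Phi> = Phi \<psi> \<phi>"
  have a: "a \<le> 0" and \<phi>: "0 < \<phi>" and anti: "antimono \<omega>" and om_left: "\<And>x. x < a \<Longrightarrow> \<omega> x = \<phi>"
    and om0: "\<And>x. 0 \<le> \<omega> x"
    using om by (auto simp: discounting_intensity_def)
  obtain \<rho> where \<rho>: "0 \<le> \<rho>" and om_right: "\<And>x. 0 \<le> x \<Longrightarrow> \<omega> x = \<rho>"
    using om by (auto simp: discounting_intensity_def)
  have om_le: "\<omega> x \<le> \<phi>" for x
    using antimonoD [OF anti, of "min x (a - 1)" x] om_left [of "min x (a - 1)"] by simp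
  have om_ge: "\<rho> \<le> \<omega> x" for x
    using antimonoD [OF anti, of x "max x 0"] om_right [of "max x 0"] by simp
  have Hm [measurable]: "H \<in> borel_measurable borel" and H0: "\<And>x. 0 \<le> H x"
    and Hb: "\<And>K. compact K \<Longrightarrow> bounded (H ` K)"
    and Heq: "\<And>x. H x = exp (\<Phi> * (x - a)) + (LINT y:{a..x}|lborel. W (x - y) * (\<omega> y - \<phi>) * H y)"
    using H unfolding is_omega_scale_function_def \<Phi>_def by blast+
  have [measurable]: "\<omega> \<in> borel_measurable borel"
  proof -
    have "mono (\<lambda>x. - \<omega> x)" using anti by (simp add: mono_def antimono_def)
    then have [measurable]: "(\<lambda>x. - \<omega> x) \<in> borel_measurable borel" by (rule borel_measurable_mono)
    have "(\<lambda>x. - (- \<omega> x)) \<in> borel_measurable borel" by measurable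
    then show ?thesis by simp
  qed
  note Phi = Phi_props [OF t1 \<phi>, folded \<Phi>_def]
  show ?thesis
  \<comment> \<open>In the equality case no point below \<Phi> has \<psi> above \<rho>, so there is
    no anchor for the mixture representation; but then the intensity is constant.\<close>
  proof (cases "\<rho> = \<phi>")
    case True
    then have "\<omega> x = \<phi>" for x using om_le [of x] om_ge [of x] by simp
    then have "H x = exp (- \<Phi> * a) * exp (\<Phi> * x)" for x
      using Heq [of x] by (simp add: set_lebesgue_integral_def mult_exp_exp algebra_simps)
    then show ?thesis by (intro log_convex_increments_exp [of "exp (- \<Phi> * a)" \<Phi>]) (use Phi in auto)
  next
    case False
    then have \<rho>\<phi>: "\<rho> < \<phi>" using om_le [of 0] om_ge [of 0] by simp
    \<comment> \<open>The anchor has to lie strictly below \<Phi>, where the transform of V will be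
      evaluated; \<psi> \<Phi> = \<phi> > \<rho> leaves room for it.\<close>
    have "isCont \<psi> \<Phi>" using psi_continuous Phi(1) by (simp add: continuous_on_eq_continuous_at)
    then have "(\<psi> \<longlongrightarrow> \<phi>) (at_left \<Phi>)"
      using Phi(2) unfolding isCont_def by (simp add: filterlim_at_split)
    then have "\<forall>\<^sub>F t in at_left \<Phi>. \<rho> < \<psi> t" using \<rho>\<phi> by (rule order_tendstoD)
    moreover have "\<forall>\<^sub>F t in at_left \<Phi>. t \<in> {0<..<\<Phi>}"
      using Phi(1) by (rule eventually_at_left_real)
    ultimately have "\<forall>\<^sub>F t in at_left \<Phi>. \<rho> < \<psi> t \<and> t \<in> {0<..<\<Phi>}" by (rule eventually_conj)
    then obtain t0 where t0: "\<rho> < \<psi> t0" "0 < t0" "t0 < \<Phi>"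
      using eventually_happens' [OF trivial_limit_at_left_real] by auto
    obtain V where V: "mono V" "\<And>x. x < 0 \<Longrightarrow> V x = 0" "\<And>x. 0 \<le> V x" "log_convex_increments V"
      and VL: "\<And>t. t > t0 \<Longrightarrow> laplace (\<lambda>x. ennreal (V x)) t = ennreal (1 / (\<psi> t - \<rho>))"
      using scale_function_exists [OF \<rho> t0(2,1)] by blast
    \<comment> \<open>A monotone nonnegative representative of W. It agrees with W almost
      everywhere, which is all that the integral equation sees, and provides signs and local
      bounds.\<close>
    obtain U where U: "mono U" "\<And>x. x < 0 \<Longrightarrow> U x = 0" "\<And>x. 0 \<le> U x"
      and UL: "\<And>t. t > \<Phi> + 1 \<Longrightarrow> laplace (\<lambda>x. ennreal (U x)) t = ennreal (1 / (\<psi> t - \<phi>))"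
    proof -
      have c: "0 \<le> \<phi>" "0 < \<Phi> + 1" "\<phi> < \<psi> (\<Phi> + 1)" using \<phi> Phi(1) Phi(3) by auto
      show ?thesis by (rule scale_function_exists [OF c], rule that; assumption)
    qed
    have Wm [measurable]: "W \<in> borel_measurable borel" and WU: "AE x in lborel. W x = U x"
      using scale_function_unique [OF W, of "\<Phi> + 1" U] Phi(3) U UL by (auto simp: \<Phi>_def)
    have [measurable]: "V \<in> borel_measurable borel" "U \<in> borel_measurable borel"
      using V(1) U(1) by (auto intro: borel_measurable_mono)
    define v where "v = (\<lambda>x. ennreal (V x))"
    define w where "w = (\<lambda>x. ennreal (U x))"
    define c where "c = ennreal (\<phi> - \<rho>)"
    \<comment> \<open>Cut off at \<open>a\<close>, where the integral in the equation starts, so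
      that convolutions over the whole line reproduce integrals over [a, x].\<close>
    define h where "h = (\<lambda>x. ennreal (H x) * indicator {a..} x)"
    define E where "E = (\<lambda>x. ennreal (exp (\<Phi> * (x - a))) * indicator {a..} x)"
    define e where "e = (\<lambda>x. ennreal ((\<omega> x - \<rho>) * H x) * indicator {a..} x)"
    have m [measurable]: "v \<in> borel_measurable borel" "w \<in> borel_measurable borel"
      "h \<in> borel_measurable borel" "E \<in> borel_measurable borel" "e \<in> borel_measurable borel"
      unfolding v_def w_def h_def E_def e_def by measurable
    have neg: "v x = 0" "w x = 0" if "x < 0" for x using that V(2) U(2) by (auto simp: v_def w_def)
    have left: "h x = 0" "E x = 0" "e x = 0" if "x < a" for x using that by (auto simp: h_def E_def e_def)
    \<comment> \<open>On the transform side this is 1 / \<alpha> = 1 / \<beta> + (\<beta> -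
      \<alpha>) / (\<alpha> \<beta>) with \<alpha> = \<psi> t - \<phi> and \<beta> = \<psi> t -
      \<rho>.\<close>
    have res: "AE x in lborel. w x = v x + c * conv w v x"
    proof (rule laplace_unique [where ?\<theta>0.0 = "\<Phi> + 2"])
      show "laplace w (\<Phi> + 2) < \<infinity>" using UL [of "\<Phi> + 2"] by (simp add: w_def)
      show "v x + c * conv w v x = 0" if "x < 0" for x
        using that neg conv_eq_zero [of w 0 v x] by simp
      fix n :: nat
      define t where "t = \<Phi> + 2 + real n"
      have t: "\<Phi> + 1 < t" "t0 < t" "\<Phi> < t" using t0 by (auto simp: t_def)
      have p: "\<phi> < \<psi> t" "\<rho> < \<psi> t" using Phi(3) [OF t(3)] \<rho>\<phi> by auto
      have "laplace (\<lambda>x. v x + c * conv w v x) t = laplace v t + c * laplace (conv w v) t"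
        unfolding laplace_def distrib_right mult.assoc
        by (subst nn_integral_add, measurable, subst nn_integral_cmult, measurable)
      also have "\<dots> = ennreal (1 / (\<psi> t - \<rho>)) + ennreal (\<phi> - \<rho>) * (ennreal (1 / (\<psi> t - \<phi>)) * ennreal (1 / (\<psi> t - \<rho>)))"
        using VL [OF t(2)] UL [OF t(1)] by (simp add: laplace_conv v_def w_def c_def)
      also have "\<dots> = ennreal (1 / (\<psi> t - \<rho>) + (\<phi> - \<rho>) * (1 / (\<psi> t - \<phi>) * (1 / (\<psi> t - \<rho>))))"
      proof -
        have "0 \<le> 1 / (\<psi> t - \<phi>)" "0 \<le> 1 / (\<psi> t - \<rho>)" "0 \<le> \<phi> - \<rho>" using p \<rho>\<phi> by auto
        then show ?thesis by (simp only: ennreal_mult ennreal_plus mult_nonneg_nonneg)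
      qed
      also have "1 / (\<psi> t - \<rho>) + (\<phi> - \<rho>) * (1 / (\<psi> t - \<phi>) * (1 / (\<psi> t - \<rho>))) = 1 / (\<psi> t - \<phi>)"
      proof -
        have "1 / \<beta> + (\<beta> - \<alpha>) * (1 / \<alpha> * (1 / \<beta>)) = 1 / \<alpha>" if "0 < \<alpha>" "0 < \<beta>" for \<alpha> \<beta> :: real
          using that by (simp add: field_simps)
        from this [of "\<psi> t - \<phi>" "\<psi> t - \<rho>"] show ?thesis using p by simp
      qed
      also have "ennreal (1 / (\<psi> t - \<phi>)) = laplace w t" using UL [OF t(1)] by (simp add: w_def)
      finally show "laplace w (\<Phi> + 2 + real n) = laplace (\<lambda>x. v x + c * conv w v x) (\<Phi> + 2 + real n)"
        by (simp add: t_def)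
    qed (use neg in auto)
    \<comment> \<open>Splitting \<phi> - \<rho> = (\<phi> - \<omega>) + (\<omega> - \<rho>) turns
      the given equation into one with nonnegative terms on both sides.\<close>
    have both: "h x + c * conv w h x = E x + conv w e x \<and> conv w e x < \<infinity>" for x
    proof (cases "x < a")
      case True
      then show ?thesis
        using conv_eq_zero [of w a h x] conv_eq_zero [of w a e x] neg left by simp
    next
      case False
      obtain B where "\<forall>y\<in>H ` {a..x}. norm y \<le> B"
        using Hb [of "{a..x}"] unfolding bounded_iff by auto
      then have B: "H y \<le> B" if "y \<in> {a..x}" for y using that by force
      define C where "C = U (x - a) * \<phi> * B"
      have UB: "U (x - y) * z * H y \<le> C" if "y \<in> {a..x}" "0 \<le> z" "z \<le> \<phi>" for y z
        unfolding C_def using that U(1) U(3) [of "x - y"] U(3) [of "x - a"] H0 [of y] B [of y] \<phi>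
        by (intro mult_mono mult_nonneg_nonneg) (auto simp: mono_def)
      define p where "p = (\<lambda>y. indicator {a..x} y *\<^sub>R (U (x - y) * (\<phi> - \<omega> y) * H y))"
      have p0: "0 \<le> p y" for y using U(3) H0 om_le by (simp add: p_def)
      have pint: "integrable lborel p"
        unfolding p_def
      proof (rule integrableI_bounded_set_indicator [where B = C])
        show "AE y in lborel. y \<in> {a..x} \<longrightarrow> norm (U (x - y) * (\<phi> - \<omega> y) * H y) \<le> C"
          using UB om_le om0 U(3) H0 by (intro AE_I2 impI) (simp add: abs_mult)
      qed (use False in auto)
      have WUx: "AE y in lborel. W (x - y) = U (x - y)"
        using AE_borel_affine [where P = "\<lambda>x. W x = U x" and c = "-1" and t = x] WU by simp
      have "(LINT y:{a..x}|lborel. W (x - y) * (\<omega> y - \<phi>) * H y) = (LINT y|lborel. - p y)"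
        unfolding set_lebesgue_integral_def
      proof (rule integral_cong_AE)
        show "AE y in lborel. indicator {a..x} y *\<^sub>R (W (x - y) * (\<omega> y - \<phi>) * H y) = - p y"
          using WUx by eventually_elim (simp add: p_def algebra_simps)
      qed (auto simp: p_def)
      then have Hx: "H x + integral\<^sup>L lborel p = exp (\<Phi> * (x - a))" using Heq [of x] by simp
      have pI: "(\<integral>\<^sup>+y. ennreal (p y) \<partial>lborel) = ennreal (integral\<^sup>L lborel p)"
        by (rule nn_integral_eq_integral [OF pint]) (simp add: p0)
      have pI0: "0 \<le> integral\<^sup>L lborel p" using p0 by simp
      have pw: "w (x - y) * (c * h y) = ennreal (p y) + w (x - y) * e y" for y
      proof (cases "y \<in> {a..x}")
        case True
        have "U (x - y) * ((\<phi> - \<rho>) * H y) = U (x - y) * (\<phi> - \<omega> y) * H y + U (x - y) * ((\<omega> y - \<rho>) * H y)"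
          by (simp add: algebra_simps)
        then have "ennreal (U (x - y) * ((\<phi> - \<rho>) * H y)) =
            ennreal (U (x - y) * (\<phi> - \<omega> y) * H y) + ennreal (U (x - y) * ((\<omega> y - \<rho>) * H y))"
          using U(3) [of "x - y"] H0 [of y] om_le [of y] om_ge [of y] by (simp add: ennreal_plus)
        then show ?thesis
          using True U(3) [of "x - y"] H0 [of y] om_ge [of y] \<rho>\<phi>
          by (simp add: w_def c_def h_def e_def p_def ennreal_mult)
      next
        case False
        then show ?thesis using neg(2) [of "x - y"] left [of y] by (cases "y < a") (auto simp: p_def)
      qed
      have "c * conv w h x = conv w (\<lambda>y. c * h y) x" by (simp add: conv_cmult_right)
      also have "\<dots> = (\<integral>\<^sup>+y. ennreal (p y) \<partial>lborel) + conv w e x"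
        unfolding conv_def pw using pint by (intro nn_integral_add) auto
      finally have "h x + c * conv w h x = (ennreal (H x) + ennreal (integral\<^sup>L lborel p)) + conv w e x"
        using False by (simp add: pI h_def ac_simps)
      also have "ennreal (H x) + ennreal (integral\<^sup>L lborel p) = E x"
        using Hx H0 [of x] pI0 False by (simp add: E_def ennreal_plus [symmetric] del: ennreal_plus)
      finally have "h x + c * conv w h x = E x + conv w e x" .
      moreover have "conv w e x < \<infinity>"
      proof -
        have "conv w e x \<le> (\<integral>\<^sup>+y. ennreal C * indicator {a..x} y \<partial>lborel)"
          unfolding conv_def
        proof (rule nn_integral_mono)
          fix y
          show "w (x - y) * e y \<le> ennreal C * indicator {a..x} y"
          proof (cases "y \<in> {a..x}")
            case True
            have "U (x - y) * ((\<omega> y - \<rho>) * H y) \<le> C"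
              using UB [OF True, of "\<omega> y - \<rho>"] om_ge [of y] om_le [of y] \<rho> by (simp add: mult.assoc)
            then show ?thesis using True U(3) [of "x - y"] H0 [of y] om_ge [of y]
              by (simp add: w_def e_def ennreal_mult [symmetric] ennreal_leI)
          next
            case False
            then show ?thesis using neg(2) [of "x - y"] left [of y] by (cases "y < a") auto
          qed
        qed
        also have "\<dots> < \<infinity>" using False by (simp add: nn_integral_cmult_indicator ennreal_mult_less_top)
        finally show ?thesis .
      qed
      ultimately show ?thesis by simp
    qed
    \<comment> \<open>Mixing density: the first part is what the exponential leaves beyond x - a,
      the second is the source \<open>e\<close> reflected. Both live on s >= 0, since a <= 0 and
      \<omega> = \<rho> to the right of 0.\<close>
    define q where "q = (\<lambda>s. c * ennreal (exp (- \<Phi> * (a + s))) * indicator {- a<..} s + e (- s))"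
    have [measurable]: "q \<in> borel_measurable borel" unfolding q_def by measurable
    show ?thesis
    proof (rule log_convex_increments_mixture [OF V(4) V(1) V(3), where \<mu> = "density lborel q"])
      show "sets (density lborel q) = sets borel" by simp
      have "q s = 0" if "s < 0" for s
        using that a om_right [of "- s"] by (simp add: q_def e_def)
      then have "0 \<le> s" if "0 < q s" for s using that by (metis less_irrefl not_le)
      then show "AE s in density lborel q. 0 \<le> s" by (subst AE_density) auto
      fix x :: real assume x: "0 < x"
      define G where "G = (\<integral>\<^sup>+s. v (x + s) * (c * ennreal (exp (- \<Phi> * (a + s))) * indicator {- a<..} s) \<partial>lborel)"
      \<comment> \<open>A consequence of \<psi> \<Phi> = \<phi>. It writes \<open>E x\<close> as an
        integral of \<open>v\<close>; the part up to x - a is \<open>c * conv E v x\<close>, which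
        cancels against the left side of the resolvent equation, and the rest is
        \<open>G\<close>.\<close>
      have "c * laplace v \<Phi> = 1"
        using VL [OF t0(3)] \<rho>\<phi> Phi(2) by (simp add: c_def v_def ennreal_mult [symmetric])
      then have "E x = ennreal (exp (\<Phi> * (x - a))) * c * laplace v \<Phi>"
        using x a by (simp add: E_def mult.assoc)
      also have "\<dots> = (\<integral>\<^sup>+t. ennreal (exp (\<Phi> * (x - a))) * c * (v t * ennreal (exp (- \<Phi> * t))) \<partial>lborel)"
        unfolding laplace_def by (rule nn_integral_cmult [symmetric]) measurable
      also have "\<dots> = (\<integral>\<^sup>+t. c * (E (x - t) * v t) + v t * (c * ennreal (exp (\<Phi> * (x - a - t))) * indicator {x - a<..} t) \<partial>lborel)"
      proof (rule nn_integral_cong)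
        fix t
        have "ennreal (exp (\<Phi> * (x - a))) * ennreal (exp (- \<Phi> * t)) = ennreal (exp (\<Phi> * (x - a - t)))"
          by (simp add: ennreal_mult [symmetric] mult_exp_exp algebra_simps)
        then have "ennreal (exp (\<Phi> * (x - a))) * c * (v t * ennreal (exp (- \<Phi> * t))) = c * v t * ennreal (exp (\<Phi> * (x - a - t)))"
          by (metis (no_types, lifting) mult.assoc mult.commute)
        then show "ennreal (exp (\<Phi> * (x - a))) * c * (v t * ennreal (exp (- \<Phi> * t))) =
          c * (E (x - t) * v t) + v t * (c * ennreal (exp (\<Phi> * (x - a - t))) * indicator {x - a<..} t)"
          by (cases "t \<le> x - a") (auto simp: E_def ac_simps diff_diff_eq)
      qed
      also have "\<dots> = c * conv E v x + (\<integral>\<^sup>+t. v t * (c * ennreal (exp (\<Phi> * (x - a - t))) * indicator {x - a<..} t) \<partial>lborel)"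
        unfolding conv_def by (subst nn_integral_add, measurable, subst nn_integral_cmult, measurable)
      also have "(\<integral>\<^sup>+t. v t * (c * ennreal (exp (\<Phi> * (x - a - t))) * indicator {x - a<..} t) \<partial>lborel) =
          (\<integral>\<^sup>+s. v (s + x) * (c * ennreal (exp (\<Phi> * (x - a - (s + x)))) * indicator {x - a<..} (s + x)) \<partial>lborel)"
        by (rule nn_integral_lborel_translate [symmetric]) measurable
      also have "\<dots> = G"
        unfolding G_def by (intro nn_integral_cong) (auto simp: indicator_def algebra_simps)
      also have "conv E v x = conv v E x" by (rule conv_commute) measurable
      finally have Ex: "E x = c * conv v E x + G" .
      have "h x + c * conv v E x = E x + conv v e x"
        by (rule resolvent_equation [OF m res]) (use both in auto)
      then have "c * conv v E x + h x = c * conv v E x + (G + conv v e x)"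
        unfolding Ex by (simp only: ac_simps)
      moreover have "c * conv v E x \<noteq> top"
      proof
        assume "c * conv v E x = top"
        then have "E x = top" using Ex by simp
        then show False using x a by (simp add: E_def)
      qed
      ultimately have hx: "h x = G + conv v e x" unfolding ennreal_add_left_cancel by simp
      have ce: "conv v e x = (\<integral>\<^sup>+s. v (x + s) * e (- s) \<partial>lborel)"
        unfolding conv_def by (subst nn_integral_real_affine [where c = "-1" and t = 0]) auto
      have "ennreal (H x) = h x" using x a by (simp add: h_def)
      also have "\<dots> = (\<integral>\<^sup>+s. v (x + s) * q s \<partial>lborel)"
        unfolding hx ce G_def q_def distrib_left by (rule nn_integral_add [symmetric]) measurable
      also have "\<dots> = (\<integral>\<^sup>+s. ennreal (V (x + s)) \<partial>density lborel q)"
        by (subst nn_integral_density) (auto simp: v_def mult.commute)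
      finally show "ennreal (H x) = (\<integral>\<^sup>+s. ennreal (V (x + s)) \<partial>density lborel q)" .
    qed (rule H0)
  qed
qed

end

theorem proposition2p1:
  fixes M :: "'a measure" and X :: "real \<Rightarrow> 'a \<Rightarrow> real"
    and \<gamma> \<sigma> :: real and \<nu> :: "real measure"
    and \<omega> :: "real \<Rightarrow> real" and a \<phi> :: real and W H :: "real \<Rightarrow> real"
  assumes "spectrally_negative_levy M X \<gamma> \<sigma> \<nu>"
    and "\<not> decreasing_paths M X"
    and "bounded_variation_paths M X \<longrightarrow>
           absolutely_continuous (restrict_space lborel {0<..}) \<nu>"
    and "discounting_intensity \<omega> a \<phi>"
    and "is_scale_function (laplace_exponent \<gamma> \<sigma> \<nu>) \<phi> W"
    and "is_omega_scale_function (laplace_exponent \<gamma> \<sigma> \<nu>) \<omega> a \<phi> W H"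
    and "log_convex_on {0<..} (\<lambda>x. measure \<nu> {x<..})"
  shows "H differentiable_on {0<..} \<and>
         log_convex_on {0<..} (deriv H) \<and>
         convex_on {0<..} (deriv H)"
proof -
  interpret levy_exponent \<gamma> \<sigma> \<nu>
    using assms(1,7) by unfold_locales (auto simp: spectrally_negative_levy_def)
  \<comment> \<open>Were \<psi> nonpositive on the half-line, the paths would be decreasing. A point
    with \<psi> positive forces the growth of \<psi> on which \<Phi>(\<phi>) depends.\<close>
  obtain t1 where t1: "0 \<le> t1" "0 < \<psi> t1"
    using nonpos_exponent_imp_decreasing_paths [OF assms(1)] assms(2) by (meson not_le)
  then have "0 < t1" using psi_zero by (cases "t1 = 0") auto
  from omega_scale_log_convex_increments [OF this t1(2) assms(4,5,6)]
  show ?thesis by (rule log_convex_increments_imp_log_convex_deriv)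
qed

end
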